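(* Let $\mathbb{K}\in\{\mathbb{R},\mathbb{C},\mathbb{H}\}$, $\beta=\dim_{\mathbb{R}}\mathbb{K}$, $n\ge1$. Let $Z\in\mathbb{K}^{n\times n}$ be an arbitrary random matrix independent of a standard $\mathbb{K}$-Ginibre matrix $G_n^{\mathbb{K}}$. Then, for every $w\in\mathbb{K}$ and $s\ge0$, $$\mathbb{E}\,e^{-s|\mathrm{per}_{\mathbb{K}}(Z+G_n^{\mathbb{K}})-w|^2}\le\mathbb{E}\,e^{-s|\mathrm{per}_{\mathbb{K}}G_n^{\mathbb{K}}|^2}.$$ Moreover, $\mathrm{per}_{\mathbb{K}}(Z+G_n^{\mathbb{K}})/\sqrt{n!}$ has a density $q$ (with respect to Lebesgue measure on $\mathbb{K}\simeq\mathbb{R}^\beta$) satisfying $$\|q\|_\infty\le p_n^{\mathbb{K}}(0)\le\kappa_{n,\beta}.$$ Consequently, for every $\varepsilon>0$, $$\sup_{w\in\mathbb{K}}\mathbb{P}\left(|\mathrm{per}_{\mathbb{K}}(Z+G_n^{\mathbb{K}})-w|\le\varepsilon\sqrt{n!}\right)\le\min\{1,\omega_\beta\kappa_{n,\beta}\varepsilon^\beta\}.$$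
   Context: $\mathbb{H}$ denotes the quaternions. The row-ordered permanent of $A\in\mathbb{K}^{n\times n}$ is $\mathrm{per}_{\mathbb{K}}A=\sum_{\sigma\in S_n}a_{1,\sigma(1)}a_{2,\sigma(2)}\cdots a_{n,\sigma(n)}$. A standard $\mathbb{K}$-Gaussian has independent $N(0,1/\beta)$ real coordinates; a standard $\mathbb{K}$-Ginibre matrix $G_n^{\mathbb{K}}$ is $n\times n$ with i.i.d. standard $\mathbb{K}$-Gaussian entries. $p_n^{\mathbb{K}}$ is the radial density of $W_n^{\mathbb{K}}=\mathrm{per}_{\mathbb{K}}G_n^{\mathbb{K}}/\sqrt{n!}$ with respect to Lebesgue measure on $\mathbb{K}\simeq\mathbb{R}^\beta$, in the version that is nonincreasing in $|z|$ with $p_n^{\mathbb{K}}(0)=\|p_n^{\mathbb{K}}\|_\infty$ (such a density exists). $\omega_\beta=\pi^{\beta/2}/\Gamma(\beta/2+1)$ is the volume of the unit ball in $\mathbb{R}^\beta$, and $$\kappa_{n,\beta}=\frac{(n!)^{\beta/2}}{\pi^{\beta/2}}\left(\frac\beta2\right)^{\beta n/2}\frac{\Gamma(\beta/2)}{\Gamma(\beta n/2)}.$$ *)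

theory Defs
  imports "HOL-Probability.Probability" "HOL-Combinatorics.Permutations"
begin

section \<open>The quaternions\<close>

codatatype quat = Quat (qRe: real) (qI: real) (qJ: real) (qK: real)

lemma quat_eqI: "\<lbrakk>qRe x = qRe y; qI x = qI y; qJ x = qJ y; qK x = qK y\<rbrakk> \<Longrightarrow> x = y"
  by (rule quat.expand) simp

lemma quat_eq_iff: "x = y \<longleftrightarrow> qRe x = qRe y \<and> qI x = qI y \<and> qJ x = qJ y \<and> qK x = qK y"
  by (auto intro: quat.expand)

instantiation quat :: ab_group_add
begin

primcorec zero_quat where
  "qRe 0 = 0" | "qI 0 = 0" | "qJ 0 = 0" | "qK 0 = 0"

primcorec plus_quat where
  "qRe (x + y) = qRe x + qRe y"
| "qI (x + y) = qI x + qI y"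
| "qJ (x + y) = qJ x + qJ y"
| "qK (x + y) = qK x + qK y"

primcorec uminus_quat where
  "qRe (- x) = - qRe x"
| "qI (- x) = - qI x"
| "qJ (- x) = - qJ x"
| "qK (- x) = - qK x"

primcorec minus_quat where
  "qRe (x - y) = qRe x - qRe y"
| "qI (x - y) = qI x - qI y"
| "qJ (x - y) = qJ x - qJ y"
| "qK (x - y) = qK x - qK y"

instance
  by standard (simp_all add: quat_eq_iff)

end

instantiation quat :: ring_1
begin

primcorec one_quat where
  "qRe 1 = 1" | "qI 1 = 0" | "qJ 1 = 0" | "qK 1 = 0"

primcorec times_quat where
  "qRe (x * y) = qRe x * qRe y - qI x * qI y - qJ x * qJ y - qK x * qK y"
| "qI (x * y) = qRe x * qI y + qI x * qRe y + qJ x * qK y - qK x * qJ y"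
| "qJ (x * y) = qRe x * qJ y - qI x * qK y + qJ x * qRe y + qK x * qI y"
| "qK (x * y) = qRe x * qK y + qI x * qJ y - qJ x * qI y + qK x * qRe y"

instance
  by standard (simp_all add: quat_eq_iff algebra_simps)

end

lemma quat_sum_squares_eq_0:
  "(qRe x)\<^sup>2 + (qI x)\<^sup>2 + (qJ x)\<^sup>2 + (qK x)\<^sup>2 = 0 \<longleftrightarrow> x = 0"
  by (simp add: quat_eq_iff add_nonneg_eq_0_iff)

instantiation quat :: real_algebra_1
begin

primcorec scaleR_quat where
  "qRe (scaleR r x) = r * qRe x"
| "qI (scaleR r x) = r * qI x"
| "qJ (scaleR r x) = r * qJ x"
| "qK (scaleR r x) = r * qK x"

instance
  by standard (simp_all add: quat_eq_iff algebra_simps)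

end

definition qcnj :: "quat \<Rightarrow> quat" where
  "qcnj x = Quat (qRe x) (- qI x) (- qJ x) (- qK x)"

lemma qcnj_mult:
  "x * qcnj x = ((qRe x)\<^sup>2 + (qI x)\<^sup>2 + (qJ x)\<^sup>2 + (qK x)\<^sup>2) *\<^sub>R 1"
  "qcnj x * x = ((qRe x)\<^sup>2 + (qI x)\<^sup>2 + (qJ x)\<^sup>2 + (qK x)\<^sup>2) *\<^sub>R 1"
  by (simp_all add: quat_eq_iff qcnj_def power2_eq_square algebra_simps)

instantiation quat :: real_div_algebra
begin

definition inverse_quat :: "quat \<Rightarrow> quat" where
  "inverse x = qcnj x /\<^sub>R ((qRe x)\<^sup>2 + (qI x)\<^sup>2 + (qJ x)\<^sup>2 + (qK x)\<^sup>2)"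

definition divide_quat :: "quat \<Rightarrow> quat \<Rightarrow> quat" where
  "x div y = x * inverse y" for x y :: quat

instance
proof
  fix x y :: quat
  show "x \<noteq> 0 \<Longrightarrow> inverse x * x = 1" "x \<noteq> 0 \<Longrightarrow> x * inverse x = 1"
    by (simp_all add: inverse_quat_def qcnj_mult quat_sum_squares_eq_0)
  show "x div y = x * inverse y"
    by (simp add: divide_quat_def)
  show "inverse (0 :: quat) = 0"
    by (simp add: inverse_quat_def quat_eq_iff qcnj_def)
qed

end

instantiation quat :: real_inner
begin

definition inner_quat :: "quat \<Rightarrow> quat \<Rightarrow> real" where
  "inner x y = qRe x * qRe y + qI x * qI y + qJ x * qJ y + qK x * qK y"

definition norm_quat :: "quat \<Rightarrow> real" where
  "norm x = sqrt ((qRe x)\<^sup>2 + (qI x)\<^sup>2 + (qJ x)\<^sup>2 + (qK x)\<^sup>2)"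

definition sgn_quat :: "quat \<Rightarrow> quat" where
  "sgn x = x /\<^sub>R norm x" for x :: quat

definition dist_quat :: "quat \<Rightarrow> quat \<Rightarrow> real" where
  "dist x y = norm (x - y)" for x y :: quat

definition uniformity_quat :: "(quat \<times> quat) filter" where
  "uniformity = (INF e\<in>{0 <..}. principal {(x :: quat, y). dist x y < e})"

definition open_quat :: "quat set \<Rightarrow> bool" where
  "open U \<longleftrightarrow> (\<forall>x\<in>U. eventually (\<lambda>(x', y). x' = x \<longrightarrow> y \<in> U) uniformity)"
  for U :: "quat set"

instance
proof
  fix x y z :: quat and r :: real
  show "inner x y = inner y x"
    by (simp add: inner_quat_def mult.commute)
  show "inner (x + y) z = inner x z + inner y z"
    by (simp add: inner_quat_def algebra_simps)
  show "inner (scaleR r x) y = r * inner x y"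
    by (simp add: inner_quat_def algebra_simps)
  show "0 \<le> inner x x"
    by (simp add: inner_quat_def)
  show "inner x x = 0 \<longleftrightarrow> x = 0"
    using quat_sum_squares_eq_0[of x] by (simp add: inner_quat_def power2_eq_square)
  show "norm x = sqrt (inner x x)"
    by (simp add: inner_quat_def norm_quat_def power2_eq_square)
qed (rule sgn_quat_def dist_quat_def open_quat_def uniformity_quat_def)+

end

lemma quat_four_squares:
  fixes a b c d p q r s :: real
  shows "(a * p - b * q - c * r - d * s)\<^sup>2 + (a * q + b * p + c * s - d * r)\<^sup>2
       + (a * r - b * s + c * p + d * q)\<^sup>2 + (a * s + b * r - c * q + d * p)\<^sup>2
       = (a\<^sup>2 + b\<^sup>2 + c\<^sup>2 + d\<^sup>2) * (p\<^sup>2 + q\<^sup>2 + r\<^sup>2 + s\<^sup>2)"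
  by algebra

instance quat :: real_normed_div_algebra
proof
  fix x y :: quat
  show "norm (x * y) = norm x * norm y"
    unfolding norm_quat_def times_quat.sel quat_four_squares by (rule real_sqrt_mult)
qed

instantiation quat :: euclidean_space
begin

definition Basis_quat :: "quat set" where
  "Basis = {Quat 1 0 0 0, Quat 0 1 0 0, Quat 0 0 1 0, Quat 0 0 0 1}"

instance
proof
  show "(Basis :: quat set) \<noteq> {}" "finite (Basis :: quat set)"
    by (simp_all add: Basis_quat_def)
  fix x u v :: quat
  show "u \<in> Basis \<Longrightarrow> v \<in> Basis \<Longrightarrow> inner u v = (if u = v then 1 else 0)"
    unfolding Basis_quat_def insert_iff empty_iff by (elim disjE) (simp_all add: inner_quat_def)
  show "(\<forall>u\<in>Basis. inner x u = 0) \<longleftrightarrow> x = 0"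
    by (simp add: Basis_quat_def inner_quat_def quat_eq_iff [of x 0])
qed

end

lemma DIM_quat [simp]: "DIM(quat) = 4"
  by (simp add: Basis_quat_def)


section \<open>The scalars\<close>

text \<open>The scalars are given as a type variable \<open>'k\<close> whose multiplication and Euclidean norm make
  it a copy of the reals, the complex numbers or the quaternions. The three types themselves
  satisfy the predicate.\<close>

definition isometric_algebra_iso ::
    "('a::{euclidean_space,real_normed_div_algebra} \<Rightarrow>
      'b::{euclidean_space,real_normed_div_algebra}) \<Rightarrow> bool" where
  "isometric_algebra_iso f \<longleftrightarrow>
     linear f \<and> bij f \<and> f 1 = 1 \<and> (\<forall>x y. f (x * y) = f x * f y) \<and> (\<forall>x. norm (f x) = norm x)"

definition real_complex_or_quaternion ::
    "'k::{euclidean_space,real_normed_div_algebra} itself \<Rightarrow> bool" where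
  "real_complex_or_quaternion _ \<longleftrightarrow>
     (\<exists>f :: 'k \<Rightarrow> real. isometric_algebra_iso f) \<or>
     (\<exists>f :: 'k \<Rightarrow> complex. isometric_algebra_iso f) \<or>
     (\<exists>f :: 'k \<Rightarrow> quat. isometric_algebra_iso f)"

lemma isometric_algebra_iso_id: "isometric_algebra_iso (\<lambda>x. x)"
  by (simp add: isometric_algebra_iso_def linear_ident bij_id[unfolded id_def])

lemma real_complex_or_quaternion_instances:
  "real_complex_or_quaternion TYPE(real)"
  "real_complex_or_quaternion TYPE(complex)"
  "real_complex_or_quaternion TYPE(quat)"
  unfolding real_complex_or_quaternion_def using isometric_algebra_iso_id by blast+


section \<open>Random matrices and permanents\<close>

text \<open>An \<open>n\<close> by \<open>n\<close> matrix is a function on index pairs, of which only the entries with both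
  indices in \<open>{1..n}\<close> matter. As points of the product space \<open>mat_borel n\<close>, matrices take the
  value \<open>undefined\<close> at all other pairs.\<close>

type_synonym 'k mat = "nat \<times> nat \<Rightarrow> 'k"

abbreviation mat_idx :: "nat \<Rightarrow> (nat \<times> nat) set" where
  "mat_idx n \<equiv> {1..n} \<times> {1..n}"

definition mat_borel :: "nat \<Rightarrow> 'k::euclidean_space mat measure" where
  "mat_borel n = (\<Pi>\<^sub>M ij\<in>mat_idx n. borel)"

text \<open>The list product keeps the factors in row order, which matters for quaternions.\<close>

definition row_per :: "nat \<Rightarrow> 'k::ring_1 mat \<Rightarrow> 'k" where
  "row_per n A =
     (\<Sum>\<sigma> | \<sigma> permutes {1..n}. prod_list (map (\<lambda>i. A (i, \<sigma> i)) [1..<Suc n]))"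

text \<open>The second parameter of \<open>normal_density\<close> is the standard deviation.\<close>

definition std_gaussian :: "'w measure \<Rightarrow> ('w \<Rightarrow> 'k::euclidean_space) \<Rightarrow> bool" where
  "std_gaussian M X \<longleftrightarrow>
     prob_space.indep_vars M (\<lambda>_. borel) (\<lambda>b \<omega>. X \<omega> \<bullet> b) Basis \<and>
     (\<forall>b\<in>Basis. distributed M lborel (\<lambda>\<omega>. X \<omega> \<bullet> b)
        (\<lambda>x. ennreal (normal_density 0 (sqrt (1 / real DIM('k))) x)))"

definition std_ginibre :: "'w measure \<Rightarrow> nat \<Rightarrow> ('w \<Rightarrow> 'k::euclidean_space mat) \<Rightarrow> bool" where
  "std_ginibre M n G \<longleftrightarrow>
     G \<in> measurable M (mat_borel n) \<and>
     prob_space.indep_vars M (\<lambda>_. borel) (\<lambda>ij \<omega>. G \<omega> ij) (mat_idx n) \<and>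
     (\<forall>ij\<in>mat_idx n. std_gaussian M (\<lambda>\<omega>. G \<omega> ij))"


section \<open>Densities\<close>

definition has_density ::
    "'w measure \<Rightarrow> ('w \<Rightarrow> 'k::euclidean_space) \<Rightarrow> ('k \<Rightarrow> real) \<Rightarrow> bool" where
  "has_density M X q \<longleftrightarrow> (\<forall>x. 0 \<le> q x) \<and> distributed M lborel X (\<lambda>x. ennreal (q x))"

definition Linf_norm :: "('k::euclidean_space \<Rightarrow> real) \<Rightarrow> ereal" where
  "Linf_norm q = esssup lborel (\<lambda>x. ereal \<bar>q x\<bar>)"

text \<open>The monotonicity clause, applied to points of equal norm, also says that \<open>p\<close> is radial.
  The last clause determines \<open>p 0\<close> from the law of \<open>X\<close>.\<close>

definition has_radial_density ::
    "'w measure \<Rightarrow> ('w \<Rightarrow> 'k::euclidean_space) \<Rightarrow> ('k \<Rightarrow> real) \<Rightarrow> bool" where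
  "has_radial_density M X p \<longleftrightarrow>
     has_density M X p \<and>
     (\<forall>x y. norm x \<le> norm y \<longrightarrow> p y \<le> p x) \<and>
     ereal (p 0) = Linf_norm p"

definition kappa :: "nat \<Rightarrow> nat \<Rightarrow> real" where
  "kappa n \<beta> =
     fact n powr (real \<beta> / 2) / pi powr (real \<beta> / 2) *
     (real \<beta> / 2) powr (real \<beta> * real n / 2) *
     (Gamma (real \<beta> / 2) / Gamma (real \<beta> * real n / 2))"

end

theory Submission
  imports Defs
begin

text \<open>The proof rests on the fact that Gaussian functions are averages of characters. Let d be the
  real dimension of the scalars, so that d is 1, 2 or 4, and let P(n) be the permanent of an n
  by n Ginibre matrix.

  The Laplace inequality. The function exp(-s |y|^2) is the average of the characters exp(i c <xi,
  y>), with c = sqrt (2 s d), over a standard Gaussian xi. For a linear map T and a Gaussian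
  vector g, the average of a character of T g + a is a positive number times a phase that
  depends on a. Hence E exp(-s |T g + a|^2) is largest for a = 0
  (\<open>gauss_lin_on_shift_le\<close>). The permanent is linear in each row, without a
  constant term, so conditionally on Z the rows of Z, and with them w, can be dropped one row
  after the other (\<open>shifted_per_le_laplace_per\<close>).

  The constant. The number kappa is what one gets if |P(n)| is replaced by a product of
  independent norms |g_1| ... |g_n|, with g_m a standard Gaussian vector of m scalars, as for
  the determinant. The comparison comes from E exp(-s |P(n)|^2) <= E exp(-s |u|^2 |P(n-1)|^2),
  where u is the last row of the matrix and is independent of P(n-1). To see this, fix u and
  pick two columns p, q. As a function of the other entries of these columns the permanent is
  bilinear, and symmetric up to the two entries of u. The Gaussian average of a character of
  such a form has modulus D exp(-|u_p|^2 A - |u_q|^2 B), where D, A and B depend on u_p and u_q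
  only through their directions, and it equals its modulus as soon as one of the two entries
  vanishes. By convexity of exp, the average is at most a convex combination of two averages in
  which the whole norm of (u_p, u_q) sits in one column
  (\<open>laplace_last_row_split_le\<close>). After finitely many such steps u has a single
  entry, and the permanent is |u| times one of size n - 1 (\<open>laplace_last_row_le\<close>).
  Iterating, and computing the moment E |g_m|^(-d) with the Gamma integral, gives E exp(-s
  |P(n)|^2) <= C s^(-d/2) with the right C (\<open>laplace_per_decay\<close>).

  From transforms to densities. The functions (s/pi)^(d/2) exp(-s |y|^2) form an approximate
  identity for large s. Therefore a measure whose transforms, the integrals of exp(-s |y -
  w|^2), are at most c (pi/s)^(d/2) for all s and w is at most c times Lebesgue measure
  (\<open>gauss_transform_bound_imp_emeasure_le\<close>), and a probability measure is
  determined by these transforms (\<open>gauss_transform_inject\<close>). Given rows 2 to n, the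
  normalised permanent of the Ginibre matrix is a centred isotropic Gaussian with a random
  scale. Its density is thus a mixture of centred Gaussian densities, which is radial and
  nonincreasing, and the decay bound controls its value at 0
  (\<open>gaussian_mixture_density\<close>, \<open>permanent_radial_density\<close>). The
  Laplace inequality transfers that bound to the shifted matrix, and the small-ball estimate
  follows by integrating the density over a ball.\<close>

section \<open>The standard Gaussian measure of a Euclidean space\<close>

text \<open>The coordinates are independent of variance 1/d, where d is the dimension. The product form is
  close to the probabilistic definition of a standard Gaussian; the density is derived in
  \<open>gauss_eq_density\<close>.\<close>

definition gauss :: "'a::euclidean_space measure" where
  "gauss = distr (\<Pi>\<^sub>M b\<in>Basis. density lborel (normal_density 0 (sqrt (1 / real DIM('a)))))
             borel (\<lambda>f. \<Sum>b\<in>Basis. f b *\<^sub>R b)"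

lemma sets_gauss [simp, measurable_cong]: "sets gauss = sets borel"
  and space_gauss [simp]: "space gauss = UNIV"
  by (simp_all add: gauss_def)

lemma measurable_sum_Basis [measurable]:
  "(\<lambda>f. \<Sum>b\<in>Basis. f b *\<^sub>R b) \<in>
     measurable (\<Pi>\<^sub>M b\<in>(Basis :: 'a::euclidean_space set). density lborel (f b)) borel"
  by (intro borel_measurable_sum borel_measurable_scaleR measurable_const)
     (auto intro!: measurable_PiM_component_rev)

lemma product_prob_space_normal: "0 < \<sigma> \<Longrightarrow> product_prob_space (\<lambda>_. density lborel (normal_density 0 \<sigma>))"
  by (intro product_prob_spaceI prob_space_normal_density) 

interpretation gauss: prob_space "gauss :: 'a::euclidean_space measure"
proof -
  have "prob_space (PiM (Basis :: 'a set) (\<lambda>_. density lborel (normal_density 0 (sqrt (1 / real DIM('a))))))"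
    by (intro prob_space_PiM prob_space_normal_density) simp
  then show "prob_space (gauss :: 'a measure)"
    unfolding gauss_def by (rule prob_space.prob_space_distr) (rule measurable_sum_Basis)
qed

interpretation gauss_PiM: product_prob_space "\<lambda>_. gauss" for I
  by unfold_locales

abbreviation gauss_vec :: "'i set \<Rightarrow> ('i \<Rightarrow> 'a::euclidean_space) measure" where
  "gauss_vec I \<equiv> PiM I (\<lambda>_. gauss)"

abbreviation gexp :: "real \<Rightarrow> 'a::real_normed_vector \<Rightarrow> ennreal" where
  "gexp s y \<equiv> ennreal (exp (- s * (norm y)\<^sup>2))"

lemma component_gauss: "i \<in> I \<Longrightarrow> (\<lambda>x. x i) \<in> borel_measurable (PiM I (\<lambda>_. gauss))"
  using measurable_component_singleton[of i I "\<lambda>_. gauss"] by (simp cong: measurable_cong_sets)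

lemma norm_square_eq_sum_Basis: "(norm x)\<^sup>2 = (\<Sum>b\<in>Basis. (x \<bullet> b)\<^sup>2)"
  unfolding power2_norm_eq_inner by (subst euclidean_inner) (simp add: power2_eq_square)

lemma nn_integral_exp_neg_square:
  assumes "0 < s"
  shows "(\<integral>\<^sup>+x. ennreal (exp (- s * x\<^sup>2)) \<partial>lborel) = ennreal (sqrt (pi / s))"
proof -
  define \<sigma> where "\<sigma> = sqrt (1 / (2 * s))"
  have \<sigma>: "\<sigma> > 0" "\<sigma>\<^sup>2 = 1 / (2 * s)" using assms by (auto simp: \<sigma>_def)
  have "exp (- s * x\<^sup>2) = sqrt (pi / s) * normal_density 0 \<sigma> x" for x
    using assms by (simp add: normal_density_def \<sigma>(2))
  then have "(\<integral>\<^sup>+x. ennreal (exp (- s * x\<^sup>2)) \<partial>lborel) =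
      (\<integral>\<^sup>+x. ennreal (sqrt (pi / s)) * ennreal (normal_density 0 \<sigma> x) \<partial>lborel)"
    using assms by (simp add: ennreal_mult)
  also have "\<dots> = ennreal (sqrt (pi / s))"
    using \<sigma> by (simp add: nn_integral_cmult nn_integral_eq_integral)
  finally show ?thesis .
qed

lemma nn_integral_lborel_exp_neg_norm_square:
  fixes w :: "'a::euclidean_space"
  assumes "0 < s"
  shows "(\<integral>\<^sup>+x. gexp s (x - w) \<partial>lborel) = ennreal ((pi / s) powr (real DIM('a) / 2))"
proof -
  have "exp (- s * (norm (x - w))\<^sup>2) = (\<Prod>b\<in>Basis. exp (- s * (x \<bullet> b - w \<bullet> b)\<^sup>2))" for x
    by (simp add: exp_sum[symmetric] sum_distrib_left[symmetric] inner_diff_left[symmetric]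
        norm_square_eq_sum_Basis sum_negf)
  then have "(\<integral>\<^sup>+x. gexp s (x - w) \<partial>lborel) =
      (\<integral>\<^sup>+x. (\<Prod>b\<in>Basis. ennreal (exp (- s * (x \<bullet> b - w \<bullet> b)\<^sup>2))) \<partial>lborel)"
    by (simp add: prod_ennreal)
  also have "\<dots> = (\<Prod>b\<in>Basis. (\<integral>\<^sup>+x. ennreal (exp (- s * (x - w \<bullet> b)\<^sup>2)) \<partial>lborel))"
    by (intro nn_integral_lborel_prod) auto
  also have "\<dots> = (\<Prod>b\<in>(Basis :: 'a set). ennreal (sqrt (pi / s)))"
  proof (rule prod.cong[OF refl])
    fix b
    show "(\<integral>\<^sup>+x. ennreal (exp (- s * (x - w \<bullet> b)\<^sup>2)) \<partial>lborel) = ennreal (sqrt (pi / s))"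
      by (subst nn_integral_real_affine[where c = 1 and t = "w \<bullet> b"])
         (auto simp: nn_integral_exp_neg_square[OF assms, simplified])
  qed
  also have "(\<Prod>b\<in>(Basis :: 'a set). ennreal (sqrt (pi / s))) = ennreal ((pi / s) powr (real DIM('a) / 2))"
  proof -
    have "sqrt (pi / s) ^ DIM('a) = (pi / s) powr (real DIM('a) / 2)"
      using assms by (simp add: powr_half_sqrt[symmetric] powr_powr flip: powr_realpow)
    then show ?thesis using assms by (simp add: ennreal_power)
  qed
  finally show ?thesis .
qed

text \<open>Both Lebesgue measure and \<open>gauss\<close> are images of product measures over the
  coordinates under the same map, so it suffices to multiply the one-dimensional densities.\<close>

lemma gauss_eq_density:
  "(gauss :: 'a::euclidean_space measure) = density lborel
     (\<lambda>x. ennreal ((real DIM('a) / (2 * pi)) powr (real DIM('a) / 2) * exp (- (real DIM('a) / 2) * (norm x)\<^sup>2)))"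
proof -
  define n where "n = normal_density 0 (sqrt (1 / real DIM('a)))"
  have n [measurable]: "n \<in> borel_measurable borel" by (simp add: n_def)
  have n0: "n x \<ge> 0" for x by (simp add: n_def)
  interpret P: product_prob_space "\<lambda>_ :: 'a. density lborel n"
    unfolding n_def by (rule product_prob_space_normal) simp
  interpret L: product_sigma_finite "\<lambda>_ :: 'a. lborel :: real measure" ..
  have prod: "PiM Basis (\<lambda>_ :: 'a. density lborel n) =
      density (PiM Basis (\<lambda>_ :: 'a. lborel)) (\<lambda>x. \<Prod>b\<in>Basis. ennreal (n (x b)))"
  proof (rule P.PiM_eqI[symmetric])
    fix A :: "'a \<Rightarrow> real set" assume A: "\<And>i. i \<in> Basis \<Longrightarrow> A i \<in> sets (density lborel n)"
    have "emeasure (density (PiM Basis (\<lambda>_ :: 'a. lborel)) (\<lambda>x. \<Prod>b\<in>Basis. ennreal (n (x b)))) (Pi\<^sub>E Basis A)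
      = (\<integral>\<^sup>+x. (\<Prod>b\<in>Basis. ennreal (n (x b))) * indicator (Pi\<^sub>E Basis A) x \<partial>PiM Basis (\<lambda>_ :: 'a. lborel))"
      using A by (intro emeasure_density) (auto intro!: sets_PiM_I_finite)
    also have "\<dots> = (\<integral>\<^sup>+x. (\<Prod>b\<in>Basis. ennreal (n (x b)) * indicator (A b) (x b)) \<partial>PiM Basis (\<lambda>_ :: 'a. lborel))"
    proof (rule nn_integral_cong)
      fix x assume "x \<in> space (PiM Basis (\<lambda>_ :: 'a. lborel :: real measure))"
      then have "indicator (Pi\<^sub>E Basis A) x = (\<Prod>b\<in>Basis. indicator (A b) (x b) :: ennreal)"
        by (auto simp: indicator_def space_PiM PiE_iff prod_zero_iff)
      then show "(\<Prod>b\<in>Basis. ennreal (n (x b))) * indicator (Pi\<^sub>E Basis A) x =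
          (\<Prod>b\<in>Basis. ennreal (n (x b)) * indicator (A b) (x b))"
        by (simp add: prod.distrib)
    qed
    also have "\<dots> = (\<Prod>b\<in>Basis. \<integral>\<^sup>+x. ennreal (n x) * indicator (A b) x \<partial>lborel)"
      using A by (intro L.product_nn_integral_prod) auto
    also have "\<dots> = (\<Prod>b\<in>Basis. emeasure (density lborel n) (A b))"
      using A by (intro prod.cong refl) (auto simp: emeasure_density)
    finally show "emeasure (density (PiM Basis (\<lambda>_ :: 'a. lborel)) (\<lambda>x. \<Prod>b\<in>Basis. ennreal (n (x b)))) (Pi\<^sub>E Basis A)
      = (\<Prod>b\<in>Basis. emeasure (density lborel n) (A b))" .
  qed (auto cong: sets_PiM_cong)
  have "gauss = distr (density (PiM Basis (\<lambda>_ :: 'a. lborel)) (\<lambda>x. \<Prod>b\<in>Basis. ennreal (n (x b)))) borel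
          (\<lambda>f. \<Sum>b\<in>Basis. f b *\<^sub>R b)"
    unfolding gauss_def prod[symmetric] by (simp add: n_def)
  also have "\<dots> = distr (density (PiM Basis (\<lambda>_ :: 'a. lborel)) 
      (\<lambda>x. (\<lambda>y. \<Prod>b\<in>Basis. ennreal (n (y \<bullet> b))) (\<Sum>b\<in>Basis. x b *\<^sub>R b))) borel
          (\<lambda>f. \<Sum>b\<in>Basis. f b *\<^sub>R b)"
    by simp
  also have "\<dots> = density (distr (PiM Basis (\<lambda>_ :: 'a. lborel)) borel (\<lambda>f. \<Sum>b\<in>Basis. f b *\<^sub>R b))
      (\<lambda>y. \<Prod>b\<in>Basis. ennreal (n (y \<bullet> b)))"
    by (rule density_distr[symmetric]) measurable
  also have "\<dots> = density lborel (\<lambda>y. \<Prod>b\<in>Basis. ennreal (n (y \<bullet> b)))"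
    by (simp only: lborel_eq[symmetric])
  also have "(\<lambda>y::'a. \<Prod>b\<in>Basis. ennreal (n (y \<bullet> b))) = 
    (\<lambda>x. ennreal ((real DIM('a) / (2 * pi)) powr (real DIM('a) / 2) * exp (- (real DIM('a) / 2) * (norm x)\<^sup>2)))"
  proof
    fix y :: 'a
    have "n t = sqrt (real DIM('a) / (2 * pi)) * exp (- (real DIM('a) / 2) * t\<^sup>2)" for t
      by (simp add: n_def normal_density_def real_sqrt_divide field_simps)
    then have "(\<Prod>b\<in>Basis. n (y \<bullet> b)) =
        sqrt (real DIM('a) / (2 * pi)) ^ DIM('a) * exp (\<Sum>b\<in>Basis. - (real DIM('a) / 2) * (y \<bullet> b)\<^sup>2)"
      by (simp add: exp_sum prod.distrib)
    also have "(\<Sum>b\<in>Basis. - (real DIM('a) / 2) * (y \<bullet> b)\<^sup>2) = - (real DIM('a) / 2) * (norm y)\<^sup>2"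
      unfolding sum_distrib_left[symmetric]
      by (simp add: norm_square_eq_sum_Basis)
    also have "sqrt (real DIM('a) / (2 * pi)) ^ DIM('a) = (real DIM('a) / (2 * pi)) powr (real DIM('a) / 2)"
      by (simp add: powr_half_sqrt[symmetric] powr_powr flip: powr_realpow)
    finally show "(\<Prod>b\<in>Basis. ennreal (n (y \<bullet> b))) =
      ennreal ((real DIM('a) / (2 * pi)) powr (real DIM('a) / 2) * exp (- (real DIM('a) / 2) * (norm y)\<^sup>2))"
      by (simp add: prod_ennreal n0)
  qed
  finally show ?thesis .
qed

lemma nn_integral_gauss_exp_neg_norm_square:
  assumes "0 \<le> s"
  shows "(\<integral>\<^sup>+x. gexp s x \<partial>(gauss :: 'a::euclidean_space measure)) =
    ennreal ((1 + 2 * s / real DIM('a)) powr (- (real DIM('a) / 2)))"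
proof -
  let ?d = "real DIM('a)"
  have eq: "ennreal (c * exp (- (?d / 2) * r)) * ennreal (exp (- s * r)) =
      ennreal c * ennreal (exp (- (s + ?d / 2) * r))" if "0 \<le> c" for c r
    using that by (simp add: ennreal_mult[symmetric] mult.assoc exp_add[symmetric] distrib_right[symmetric])
       (simp add: algebra_simps)
  have "(\<integral>\<^sup>+x. gexp s x \<partial>(gauss :: 'a measure)) =
      (\<integral>\<^sup>+x. ennreal ((?d / (2 * pi)) powr (?d / 2)) * gexp (s + ?d / 2) (x - 0 :: 'a) \<partial>lborel)"
    unfolding gauss_eq_density by (subst nn_integral_density) (simp_all only: eq powr_ge_zero diff_zero, measurable)
  also have "\<dots> = ennreal ((?d / (2 * pi)) powr (?d / 2)) * ennreal ((pi / (s + ?d / 2)) powr (?d / 2))"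
    using assms by (subst nn_integral_cmult, measurable, subst nn_integral_lborel_exp_neg_norm_square)
      (simp_all add: add_nonneg_pos)
  also have "\<dots> = ennreal (((?d / (2 * pi)) * (pi / (s + ?d / 2))) powr (?d / 2))"
    unfolding powr_mult by (rule ennreal_mult[symmetric]) simp_all
  also have "(?d / (2 * pi)) * (pi / (s + ?d / 2)) = inverse (1 + 2 * s / ?d)"
    using assms by (simp add: field_simps)
  also have "inverse (1 + 2 * s / ?d) powr (?d / 2) = (1 + 2 * s / ?d) powr (- (?d / 2))"
    using assms by (simp add: powr_minus inverse_powr)
  finally show ?thesis .
qed

lemma integral_normal_iexp:
  assumes "0 < \<sigma>"
  shows "(\<integral>x. iexp (x * t) \<partial>density lborel (normal_density 0 \<sigma>)) = complex_of_real (exp (- (\<sigma> * t)\<^sup>2 / 2))"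
proof -
  interpret S: real_distribution std_normal_distribution by (rule real_dist_normal_dist)
  have "distributed std_normal_distribution lborel (\<lambda>x. x) std_normal_density"
    unfolding distributed_def by (simp add: distr_id2)
  from S.normal_density_affine[OF this, of \<sigma> 0] assms
  have "distributed std_normal_distribution lborel (\<lambda>x. \<sigma> * x) (normal_density 0 \<sigma>)" by simp
  then have "density lborel (normal_density 0 \<sigma>) = distr std_normal_distribution lborel (\<lambda>x. \<sigma> * x)"
    by (simp add: distributed_distr_eq_density)
  then have "(\<integral>x. iexp (x * t) \<partial>density lborel (normal_density 0 \<sigma>)) = (\<integral>x. iexp (\<sigma> * x * t) \<partial>std_normal_distribution)"
    by (simp add: integral_distr)
  also have "\<dots> = char std_normal_distribution (\<sigma> * t)"
    unfolding char_def by (intro Bochner_Integration.integral_cong refl) (simp add: mult_ac)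
  finally show ?thesis by (simp add: char_std_normal_distribution)
qed

lemma integral_gauss_iexp:
  fixes a :: "'a::euclidean_space"
  shows "(\<integral>x. iexp (x \<bullet> a) \<partial>gauss) = complex_of_real (exp (- (norm a)\<^sup>2 / (2 * real DIM('a))))"
proof -
  define \<sigma> where "\<sigma> = sqrt (1 / real DIM('a))"
  have \<sigma>: "0 < \<sigma>" by (simp add: \<sigma>_def)
  interpret P: product_prob_space "\<lambda>_ :: 'a. density lborel (normal_density 0 \<sigma>)"
    by (rule product_prob_space_normal[OF \<sigma>])
  have N: "finite_measure (density lborel (normal_density 0 \<sigma>))"
    using prob_space_normal_density[OF \<sigma>, of 0] by (rule prob_space.finite_measure)
  have "(\<integral>x. iexp (x \<bullet> a) \<partial>gauss) =
      (\<integral>f. iexp ((\<Sum>b\<in>Basis. f b *\<^sub>R b) \<bullet> a) \<partial>PiM Basis (\<lambda>_. density lborel (normal_density 0 \<sigma>)))"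
    unfolding gauss_def \<sigma>_def[symmetric] by (intro integral_distr) auto
  also have "\<dots> = (\<integral>f. (\<Prod>b\<in>Basis. iexp (f b * (b \<bullet> a))) \<partial>PiM Basis (\<lambda>_. density lborel (normal_density 0 \<sigma>)))"
    by (simp add: inner_sum_left exp_sum[symmetric] sum_distrib_left)
  also have "\<dots> = (\<Prod>b\<in>Basis. \<integral>x. iexp (x * (b \<bullet> a)) \<partial>density lborel (normal_density 0 \<sigma>))"
    by (intro P.product_integral_prod finite_measure.integrable_const_bound[OF N, where B = 1]) auto
  also have "\<dots> = complex_of_real (\<Prod>b\<in>Basis. exp (- (\<sigma> * (a \<bullet> b))\<^sup>2 / 2))"
    by (simp only: integral_normal_iexp[OF \<sigma>] of_real_prod inner_commute)
  also have "(\<Prod>b\<in>Basis. exp (- (\<sigma> * (a \<bullet> b))\<^sup>2 / 2)) = exp (- (\<sigma>\<^sup>2 / 2) * (\<Sum>b\<in>Basis. (a \<bullet> b)\<^sup>2))"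
    by (simp add: exp_sum[symmetric] sum_distrib_left power_mult_distrib sum_negf)
  also have "(\<Sum>b\<in>Basis. (a \<bullet> b)\<^sup>2) = (norm a)\<^sup>2"
    by (simp add: norm_square_eq_sum_Basis)
  finally show ?thesis by (simp add: \<sigma>_def)
qed

lemma integral_PiM_gauss_iexp:
  fixes a :: "'i \<Rightarrow> 'a::euclidean_space"
  assumes "finite I"
  shows "(\<integral>x. iexp (\<Sum>i\<in>I. x i \<bullet> a i) \<partial>gauss_vec I) =
    complex_of_real (exp (- (\<Sum>i\<in>I. (norm (a i))\<^sup>2) / (2 * real DIM('a))))"
proof -
  have "(\<integral>x. iexp (\<Sum>i\<in>I. x i \<bullet> a i) \<partial>gauss_vec I) =
      (\<integral>x. (\<Prod>i\<in>I. iexp (x i \<bullet> a i)) \<partial>gauss_vec I)"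
    using assms by (simp add: exp_sum sum_distrib_left)
  also have "\<dots> = (\<Prod>i\<in>I. \<integral>x. iexp (x \<bullet> a i) \<partial>gauss)"
    using assms by (intro gauss_PiM.product_integral_prod gauss.integrable_const_bound[where B = 1]) auto
  also have "\<dots> = complex_of_real (\<Prod>i\<in>I. exp (- (norm (a i))\<^sup>2 / (2 * real DIM('a))))"
    by (simp add: integral_gauss_iexp)
  also have "(\<Prod>i\<in>I. exp (- (norm (a i))\<^sup>2 / (2 * real DIM('a)))) =
      exp (- (\<Sum>i\<in>I. (norm (a i))\<^sup>2) / (2 * real DIM('a)))"
    using assms by (simp add: exp_sum[symmetric] sum_divide_distrib sum_negf)
  finally show ?thesis .
qed

text \<open>This representation of a Gaussian function by characters turns inequalities for it into
  inequalities for characteristic functions.\<close>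

lemma exp_neg_norm_square_eq_integral:
  fixes y :: "'a::euclidean_space"
  assumes "0 \<le> s"
  shows "complex_of_real (exp (- s * (norm y)\<^sup>2)) = (\<integral>\<xi>. iexp (sqrt (2 * s * real DIM('a)) * (\<xi> \<bullet> y)) \<partial>gauss)"
  using integral_gauss_iexp[of "sqrt (2 * s * real DIM('a)) *\<^sub>R y"] assms
  by (simp add: power_mult_distrib field_simps)

text \<open>Independence of the coordinates says that their joint law is a product measure, and a vector is
  recovered from its coordinates by the map that defines \<open>gauss\<close>.\<close>

lemma distr_std_gaussian:
  fixes X :: "'w \<Rightarrow> 'k::euclidean_space"
  assumes M: "prob_space M" and X: "std_gaussian M X"
  shows "X \<in> borel_measurable M" "distr M borel X = gauss"
proof -
  interpret prob_space M by fact
  let ?N = "density lborel (normal_density 0 (sqrt (1 / real DIM('k))))"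
  have ind: "indep_vars (\<lambda>_. borel) (\<lambda>b \<omega>. X \<omega> \<bullet> b) Basis"
    and d: "\<And>b. b \<in> Basis \<Longrightarrow> distributed M lborel (\<lambda>\<omega>. X \<omega> \<bullet> b) (normal_density 0 (sqrt (1 / real DIM('k))))"
    using X by (auto simp: std_gaussian_def)
  have [measurable]: "b \<in> Basis \<Longrightarrow> (\<lambda>\<omega>. X \<omega> \<bullet> b) \<in> borel_measurable M" for b
    using distributed_measurable[OF d[of b]] by simp
  have "(\<lambda>\<omega>. \<Sum>b\<in>Basis. (X \<omega> \<bullet> b) *\<^sub>R b) \<in> borel_measurable M" by measurable
  then show [measurable]: "X \<in> borel_measurable M" by (simp add: euclidean_representation)
  have D: "distr M borel (\<lambda>\<omega>. X \<omega> \<bullet> b) = ?N" if "b \<in> Basis" for b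
    using distributed_distr_eq_density[OF d[OF that]] by (simp cong: distr_cong)
  have "distr M (\<Pi>\<^sub>M b\<in>Basis. borel) (\<lambda>x. \<lambda>b\<in>Basis. X x \<bullet> b) = (\<Pi>\<^sub>M b\<in>(Basis :: 'k set). distr M borel (\<lambda>\<omega>. X \<omega> \<bullet> b))"
    using ind by (subst (asm) indep_vars_iff_distr_eq_PiM') auto
  also have "\<dots> = (\<Pi>\<^sub>M b\<in>Basis. ?N)" by (intro PiM_cong refl D)
  finally have "gauss = distr (distr M (\<Pi>\<^sub>M b\<in>(Basis :: 'k set). borel) (\<lambda>x. \<lambda>b\<in>Basis. X x \<bullet> b)) borel (\<lambda>f. \<Sum>b\<in>Basis. f b *\<^sub>R b)"
    unfolding gauss_def by simp
  also have "\<dots> = distr M borel (\<lambda>x. \<Sum>b\<in>Basis. (X x \<bullet> b) *\<^sub>R b)"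
    by (subst distr_distr) (auto simp: comp_def intro!: borel_measurable_sum borel_measurable_scaleR measurable_PiM_component_rev)
  finally show "distr M borel X = gauss" by (simp add: euclidean_representation)
qed

lemma distr_std_ginibre:
  fixes G :: "'w \<Rightarrow> 'k::euclidean_space mat"
  assumes M: "prob_space M" and G: "std_ginibre M n G" and n: "n \<ge> 1"
  shows "distr M (mat_borel n) G = (\<Pi>\<^sub>M ij\<in>mat_idx n. gauss)"
proof -
  interpret prob_space M by fact
  have [measurable]: "G \<in> measurable M (mat_borel n)"
    and ind: "indep_vars (\<lambda>_. borel) (\<lambda>ij \<omega>. G \<omega> ij) (mat_idx n)"
    and g: "\<And>ij. ij \<in> mat_idx n \<Longrightarrow> std_gaussian M (\<lambda>\<omega>. G \<omega> ij)"
    using G by (auto simp: std_ginibre_def)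
  have rv: "(\<lambda>\<omega>. G \<omega> ij) \<in> borel_measurable M" if "ij \<in> mat_idx n" for ij
    using distr_std_gaussian(1)[OF M g[OF that]] .
  have ne: "mat_idx n \<noteq> {}" using n by auto
  have "distr M (mat_borel n) G = distr M (\<Pi>\<^sub>M ij\<in>mat_idx n. borel) (\<lambda>\<omega>. \<lambda>ij\<in>mat_idx n. G \<omega> ij)"
  proof (rule distr_cong)
    fix \<omega> assume "\<omega> \<in> space M"
    then have "G \<omega> \<in> space (mat_borel n)" using \<open>G \<in> _\<close> by (rule measurable_space[rotated])
    then show "G \<omega> = (\<lambda>ij\<in>mat_idx n. G \<omega> ij)"
      by (simp add: mat_borel_def space_PiM PiE_iff extensional_restrict)
  qed (simp_all add: mat_borel_def)
  also have "\<dots> = (\<Pi>\<^sub>M ij\<in>mat_idx n. distr M borel (\<lambda>\<omega>. G \<omega> ij))"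
    using ind by (subst (asm) indep_vars_iff_distr_eq_PiM'[OF ne]) (auto intro: rv)
  also have "\<dots> = (\<Pi>\<^sub>M ij\<in>mat_idx n. gauss)"
    by (intro PiM_cong refl distr_std_gaussian(2)[OF M] g)
  finally show ?thesis .
qed

section \<open>Gaussian averages of linear images\<close>

text \<open>Linear maps that only see the entries with index in \<open>I\<close>. Row and column variables
  of a matrix are of this kind, without being a vector space of their own.\<close>

definition lin_on :: "'i set \<Rightarrow> (('i \<Rightarrow> 'a::real_vector) \<Rightarrow> 'b::real_vector) \<Rightarrow> bool" where
  "lin_on I T \<longleftrightarrow>
     (\<forall>x y. (\<forall>i\<in>I. x i = y i) \<longrightarrow> T x = T y) \<and>
     (\<forall>x y. T (\<lambda>i. x i + y i) = T x + T y) \<and>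
     (\<forall>r x. T (\<lambda>i. r *\<^sub>R x i) = r *\<^sub>R T x)"

lemma lin_on_cong: "lin_on I T \<Longrightarrow> (\<And>i. i \<in> I \<Longrightarrow> x i = y i) \<Longrightarrow> T x = T y"
  and lin_on_add: "lin_on I T \<Longrightarrow> T (\<lambda>i. x i + y i) = T x + T y"
  and lin_on_scaleR: "lin_on I T \<Longrightarrow> T (\<lambda>i. r *\<^sub>R x i) = r *\<^sub>R T x"
  unfolding lin_on_def by blast+

lemma lin_on_zero: "lin_on I T \<Longrightarrow> T (\<lambda>_. 0) = 0"
  using lin_on_scaleR[of I T 0 "\<lambda>_. 0"] by simp

lemma lin_on_sum:
  assumes T: "lin_on I T" and "finite J"
  shows "T (\<lambda>i. \<Sum>j\<in>J. f j i) = (\<Sum>j\<in>J. T (f j))"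
  using \<open>finite J\<close> by induction (simp_all add: lin_on_zero[OF T] lin_on_add[OF T])

definition single :: "'i \<Rightarrow> 'a \<Rightarrow> 'i \<Rightarrow> 'a::zero" where
  "single i v = (\<lambda>j. if j = i then v else 0)"

lemma lin_on_expand:
  fixes T :: "('i \<Rightarrow> 'a::euclidean_space) \<Rightarrow> 'b::real_vector"
  assumes T: "lin_on I T" and I: "finite I"
  shows "T x = (\<Sum>i\<in>I. \<Sum>e\<in>Basis. (x i \<bullet> e) *\<^sub>R T (single i e))"
proof -
  have "T x = T (\<lambda>j. \<Sum>i\<in>I. \<Sum>e\<in>Basis. (x i \<bullet> e) *\<^sub>R single i e j)"
  proof (rule lin_on_cong[OF T])
    fix j assume "j \<in> I"
    have "(\<Sum>i\<in>I. \<Sum>e\<in>Basis. (x i \<bullet> e) *\<^sub>R single i e j) = (\<Sum>i\<in>I. if i = j then \<Sum>e\<in>Basis. (x i \<bullet> e) *\<^sub>R e else 0)"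
      by (intro sum.cong refl) (auto simp: single_def)
    also have "\<dots> = x j" using I \<open>j \<in> I\<close> by (simp add: euclidean_representation)
    finally show "x j = (\<Sum>i\<in>I. \<Sum>e\<in>Basis. (x i \<bullet> e) *\<^sub>R single i e j)" by simp
  qed
  also have "\<dots> = (\<Sum>i\<in>I. \<Sum>e\<in>Basis. (x i \<bullet> e) *\<^sub>R T (single i e))"
    using I by (simp add: lin_on_sum[OF T] lin_on_scaleR[OF T])
  finally show ?thesis .
qed

text \<open>The adjoint of \<open>T\<close>: the i-th block of the vector that represents the functional
  \<open>x \<mapsto> \<xi> \<bullet> T x\<close>.\<close>

definition lin_adj :: "(('i \<Rightarrow> 'a::euclidean_space) \<Rightarrow> 'b::real_inner) \<Rightarrow> 'b \<Rightarrow> 'i \<Rightarrow> 'a" where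
  "lin_adj T \<xi> i = (\<Sum>e\<in>Basis. (\<xi> \<bullet> T (single i e)) *\<^sub>R e)"

lemma inner_lin_on:
  fixes T :: "('i \<Rightarrow> 'a::euclidean_space) \<Rightarrow> 'b::real_inner"
  assumes T: "lin_on I T" and I: "finite I"
  shows "\<xi> \<bullet> T x = (\<Sum>i\<in>I. x i \<bullet> lin_adj T \<xi> i)"
  by (subst lin_on_expand[OF T I]) (simp add: lin_adj_def inner_sum_right mult.commute)

lemma measurable_lin_on:
  fixes T :: "('i \<Rightarrow> 'a::euclidean_space) \<Rightarrow> 'b::euclidean_space"
  assumes T: "lin_on I T" and I: "finite I" and M: "\<And>i. i \<in> I \<Longrightarrow> sets (M i) = sets borel"
  shows "T \<in> borel_measurable (PiM I M)"
proof -
  have [measurable]: "(\<lambda>x. x i) \<in> borel_measurable (PiM I M)" if "i \<in> I" for i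
    using measurable_component_singleton[OF that, of M] M[OF that] by (simp cong: measurable_cong_sets)
  show ?thesis by (subst lin_on_expand[OF T I, abs_def]) measurable
qed

lemma measurable_lin_adj [measurable]:
  fixes T :: "('i \<Rightarrow> 'a::euclidean_space) \<Rightarrow> 'b::euclidean_space"
  shows "(\<lambda>\<xi>. lin_adj T \<xi> i) \<in> borel_measurable borel"
  unfolding lin_adj_def by measurable

text \<open>Write the Gaussian function as an average of characters and exchange the two integrals. The
  inner one is then the characteristic function of a Gaussian vector, evaluated at the adjoint
  of \<open>T\<close>.\<close>

lemma integral_gauss_exp_neg_norm_lin_on:
  fixes T :: "('i \<Rightarrow> 'a::euclidean_space) \<Rightarrow> 'b::euclidean_space"
  assumes T: "lin_on I T" and I: "finite I" and s: "0 \<le> s"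
  defines "k \<equiv> sqrt (2 * s * real DIM('b))"
  shows "complex_of_real (\<integral>x. exp (- s * (norm (T x + c))\<^sup>2) \<partial>gauss_vec I) =
    (\<integral>\<xi>. iexp (k * (\<xi> \<bullet> c)) *
       complex_of_real (exp (- (\<Sum>i\<in>I. (norm (k *\<^sub>R lin_adj T \<xi> i))\<^sup>2) / (2 * real DIM('a)))) \<partial>gauss)"
proof -
  let ?N = "PiM I (\<lambda>_. gauss :: 'a measure)"
  interpret N: prob_space ?N by (intro prob_space_PiM gauss.prob_space_axioms)
  interpret P: pair_prob_space ?N "gauss :: 'b measure" ..
  note [measurable] = measurable_lin_on[OF T I, of "\<lambda>_. gauss", simplified]
  have "complex_of_real (\<integral>x. exp (- s * (norm (T x + c))\<^sup>2) \<partial>?N) =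
      (\<integral>x. complex_of_real (exp (- s * (norm (T x + c))\<^sup>2)) \<partial>?N)" by simp
  also have "\<dots> = (\<integral>x. (\<integral>\<xi>. iexp (k * (\<xi> \<bullet> (T x + c))) \<partial>gauss) \<partial>?N)"
    unfolding k_def exp_neg_norm_square_eq_integral[OF s] ..
  also have "\<dots> = (\<integral>\<xi>. (\<integral>x. iexp (k * (\<xi> \<bullet> (T x + c))) \<partial>?N) \<partial>gauss)"
    by (rule P.Fubini_integral[symmetric], rule P.P.integrable_const_bound[where B = 1]) auto
  also have "\<dots> = (\<integral>\<xi>. iexp (k * (\<xi> \<bullet> c)) * (\<integral>x. iexp (\<Sum>i\<in>I. x i \<bullet> (k *\<^sub>R lin_adj T \<xi> i)) \<partial>?N) \<partial>gauss)"
    by (simp add: inner_add_right inner_lin_on[OF T I] distrib_left exp_add sum_distrib_left mult.commute)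
  finally show ?thesis by (simp only: integral_PiM_gauss_iexp[OF I])
qed

text \<open>In the Fourier formula the constant \<open>c\<close> only contributes a phase, and the remaining
  factor is positive. The triangle inequality for the integral removes the phase.\<close>

lemma gauss_lin_on_shift_le:
  fixes T :: "('i \<Rightarrow> 'a::euclidean_space) \<Rightarrow> 'b::euclidean_space"
  assumes T: "lin_on I T" and I: "finite I" and s: "0 \<le> s"
  shows "(\<integral>\<^sup>+x. gexp s (T x + c) \<partial>gauss_vec I) \<le>
         (\<integral>\<^sup>+x. gexp s (T x) \<partial>gauss_vec I)"
proof -
  let ?N = "PiM I (\<lambda>_. gauss :: 'a measure)"
  interpret N: prob_space ?N by (intro prob_space_PiM gauss.prob_space_axioms)
  note [measurable] = measurable_lin_on[OF T I, of "\<lambda>_. gauss", simplified]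
  define k where "k = sqrt (2 * s * real DIM('b))"
  define D where "D \<xi> = exp (- (\<Sum>i\<in>I. (norm (k *\<^sub>R lin_adj T \<xi> i))\<^sup>2) / (2 * real DIM('a)))" for \<xi> :: 'b
  have [measurable]: "D \<in> borel_measurable borel" unfolding D_def by measurable
  have D: "integrable gauss D"
    by (rule gauss.integrable_const_bound[where B = 1]) (auto simp: D_def intro!: divide_nonneg_nonneg sum_nonneg)
  have formula: "complex_of_real (\<integral>x. exp (- s * (norm (T x + c))\<^sup>2) \<partial>?N) = (\<integral>\<xi>. iexp (k * (\<xi> \<bullet> c)) * complex_of_real (D \<xi>) \<partial>gauss)" for c
    unfolding D_def k_def by (rule integral_gauss_exp_neg_norm_lin_on[OF T I s])
  have "(\<integral>x. exp (- s * (norm (T x + c))\<^sup>2) \<partial>?N) = cmod (complex_of_real (\<integral>x. exp (- s * (norm (T x + c))\<^sup>2) \<partial>?N))"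
    by (simp add: integral_nonneg_AE)
  also have "\<dots> \<le> (\<integral>\<xi>. cmod (iexp (k * (\<xi> \<bullet> c)) * complex_of_real (D \<xi>)) \<partial>gauss)"
    unfolding formula by (rule integral_norm_bound)
  also have "\<dots> = (\<integral>\<xi>. D \<xi> \<partial>gauss)"
    by (simp add: norm_mult D_def)
  also have "\<dots> = Re (complex_of_real (\<integral>x. exp (- s * (norm (T x + 0))\<^sup>2) \<partial>?N))"
    unfolding formula by (simp add: integral_complex_of_real)
  finally have le: "(\<integral>x. exp (- s * (norm (T x + c))\<^sup>2) \<partial>?N) \<le> (\<integral>x. exp (- s * (norm (T x))\<^sup>2) \<partial>?N)" by simp
  have int: "integrable ?N (\<lambda>x. exp (- s * (norm (T x + c))\<^sup>2))" for c
    using s by (intro gauss_PiM.integrable_const_bound[where B = 1]) auto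
  show ?thesis
    using le int[of c] int[of 0] by (simp add: nn_integral_eq_integral)
qed

text \<open>The Fourier formula depends on \<open>T\<close> only through the quadratic form \<open>\<xi>
  \<mapsto> |T* \<xi>|^2\<close>, so two Gaussian vectors with the same covariance have the same
  transforms.\<close>

lemma gauss_lin_on_eq_if_lin_adj:
  fixes T :: "('i \<Rightarrow> 'a::euclidean_space) \<Rightarrow> 'b::euclidean_space"
    and U :: "('j \<Rightarrow> 'a) \<Rightarrow> 'b"
  assumes T: "lin_on I T" and I: "finite I" and U: "lin_on J U" and J: "finite J" and s: "0 \<le> s"
    and eq: "\<And>\<xi>. (\<Sum>i\<in>I. (norm (lin_adj T \<xi> i))\<^sup>2) = (\<Sum>i\<in>J. (norm (lin_adj U \<xi> i))\<^sup>2)"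
  shows "(\<integral>\<^sup>+x. gexp s (T x + c) \<partial>gauss_vec I) =
         (\<integral>\<^sup>+x. gexp s (U x + c) \<partial>gauss_vec J)"
proof -
  have "complex_of_real (\<integral>x. exp (- s * (norm (T x + c))\<^sup>2) \<partial>gauss_vec I) =
        complex_of_real (\<integral>x. exp (- s * (norm (U x + c))\<^sup>2) \<partial>gauss_vec J)"
    unfolding integral_gauss_exp_neg_norm_lin_on[OF T I s] integral_gauss_exp_neg_norm_lin_on[OF U J s]
    by (simp add: power_mult_distrib sum_distrib_left[symmetric] eq)
  moreover have "integrable (gauss_vec I) (\<lambda>x. exp (- s * (norm (T x + c))\<^sup>2))"
    using s measurable_lin_on[OF T I, of "\<lambda>_. gauss", simplified]
    by (intro finite_measure.integrable_const_bound[where B = 1] prob_space.finite_measure prob_space_PiM gauss.prob_space_axioms) auto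
  moreover have "integrable (gauss_vec J) (\<lambda>x. exp (- s * (norm (U x + c))\<^sup>2))"
    using s measurable_lin_on[OF U J, of "\<lambda>_. gauss", simplified]
    by (intro finite_measure.integrable_const_bound[where B = 1] prob_space.finite_measure prob_space_PiM gauss.prob_space_axioms) auto
  ultimately show ?thesis
    by (simp only: of_real_eq_iff) (simp add: nn_integral_eq_integral)
qed

section \<open>Rotation invariance of a pair of Gaussian vectors\<close>

lemma nn_integral_lborel_affine:
  fixes a :: "'a::euclidean_space"
  assumes "0 < t" and [measurable]: "f \<in> borel_measurable borel"
  shows "(\<integral>\<^sup>+x. f (a + t *\<^sub>R x) \<partial>lborel) = ennreal (1 / t ^ DIM('a)) * (\<integral>\<^sup>+x. f x \<partial>lborel)"
proof -
  have "(\<integral>\<^sup>+x. f x \<partial>lborel) = (\<integral>\<^sup>+x. f x \<partial>density (distr lborel borel (\<lambda>x. a + t *\<^sub>R x)) (\<lambda>_. ennreal (\<bar>t\<bar> ^ DIM('a))))"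
    using lborel_affine[of t a] assms(1) by simp
  also have "\<dots> = ennreal (t ^ DIM('a)) * (\<integral>\<^sup>+x. f (a + t *\<^sub>R x) \<partial>lborel)"
    using assms(1) by (simp add: nn_integral_density nn_integral_distr nn_integral_cmult)
  finally show ?thesis
    using assms(1) by (simp add: mult.assoc[symmetric] ennreal_mult[symmetric])
qed

text \<open>For \<open>c \<noteq> 0\<close> a plane rotation, acting on pairs of vectors, is a product of
  two maps that change one component only, each affine in that component. Fubini's theorem
  reduces the claim to the scaling and translation behaviour of Lebesgue measure; the two
  factors \<open>c^d\<close> and \<open>c^(-d)\<close> cancel.\<close>

lemma nn_integral_lborel_rotate:
  fixes F :: "'a::euclidean_space \<times> 'a \<Rightarrow> ennreal"
  assumes c: "0 < c" and cs: "c\<^sup>2 + s\<^sup>2 = 1" and [measurable]: "F \<in> borel_measurable borel"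
  shows "(\<integral>\<^sup>+y. \<integral>\<^sup>+x. F (c *\<^sub>R x + s *\<^sub>R y, - s *\<^sub>R x + c *\<^sub>R y) \<partial>lborel \<partial>lborel) =
         (\<integral>\<^sup>+x. \<integral>\<^sup>+y. F (x, y) \<partial>lborel \<partial>lborel)"
proof -
  have [measurable]: "F \<in> borel_measurable (borel \<Otimes>\<^sub>M borel)" by (simp add: borel_prod)
  have arg: "- (s / c) *\<^sub>R (s *\<^sub>R y + c *\<^sub>R x) + (1 / c) *\<^sub>R y = - s *\<^sub>R x + c *\<^sub>R y" for x y :: 'a
  proof -
    have "1 / c - (s / c) * s = c"
      using c cs by (simp add: field_simps power2_eq_square)
    then have "(1 / c) *\<^sub>R y - ((s / c) * s) *\<^sub>R y = c *\<^sub>R y"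
      by (metis scaleR_left_diff_distrib)
    then show ?thesis using c by (simp add: algebra_simps)
  qed
  have "(\<integral>\<^sup>+y. \<integral>\<^sup>+x. F (c *\<^sub>R x + s *\<^sub>R y, - s *\<^sub>R x + c *\<^sub>R y) \<partial>lborel \<partial>lborel) =
      (\<integral>\<^sup>+y. \<integral>\<^sup>+x. (\<lambda>u. F (u, - (s / c) *\<^sub>R u + (1 / c) *\<^sub>R y)) (s *\<^sub>R y + c *\<^sub>R x) \<partial>lborel \<partial>lborel)"
    by (simp only: arg) (simp add: add.commute)
  also have "\<dots> = (\<integral>\<^sup>+y. ennreal (1 / c ^ DIM('a)) * (\<integral>\<^sup>+u. F (u, - (s / c) *\<^sub>R u + (1 / c) *\<^sub>R y) \<partial>lborel) \<partial>lborel)"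
    by (intro nn_integral_cong nn_integral_lborel_affine c) measurable
  also have "\<dots> = ennreal (1 / c ^ DIM('a)) * (\<integral>\<^sup>+y. \<integral>\<^sup>+u. F (u, - (s / c) *\<^sub>R u + (1 / c) *\<^sub>R y) \<partial>lborel \<partial>lborel)"
    by (rule nn_integral_cmult) measurable
  also have "(\<integral>\<^sup>+y. \<integral>\<^sup>+u. F (u, - (s / c) *\<^sub>R u + (1 / c) *\<^sub>R y) \<partial>lborel \<partial>lborel) =
      (\<integral>\<^sup>+u. \<integral>\<^sup>+y. F (u, - (s / c) *\<^sub>R u + (1 / c) *\<^sub>R y) \<partial>lborel \<partial>lborel)"
    by (rule lborel_pair.Fubini') measurable
  also have "\<dots> = (\<integral>\<^sup>+u. ennreal (1 / (1 / c) ^ DIM('a)) * (\<integral>\<^sup>+v. F (u, v) \<partial>lborel) \<partial>lborel)"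
    by (intro nn_integral_cong nn_integral_lborel_affine[where f = "\<lambda>v. F (_, v)"]) (use c in auto)
  also have "\<dots> = ennreal (1 / (1 / c) ^ DIM('a)) * (\<integral>\<^sup>+u. \<integral>\<^sup>+v. F (u, v) \<partial>lborel \<partial>lborel)"
    by (rule nn_integral_cmult) measurable
  finally show ?thesis
    using c by (simp add: mult.assoc[symmetric] ennreal_mult[symmetric] power_divide)
qed

text \<open>The joint density depends on \<open>(x, y)\<close> only through \<open>|x|^2 + |y|^2\<close>,
  which the rotation preserves.\<close>

lemma nn_integral_gauss_rotate:
  fixes F :: "'a::euclidean_space \<Rightarrow> 'a \<Rightarrow> ennreal"
  assumes c: "0 < c" and cs: "c\<^sup>2 + s\<^sup>2 = 1"
    and [measurable]: "case_prod F \<in> borel_measurable (borel \<Otimes>\<^sub>M borel)"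
  shows "(\<integral>\<^sup>+x. \<integral>\<^sup>+y. F (c *\<^sub>R x + s *\<^sub>R y) (- s *\<^sub>R x + c *\<^sub>R y) \<partial>gauss \<partial>gauss) =
         (\<integral>\<^sup>+x. \<integral>\<^sup>+y. F x y \<partial>gauss \<partial>gauss)"
proof -
  define g where "g x = ennreal ((real DIM('a) / (2 * pi)) powr (real DIM('a) / 2) * exp (- (real DIM('a) / 2) * (norm x)\<^sup>2))" for x :: 'a
  have [measurable]: "g \<in> borel_measurable borel" unfolding g_def by measurable
  have gauss: "gauss = density lborel g" unfolding gauss_eq_density g_def ..
  have g: "g (c *\<^sub>R x + s *\<^sub>R y) * g (- s *\<^sub>R x + c *\<^sub>R y) = g x * g y" for x y
  proof -
    have "(norm (c *\<^sub>R x + s *\<^sub>R y))\<^sup>2 + (norm (- s *\<^sub>R x + c *\<^sub>R y))\<^sup>2 = (c\<^sup>2 + s\<^sup>2) * (norm x)\<^sup>2 + (c\<^sup>2 + s\<^sup>2) * (norm y)\<^sup>2"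
      unfolding power2_norm_eq_inner by (simp add: inner_add inner_diff inner_commute algebra_simps power2_eq_square)
    then have n: "(norm (c *\<^sub>R x + s *\<^sub>R y))\<^sup>2 + (norm (- s *\<^sub>R x + c *\<^sub>R y))\<^sup>2 = (norm x)\<^sup>2 + (norm y)\<^sup>2"
      using cs by simp
    have gg: "g u * g v = ennreal (((real DIM('a) / (2 * pi)) powr (real DIM('a) / 2))\<^sup>2 * exp (- (real DIM('a) / 2) * ((norm u)\<^sup>2 + (norm v)\<^sup>2)))" for u v
      by (simp add: g_def ennreal_mult[symmetric] distrib_left exp_add[symmetric] exp_diff[symmetric] power2_eq_square mult_ac)
    show ?thesis unfolding gg n ..
  qed
  have "(\<integral>\<^sup>+x. \<integral>\<^sup>+y. F (c *\<^sub>R x + s *\<^sub>R y) (- s *\<^sub>R x + c *\<^sub>R y) \<partial>gauss \<partial>gauss) =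
     (\<integral>\<^sup>+x. \<integral>\<^sup>+y. g x * g y * F (c *\<^sub>R x + s *\<^sub>R y) (- s *\<^sub>R x + c *\<^sub>R y) \<partial>lborel \<partial>lborel)"
    unfolding gauss by (simp add: nn_integral_density nn_integral_cmult[symmetric] mult.assoc)
  also have "\<dots> = (\<integral>\<^sup>+y. \<integral>\<^sup>+x. (\<lambda>(u, v). g u * g v * F u v) (c *\<^sub>R x + s *\<^sub>R y, - s *\<^sub>R x + c *\<^sub>R y) \<partial>lborel \<partial>lborel)"
    by (subst lborel_pair.Fubini') (simp_all add: g[simplified])
  also have "\<dots> = (\<integral>\<^sup>+x. \<integral>\<^sup>+y. g x * g y * F x y \<partial>lborel \<partial>lborel)"
    by (subst nn_integral_lborel_rotate[OF c cs]) (simp_all add: borel_prod[symmetric])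
  also have "\<dots> = (\<integral>\<^sup>+x. \<integral>\<^sup>+y. F x y \<partial>gauss \<partial>gauss)"
    unfolding gauss by (simp add: nn_integral_density nn_integral_cmult[symmetric] mult.assoc)
  finally show ?thesis .
qed

text \<open>The restriction to \<open>J\<close> makes the result a point of the product space over
  \<open>J\<close>.\<close>

definition lincomb :: "'i set \<Rightarrow> real \<Rightarrow> ('i \<Rightarrow> 'a) \<Rightarrow> real \<Rightarrow> ('i \<Rightarrow> 'a) \<Rightarrow> 'i \<Rightarrow> 'a::real_vector" where
  "lincomb J a x b y = (\<lambda>j\<in>J. a *\<^sub>R x j + b *\<^sub>R y j)"

lemma measurable_lincomb [measurable]:
  assumes [measurable]: "f \<in> measurable N (PiM J (\<lambda>_. gauss :: 'a::euclidean_space measure))" "g \<in> measurable N (gauss_vec J)"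
  shows "(\<lambda>z. lincomb J a (f z) b (g z)) \<in> measurable N (PiM J (\<lambda>_. gauss :: 'a measure))"
  unfolding lincomb_def 
proof (rule measurable_restrict)
  fix j assume "j \<in> J"
  note comp = component_gauss[OF this]
  have [measurable]: "(\<lambda>z. f z j) \<in> borel_measurable N" "(\<lambda>z. g z j) \<in> borel_measurable N"
    by (rule measurable_compose[OF assms(1) comp] measurable_compose[OF assms(2) comp])+
  show "(\<lambda>z. a *\<^sub>R f z j + b *\<^sub>R g z j) \<in> measurable N gauss" by measurable
qed

text \<open>The rotation acts on each index separately, so the index set can be built up one element at a
  time.\<close>

lemma nn_integral_PiM_gauss_rotate:
  fixes F :: "('i \<Rightarrow> 'a::euclidean_space) \<Rightarrow> ('i \<Rightarrow> 'a) \<Rightarrow> ennreal"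
  assumes "finite J" and c: "0 < c" and cs: "c\<^sup>2 + s\<^sup>2 = 1"
    and F: "case_prod F \<in> borel_measurable (gauss_vec J \<Otimes>\<^sub>M gauss_vec J)"
  shows "(\<integral>\<^sup>+x. \<integral>\<^sup>+y. F (lincomb J c x s y) (lincomb J (- s) x c y) \<partial>gauss_vec J \<partial>gauss_vec J) =
         (\<integral>\<^sup>+x. \<integral>\<^sup>+y. F x y \<partial>gauss_vec J \<partial>gauss_vec J)"
  using \<open>finite J\<close> F
proof (induction J arbitrary: F)
  case empty
  have "lincomb {} p x q y = z" if "z \<in> space (PiM {} (\<lambda>_. gauss :: 'a measure))" for p q x y and z :: "'i \<Rightarrow> 'a"
    using that by (auto simp: lincomb_def space_PiM)
  then show ?case
    by (intro nn_integral_cong arg_cong2[where f = F])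
next
  case (insert j J)
  let ?N = "PiM J (\<lambda>_. gauss :: 'a measure)" and ?N' = "PiM (insert j J) (\<lambda>_. gauss :: 'a measure)"
  interpret S: pair_sigma_finite "gauss :: 'a measure" ?N
    by unfold_locales
  note [measurable] = insert.prems
  have upd [measurable]: "(\<lambda>z. (f z)(j := g z)) \<in> measurable M ?N'"
    if [measurable]: "f \<in> measurable M ?N" "g \<in> measurable M gauss" for f g and M :: "'z measure"
    by (rule measurable_fun_upd[where J = J]) auto
  have ins: "(\<integral>\<^sup>+x. f x \<partial>?N') = (\<integral>\<^sup>+x. \<integral>\<^sup>+a. f (x(j := a)) \<partial>gauss \<partial>?N)" if "f \<in> borel_measurable ?N'" for f
    using insert.hyps that by (rule gauss_PiM.product_nn_integral_insert)
  have ins2: "(\<integral>\<^sup>+x. \<integral>\<^sup>+y. H x y \<partial>?N' \<partial>?N') =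
      (\<integral>\<^sup>+x. \<integral>\<^sup>+a. \<integral>\<^sup>+y. \<integral>\<^sup>+b. H (x(j := a)) (y(j := b)) \<partial>gauss \<partial>?N \<partial>gauss \<partial>?N)"
    if H [measurable]: "case_prod H \<in> borel_measurable (?N' \<Otimes>\<^sub>M ?N')" for H
  proof -
    have "(\<integral>\<^sup>+x. \<integral>\<^sup>+y. H x y \<partial>?N' \<partial>?N') = (\<integral>\<^sup>+x. \<integral>\<^sup>+a. \<integral>\<^sup>+y. H (x(j := a)) y \<partial>?N' \<partial>gauss \<partial>?N)"
      by (rule ins) measurable
    also have "\<dots> = (\<integral>\<^sup>+x. \<integral>\<^sup>+a. \<integral>\<^sup>+y. \<integral>\<^sup>+b. H (x(j := a)) (y(j := b)) \<partial>gauss \<partial>?N \<partial>gauss \<partial>?N)"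
    proof (intro nn_integral_cong ins)
      fix x and a :: 'a assume "x \<in> space ?N"
      then have "x(j := a) \<in> space ?N'" by (auto simp: space_PiM intro!: PiE_fun_upd)
      from measurable_Pair2[OF H this] show "H (x(j := a)) \<in> borel_measurable ?N'" by simp
    qed
    finally show ?thesis .
  qed
  define G where "G x y = (\<integral>\<^sup>+a. \<integral>\<^sup>+b. F (x(j := a)) (y(j := b)) \<partial>gauss \<partial>gauss)" for x y
  have G [measurable]: "case_prod G \<in> borel_measurable (?N \<Otimes>\<^sub>M ?N)"
    unfolding G_def by measurable
  have lc: "lincomb (insert j J) p (x(j := a)) q (y(j := b)) = (lincomb J p x q y)(j := p *\<^sub>R a + q *\<^sub>R b)" for p q x y a b
    using insert.hyps by (auto simp: lincomb_def)
  have "(\<integral>\<^sup>+x. \<integral>\<^sup>+y. F (lincomb (insert j J) c x s y) (lincomb (insert j J) (- s) x c y) \<partial>?N' \<partial>?N') =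
      (\<integral>\<^sup>+x. \<integral>\<^sup>+a. \<integral>\<^sup>+y. \<integral>\<^sup>+b. F ((lincomb J c x s y)(j := c *\<^sub>R a + s *\<^sub>R b)) ((lincomb J (- s) x c y)(j := - s *\<^sub>R a + c *\<^sub>R b)) \<partial>gauss \<partial>?N \<partial>gauss \<partial>?N)"
    by (subst ins2) (measurable, simp only: lc)
  also have "\<dots> = (\<integral>\<^sup>+x. \<integral>\<^sup>+y. \<integral>\<^sup>+a. \<integral>\<^sup>+b. F ((lincomb J c x s y)(j := c *\<^sub>R a + s *\<^sub>R b)) ((lincomb J (- s) x c y)(j := - s *\<^sub>R a + c *\<^sub>R b)) \<partial>gauss \<partial>gauss \<partial>?N \<partial>?N)"
    by (intro nn_integral_cong S.Fubini'[symmetric]) measurable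
  also have "\<dots> = (\<integral>\<^sup>+x. \<integral>\<^sup>+y. G (lincomb J c x s y) (lincomb J (- s) x c y) \<partial>?N \<partial>?N)"
    unfolding G_def
    by (intro nn_integral_cong nn_integral_gauss_rotate[OF c cs, where F = "\<lambda>a b. F (_(j := a)) (_(j := b))"]) measurable
  also have "\<dots> = (\<integral>\<^sup>+x. \<integral>\<^sup>+y. G x y \<partial>?N \<partial>?N)"
    by (rule insert.IH) (rule G)
  also have "\<dots> = (\<integral>\<^sup>+x. \<integral>\<^sup>+a. \<integral>\<^sup>+y. \<integral>\<^sup>+b. F (x(j := a)) (y(j := b)) \<partial>gauss \<partial>?N \<partial>gauss \<partial>?N)"
    unfolding G_def by (intro nn_integral_cong S.Fubini') measurable
  also have "\<dots> = (\<integral>\<^sup>+x. \<integral>\<^sup>+y. F x y \<partial>?N' \<partial>?N')"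
    by (rule ins2[symmetric]) measurable
  finally show ?case .
qed

lemma distr_PiM_gauss_rotate:
  fixes J :: "'i set"
  assumes J: "finite J" and c: "0 < c" and cs: "c\<^sup>2 + s\<^sup>2 = 1"
  defines "N \<equiv> PiM J (\<lambda>_. gauss :: 'a::euclidean_space measure)"
  shows "distr (N \<Otimes>\<^sub>M N) (N \<Otimes>\<^sub>M N) (\<lambda>(x, y). (lincomb J c x s y, lincomb J (- s) x c y)) = N \<Otimes>\<^sub>M N"
    (is "?D = _")
proof (rule measure_eqI)
  interpret sigma_finite_measure N unfolding N_def
    by (intro prob_space_imp_sigma_finite prob_space_PiM gauss.prob_space_axioms)
  have [measurable]: "(\<lambda>(x, y). (lincomb J c x s y, lincomb J (- s) x c y)) \<in> measurable (N \<Otimes>\<^sub>M N) (N \<Otimes>\<^sub>M N)"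
    unfolding N_def by measurable
  fix A assume "A \<in> sets ?D"
  then have A [measurable]: "A \<in> sets (N \<Otimes>\<^sub>M N)" by simp
  have "emeasure ?D A = (\<integral>\<^sup>+z. indicator A z \<partial>?D)" by simp
  also have "\<dots> = (\<integral>\<^sup>+x. \<integral>\<^sup>+y. indicator A (lincomb J c x s y, lincomb J (- s) x c y) \<partial>N \<partial>N)"
    by (subst nn_integral_distr) (auto simp: nn_integral_fst[symmetric] simp del: nn_integral_indicator)
  also have "\<dots> = (\<integral>\<^sup>+x. \<integral>\<^sup>+y. indicator A (x, y) \<partial>N \<partial>N)"
    using A unfolding N_def by (intro nn_integral_PiM_gauss_rotate[OF J c cs, where F = "\<lambda>x y. indicator A (x, y)"]) simp
  also have "\<dots> = emeasure (N \<Otimes>\<^sub>M N) A"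
    by (simp add: emeasure_pair_measure)
  finally show "emeasure ?D A = emeasure (N \<Otimes>\<^sub>M N) A" .
qed simp

section \<open>Characteristic functions of Gaussian bilinear forms\<close>

lemma lin_on_lincomb:
  assumes "lin_on J T"
  shows "T (lincomb J p x q y) = p *\<^sub>R T x + q *\<^sub>R T y"
proof -
  have "T (lincomb J p x q y) = T (\<lambda>j. p *\<^sub>R x j + q *\<^sub>R y j)"
    by (rule lin_on_cong[OF assms]) (simp add: lincomb_def)
  then show ?thesis by (simp add: lin_on_add[OF assms] lin_on_scaleR[OF assms])
qed

text \<open>Minus the logarithm of \<open>h\<close> is additive and nonnegative, hence monotone, and a
  monotone additive function is linear.\<close>

lemma multiplicative_imp_power:
  fixes h :: "real \<Rightarrow> real"
  assumes mult: "\<And>p q. 0 < p \<Longrightarrow> 0 < q \<Longrightarrow> h (p + q) = h p * h q"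
    and h: "\<And>p. 0 < p \<Longrightarrow> 0 < h p" "\<And>p. 0 < p \<Longrightarrow> h p \<le> 1"
    and r: "0 < r"
  shows "h r = h 1 powr r"
proof -
  define g where "g p = - ln (h p)" for p
  have g_add: "g (p + q) = g p + g q" if "0 < p" "0 < q" for p q
    using that h(1)[of p] h(1)[of q] by (simp add: g_def mult ln_mult)
  have g_nonneg: "0 \<le> g p" if "0 < p" for p
    using that h by (simp add: g_def)
  have g_mono: "g p \<le> g q" if "0 < p" "p < q" for p q
    using g_add[of p "q - p"] g_nonneg[of "q - p"] that by simp
  have g_mult: "g (real (Suc n) * p) = real (Suc n) * g p" if "0 < p" for n p
  proof (induction n)
    case (Suc n)
    have "g (real (Suc (Suc n)) * p) = g (real (Suc n) * p + p)"
      by (simp add: algebra_simps)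
    also have "\<dots> = g (real (Suc n) * p) + g p"
      using that by (intro g_add) auto
    finally show ?case using Suc by (simp add: algebra_simps)
  qed simp
  \<comment> \<open>Squeezing \<open>Suc n * r\<close> between consecutive integers determines
    \<open>g r\<close> up to an error of order 1/(n+1).\<close>
  have bound: "real (Suc n) * \<bar>g r - r * g 1\<bar> \<le> 2 * g 1" for n
  proof -
    define k where "k = nat \<lfloor>real (Suc n) * r\<rfloor>"
    have k: "real k \<le> real (Suc n) * r" "real (Suc n) * r < real (Suc k)"
      unfolding k_def using r by (auto simp: of_nat_nat intro!: of_int_floor_le) linarith
    have up: "real (Suc n) * g r \<le> real (Suc k) * g 1"
      using g_mono[of "real (Suc n) * r" "real (Suc k) * 1"] k r by (simp only: g_mult mult_1_right) (simp add: g_mult[symmetric] g_mult[of 1 k, simplified])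
    have lo: "real k * g 1 \<le> real (Suc n) * g r"
    proof (cases k)
      case 0
      then show ?thesis using g_nonneg[OF r] by simp
    next
      case (Suc m)
      have "g (real (Suc m) * 1) \<le> g (real (Suc n) * r)"
        using k(1) g_mono[of "real (Suc m) * 1" "real (Suc n) * r"] unfolding Suc
        by (cases "real (Suc m) * 1 = real (Suc n) * r") auto
      then show ?thesis using r by (simp only: g_mult Suc)
    qed
    have "real k * g 1 \<le> real (Suc n) * r * g 1" "real (Suc n) * r * g 1 \<le> real (Suc k) * g 1"
      using k g_nonneg[of 1] by (auto intro!: mult_right_mono)
    with up lo g_nonneg[of 1] have "\<bar>real (Suc n) * g r - real (Suc n) * r * g 1\<bar> \<le> 2 * g 1"
      by (simp add: algebra_simps abs_le_iff)
    moreover have "real (Suc n) * g r - real (Suc n) * r * g 1 = real (Suc n) * (g r - r * g 1)"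
      by (simp add: algebra_simps)
    ultimately show ?thesis by (simp only: abs_mult abs_of_nat)
  qed
  have "g r = r * g 1"
  proof (rule ccontr)
    assume "g r \<noteq> r * g 1"
    then have pos: "0 < \<bar>g r - r * g 1\<bar>" by simp
    obtain n where "2 * g 1 < real n * \<bar>g r - r * g 1\<bar>"
      using reals_Archimedean3[OF pos] by blast
    also have "\<dots> \<le> real (Suc n) * \<bar>g r - r * g 1\<bar>" by (intro mult_right_mono) auto
    finally show False using bound[of n] by simp
  qed
  then have "ln (h r) = r * ln (h 1)" by (simp add: g_def)
  then show ?thesis
    using h(1)[OF r] h(1)[of 1] by (simp add: powr_def) (metis exp_ln)
qed

text \<open>The bilinear form in question is \<open>(b, c) \<mapsto> \<Sum>i\<in>J. b i \<bullet> \<Lambda>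
  c i\<close>. For independent standard Gaussian vectors \<open>b\<close> and \<open>c\<close>
  we study the characteristic function of this form plus linear terms \<open>\<alpha> \<cdot> c
  + \<gamma> \<cdot> b\<close>. Below, \<open>h \<alpha> \<gamma> c\<close> is the result of
  integrating over \<open>b\<close>, and \<open>X \<alpha> \<gamma>\<close> that of integrating
  over \<open>c\<close> as well. The value \<open>f \<gamma>\<close> is \<open>X 0
  \<gamma>\<close>, which is real and positive.\<close>

locale symmetric_form =
  fixes J :: "'i set" and \<Lambda> :: "('i \<Rightarrow> 'a::euclidean_space) \<Rightarrow> 'i \<Rightarrow> 'a"
  assumes J: "finite J"
    and lin: "\<And>i. i \<in> J \<Longrightarrow> lin_on J (\<lambda>c. \<Lambda> c i)"
    and sym: "\<And>b c. (\<Sum>i\<in>J. b i \<bullet> \<Lambda> c i) = (\<Sum>i\<in>J. c i \<bullet> \<Lambda> b i)"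
begin

abbreviation "N \<equiv> PiM J (\<lambda>_. gauss :: 'a measure)"

definition Q :: "('i \<Rightarrow> 'a) \<Rightarrow> real" where
  "Q x = (\<Sum>i\<in>J. (norm (x i))\<^sup>2) / (2 * real DIM('a))"

definition h :: "('i \<Rightarrow> 'a) \<Rightarrow> ('i \<Rightarrow> 'a) \<Rightarrow> ('i \<Rightarrow> 'a) \<Rightarrow> complex" where
  "h \<alpha> \<gamma> c = iexp (\<Sum>i\<in>J. c i \<bullet> \<alpha> i) * complex_of_real (exp (- Q (\<lambda>i. \<gamma> i + \<Lambda> c i)))"

definition X :: "('i \<Rightarrow> 'a) \<Rightarrow> ('i \<Rightarrow> 'a) \<Rightarrow> complex" where
  "X \<alpha> \<gamma> = (\<integral>c. h \<alpha> \<gamma> c \<partial>N)"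

definition f :: "('i \<Rightarrow> 'a) \<Rightarrow> real" where
  "f \<gamma> = (\<integral>c. exp (- Q (\<lambda>i. \<gamma> i + \<Lambda> c i)) \<partial>N)"

sublocale NN: pair_prob_space N N ..

lemma Q_nonneg: "0 \<le> Q x"
  by (simp add: Q_def sum_nonneg)

lemma measurable_component [measurable]: "i \<in> J \<Longrightarrow> (\<lambda>c. c i) \<in> borel_measurable N"
  by (rule component_gauss)

lemma measurable_form [measurable]: "i \<in> J \<Longrightarrow> (\<lambda>c. \<Lambda> c i) \<in> borel_measurable N"
  by (rule measurable_lin_on[OF lin J]) auto

lemma measurable_h [measurable]: "h \<alpha> \<gamma> \<in> borel_measurable N"
  unfolding h_def Q_def by measurable

lemma cmod_h: "cmod (h \<alpha> \<gamma> c) = exp (- Q (\<lambda>i. \<gamma> i + \<Lambda> c i))"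
  by (simp add: h_def norm_mult)

lemma cmod_h_le_1: "cmod (h \<alpha> \<gamma> c) \<le> 1"
  by (simp add: cmod_h Q_nonneg)

lemma integrable_h: "integrable N (h \<alpha> \<gamma>)"
  by (rule gauss_PiM.integrable_const_bound[where B = 1]) (auto simp: cmod_h_le_1)

lemma integrable_exp_Q: "integrable N (\<lambda>c. exp (- Q (\<lambda>i. \<gamma> i + \<Lambda> c i)))"
  using integrable_norm[OF integrable_h[of "\<lambda>_. 0" \<gamma>]] by (simp add: cmod_h)

lemma X_times_X: "X \<alpha> \<gamma> * X \<alpha>' \<gamma>' = (\<integral>(x, y). h \<alpha> \<gamma> x * h \<alpha>' \<gamma>' y \<partial>(N \<Otimes>\<^sub>M N))"
proof -
  have "integrable (N \<Otimes>\<^sub>M N) (\<lambda>(x, y). h \<alpha> \<gamma> x * h \<alpha>' \<gamma>' y)"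
    by (rule NN.P.integrable_const_bound[where B = 1])
       (auto simp: norm_mult intro!: AE_I2 mult_le_one cmod_h_le_1)
  from NN.integral_fst'[OF this] show ?thesis
    by (simp add: X_def)
qed

text \<open>The phase of \<open>h\<close> is linear in \<open>(\<alpha>, c)\<close> and its damping is a
  quadratic form in \<open>\<gamma> + \<Lambda> c\<close>. Rotating the two arguments is
  therefore the same as rotating the two parameters in the opposite direction.\<close>

lemma h_rotate:
  assumes cs: "c\<^sup>2 + s\<^sup>2 = (1 :: real)"
  shows "h \<alpha> \<gamma> (lincomb J c x s y) * h \<alpha>' \<gamma>' (lincomb J (- s) x c y) =
    h (\<lambda>i. c *\<^sub>R \<alpha> i - s *\<^sub>R \<alpha>' i) (\<lambda>i. c *\<^sub>R \<gamma> i - s *\<^sub>R \<gamma>' i) x *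
    h (\<lambda>i. s *\<^sub>R \<alpha> i + c *\<^sub>R \<alpha>' i) (\<lambda>i. s *\<^sub>R \<gamma> i + c *\<^sub>R \<gamma>' i) y"
proof -
  have phase: "(\<Sum>i\<in>J. lincomb J c x s y i \<bullet> \<alpha> i) + (\<Sum>i\<in>J. lincomb J (- s) x c y i \<bullet> \<alpha>' i) =
      (\<Sum>i\<in>J. x i \<bullet> (c *\<^sub>R \<alpha> i - s *\<^sub>R \<alpha>' i)) + (\<Sum>i\<in>J. y i \<bullet> (s *\<^sub>R \<alpha> i + c *\<^sub>R \<alpha>' i))"
    unfolding sum.distrib[symmetric]
    by (intro sum.cong refl) (simp add: lincomb_def inner_add inner_diff)
  have "(norm (g + (c *\<^sub>R a + s *\<^sub>R b)))\<^sup>2 + (norm (g' + (- s *\<^sub>R a + c *\<^sub>R b)))\<^sup>2 =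
      (norm ((c *\<^sub>R g - s *\<^sub>R g') + a))\<^sup>2 + (norm ((s *\<^sub>R g + c *\<^sub>R g') + b))\<^sup>2" for g g' a b :: 'a
  proof -
    have "(norm (g + (c *\<^sub>R a + s *\<^sub>R b)))\<^sup>2 + (norm (g' + (- s *\<^sub>R a + c *\<^sub>R b)))\<^sup>2 =
        g \<bullet> g + g' \<bullet> g' + 2 * (c * (g \<bullet> a) + s * (g \<bullet> b) - s * (g' \<bullet> a) + c * (g' \<bullet> b)) +
        (c\<^sup>2 + s\<^sup>2) * (a \<bullet> a) + (c\<^sup>2 + s\<^sup>2) * (b \<bullet> b)"
      unfolding power2_norm_eq_inner
      by (simp add: inner_add inner_diff inner_commute algebra_simps power2_eq_square)
    moreover have "(norm ((c *\<^sub>R g - s *\<^sub>R g') + a))\<^sup>2 + (norm ((s *\<^sub>R g + c *\<^sub>R g') + b))\<^sup>2 =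
        (c\<^sup>2 + s\<^sup>2) * (g \<bullet> g) + (c\<^sup>2 + s\<^sup>2) * (g' \<bullet> g') +
        2 * (c * (g \<bullet> a) + s * (g \<bullet> b) - s * (g' \<bullet> a) + c * (g' \<bullet> b)) + a \<bullet> a + b \<bullet> b"
      unfolding power2_norm_eq_inner
      by (simp add: inner_add inner_diff inner_commute algebra_simps power2_eq_square)
    ultimately show ?thesis using cs by simp
  qed
  then have norms: "(norm (\<gamma> i + \<Lambda> (lincomb J c x s y) i))\<^sup>2 + (norm (\<gamma>' i + \<Lambda> (lincomb J (- s) x c y) i))\<^sup>2 =
      (norm ((c *\<^sub>R \<gamma> i - s *\<^sub>R \<gamma>' i) + \<Lambda> x i))\<^sup>2 + (norm ((s *\<^sub>R \<gamma> i + c *\<^sub>R \<gamma>' i) + \<Lambda> y i))\<^sup>2" if "i \<in> J" for i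
    using lin_on_lincomb[OF lin[OF that]] by simp
  have damping: "Q (\<lambda>i. \<gamma> i + \<Lambda> (lincomb J c x s y) i) + Q (\<lambda>i. \<gamma>' i + \<Lambda> (lincomb J (- s) x c y) i) =
      Q (\<lambda>i. (c *\<^sub>R \<gamma> i - s *\<^sub>R \<gamma>' i) + \<Lambda> x i) + Q (\<lambda>i. (s *\<^sub>R \<gamma> i + c *\<^sub>R \<gamma>' i) + \<Lambda> y i)"
    unfolding Q_def add_divide_distrib[symmetric] sum.distrib[symmetric] by (simp add: norms)
  have hh: "h a b u * h a' b' v = iexp ((\<Sum>i\<in>J. u i \<bullet> a i) + (\<Sum>i\<in>J. v i \<bullet> a' i)) *
      complex_of_real (exp (- (Q (\<lambda>i. b i + \<Lambda> u i) + Q (\<lambda>i. b' i + \<Lambda> v i))))" for a b a' b' u v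
    by (simp add: h_def exp_add exp_diff distrib_left exp_minus field_simps)
  show ?thesis unfolding hh phase damping ..
qed

lemma X_rotate:
  assumes c: "0 < c" and cs: "c\<^sup>2 + s\<^sup>2 = (1 :: real)"
  shows "X \<alpha> \<gamma> * X \<alpha>' \<gamma>' =
    X (\<lambda>i. c *\<^sub>R \<alpha> i - s *\<^sub>R \<alpha>' i) (\<lambda>i. c *\<^sub>R \<gamma> i - s *\<^sub>R \<gamma>' i) *
    X (\<lambda>i. s *\<^sub>R \<alpha> i + c *\<^sub>R \<alpha>' i) (\<lambda>i. s *\<^sub>R \<gamma> i + c *\<^sub>R \<gamma>' i)"
proof -
  have "X \<alpha> \<gamma> * X \<alpha>' \<gamma>' = (\<integral>(x, y). h \<alpha> \<gamma> x * h \<alpha>' \<gamma>' y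
      \<partial>distr (N \<Otimes>\<^sub>M N) (N \<Otimes>\<^sub>M N) (\<lambda>(x, y). (lincomb J c x s y, lincomb J (- s) x c y)))"
    unfolding distr_PiM_gauss_rotate[OF J c cs] by (rule X_times_X)
  also have "\<dots> = (\<integral>(x, y). h \<alpha> \<gamma> (lincomb J c x s y) * h \<alpha>' \<gamma>' (lincomb J (- s) x c y) \<partial>(N \<Otimes>\<^sub>M N))"
    by (subst integral_distr) (auto simp: case_prod_unfold)
  finally show ?thesis unfolding h_rotate[OF cs] X_times_X .
qed

lemma X_zero_left: "X (\<lambda>_. 0) \<gamma> = complex_of_real (f \<gamma>)"
  by (simp add: X_def h_def f_def)

lemma cnj_X: "cnj (X \<alpha> \<gamma>) = X (\<lambda>i. - \<alpha> i) \<gamma>"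
proof -
  have "cnj (h \<alpha> \<gamma> c) = h (\<lambda>i. - \<alpha> i) \<gamma> c" for c
    by (simp add: h_def exp_cnj sum_negf)
  then show ?thesis
    unfolding X_def using integral_bounded_linear[OF bounded_linear_cnj integrable_h[of \<alpha> \<gamma>]] by simp
qed

text \<open>Written as a double integral, \<open>X \<alpha> \<gamma>\<close> treats \<open>b\<close> and
  \<open>c\<close> alike up to exchanging \<open>\<alpha>\<close> and \<open>\<gamma>\<close>,
  because the form is symmetric.\<close>

lemma X_commute: "X \<alpha> \<gamma> = X \<gamma> \<alpha>"
proof -
  have expand: "h \<alpha> \<gamma> c = (\<integral>b. iexp ((\<Sum>i\<in>J. c i \<bullet> \<alpha> i) + (\<Sum>i\<in>J. b i \<bullet> \<gamma> i) + (\<Sum>i\<in>J. b i \<bullet> \<Lambda> c i)) \<partial>N)" for \<alpha> \<gamma> c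
  proof -
    have "(\<integral>b. iexp ((\<Sum>i\<in>J. c i \<bullet> \<alpha> i) + (\<Sum>i\<in>J. b i \<bullet> \<gamma> i) + (\<Sum>i\<in>J. b i \<bullet> \<Lambda> c i)) \<partial>N) =
        iexp (\<Sum>i\<in>J. c i \<bullet> \<alpha> i) * (\<integral>b. iexp (\<Sum>i\<in>J. b i \<bullet> (\<gamma> i + \<Lambda> c i)) \<partial>N)"
      by (simp add: inner_add_right sum.distrib distrib_left exp_add mult.assoc)
    then show ?thesis
      by (simp only: integral_PiM_gauss_iexp[OF J] h_def Q_def)  simp
  qed
  have "X \<alpha> \<gamma> = (\<integral>c. \<integral>b. iexp ((\<Sum>i\<in>J. c i \<bullet> \<alpha> i) + (\<Sum>i\<in>J. b i \<bullet> \<gamma> i) + (\<Sum>i\<in>J. b i \<bullet> \<Lambda> c i)) \<partial>N \<partial>N)"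
    unfolding X_def by (intro Bochner_Integration.integral_cong refl expand)
  also have "\<dots> = (\<integral>b. \<integral>c. iexp ((\<Sum>i\<in>J. c i \<bullet> \<alpha> i) + (\<Sum>i\<in>J. b i \<bullet> \<gamma> i) + (\<Sum>i\<in>J. b i \<bullet> \<Lambda> c i)) \<partial>N \<partial>N)"
    by (rule NN.Fubini_integral[symmetric], rule NN.P.integrable_const_bound[where B = 1]) auto
  also have "\<dots> = X \<gamma> \<alpha>"
  proof -
    have "(\<Sum>i\<in>J. c i \<bullet> \<alpha> i) + (\<Sum>i\<in>J. b i \<bullet> \<gamma> i) + (\<Sum>i\<in>J. b i \<bullet> \<Lambda> c i) =
        (\<Sum>i\<in>J. b i \<bullet> \<gamma> i) + (\<Sum>i\<in>J. c i \<bullet> \<alpha> i) + (\<Sum>i\<in>J. c i \<bullet> \<Lambda> b i)" for b c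
      unfolding sym[of b c] by simp
    note swap = this
    show ?thesis unfolding X_def
      by (intro Bochner_Integration.integral_cong refl) (simp only: expand swap)
  qed
  finally show ?thesis .
qed

lemma X_zero_right: "X \<alpha> (\<lambda>_. 0) = complex_of_real (f \<alpha>)"
  by (simp only: X_commute[of \<alpha>] X_zero_left)

lemma f_pos: "0 < f \<gamma>"
proof -
  have "f \<gamma> \<noteq> 0"
  proof
    assume "f \<gamma> = 0"
    then have "AE c in N. exp (- Q (\<lambda>i. \<gamma> i + \<Lambda> c i)) = 0"
      unfolding f_def by (subst (asm) integral_nonneg_eq_0_iff_AE[OF integrable_exp_Q]) auto
    then show False using gauss_PiM.AE_False by simp
  qed
  moreover have "0 \<le> f \<gamma>" unfolding f_def by (simp add: integral_nonneg_AE)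
  ultimately show ?thesis by simp
qed

text \<open>By the symmetry of \<open>X\<close>, the value \<open>f \<gamma>\<close> is also \<open>X
  \<gamma> 0\<close>, an average in which \<open>\<gamma>\<close> only produces a phase.\<close>

lemma f_le_f_zero: "f \<gamma> \<le> f (\<lambda>_. 0)"
proof -
  have "f \<gamma> = cmod (X \<gamma> (\<lambda>_. 0))" using f_pos[of \<gamma>] by (simp add: X_zero_right)
  also have "\<dots> \<le> (\<integral>c. cmod (h \<gamma> (\<lambda>_. 0) c) \<partial>N)" unfolding X_def by (rule integral_norm_bound)
  also have "\<dots> = f (\<lambda>_. 0)" by (simp add: f_def cmod_h)
  finally show ?thesis .
qed

text \<open>Explicitly, \<open>f \<gamma> = f 0 * exp (- q \<gamma>)\<close> for a quadratic form
  \<open>q\<close>. Computing \<open>q\<close> would need the inverse of a matrix built from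
  \<open>\<Lambda>\<close>. It is enough to know the behaviour on a ray, which follows from
  rotating the pair of parameters \<open>(sqrt (p + q) \<gamma>, 0)\<close>: the angle with
  squared cosine \<open>p / (p + q)\<close> splits \<open>sqrt (p + q) \<gamma>\<close> into
  \<open>sqrt p \<gamma>\<close> and \<open>sqrt q \<gamma>\<close>.\<close>

lemma f_scale:
  assumes "0 < r"
  shows "f (\<lambda>i. sqrt r *\<^sub>R \<gamma> i) = f (\<lambda>_. 0) * (f \<gamma> / f (\<lambda>_. 0)) powr r"
proof -
  let ?C = "f (\<lambda>_. 0)"
  have mult: "f (\<lambda>i. sqrt (p + q) *\<^sub>R \<gamma> i) * ?C = f (\<lambda>i. sqrt p *\<^sub>R \<gamma> i) * f (\<lambda>i. sqrt q *\<^sub>R \<gamma> i)"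
    if "0 < p" "0 < q" for p q
  proof -
    define c s where "c = sqrt (p / (p + q))" and "s = sqrt (q / (p + q))"
    have c: "0 < c" and cs: "c\<^sup>2 + s\<^sup>2 = 1"
      using that by (auto simp: c_def s_def add_divide_distrib[symmetric])
    have "c * sqrt (p + q) = sqrt p" "s * sqrt (p + q) = sqrt q"
      using that by (auto simp: c_def s_def real_sqrt_divide)
    then show ?thesis
      using X_rotate[OF c cs, of "\<lambda>_. 0" "\<lambda>i. sqrt (p + q) *\<^sub>R \<gamma> i" "\<lambda>_. 0" "\<lambda>_. 0"]
      by (simp add: X_zero_left del: of_real_mult add: of_real_mult[symmetric])
  qed
  define g where "g p = f (\<lambda>i. sqrt p *\<^sub>R \<gamma> i) / ?C" for p
  have "g r = g 1 powr r"
  proof (rule multiplicative_imp_power)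
    fix p q :: real assume "0 < p" "0 < q"
    from mult[OF this] show "g (p + q) = g p * g q" using f_pos[of "\<lambda>_. 0"] by (simp add: g_def field_simps)
  qed (use assms f_pos f_le_f_zero in \<open>simp_all add: g_def\<close>)
  then show ?thesis using f_pos[of "\<lambda>_. 0"] by (simp add: g_def field_simps)
qed

text \<open>The squared modulus is \<open>X \<alpha> \<gamma> * X (-\<alpha>) \<gamma>\<close>. A rotation
  by 45 degrees separates the parameters into \<open>(sqrt 2 \<alpha>, 0)\<close> and \<open>(0,
  sqrt 2 \<gamma>)\<close>.\<close>

lemma cmod_X_eq: "cmod (X \<alpha> \<gamma>) = f \<alpha> * f \<gamma> / f (\<lambda>_. 0)"
proof -
  let ?C = "f (\<lambda>_. 0)"
  define c where "c = sqrt (1 / 2)"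
  have c: "0 < c" "c\<^sup>2 + c\<^sup>2 = 1" by (auto simp: c_def)
  have cc: "c + c = sqrt 2" by (simp add: c_def real_sqrt_divide) (simp add: field_simps)
  have "complex_of_real ((cmod (X \<alpha> \<gamma>))\<^sup>2) = X \<alpha> \<gamma> * X (\<lambda>i. - \<alpha> i) \<gamma>"
    unfolding cnj_X[symmetric] by (simp add: complex_norm_square[symmetric])
  also have "\<dots> = X (\<lambda>i. sqrt 2 *\<^sub>R \<alpha> i) (\<lambda>_. 0) * X (\<lambda>_. 0) (\<lambda>i. sqrt 2 *\<^sub>R \<gamma> i)"
    by (subst X_rotate[OF c]) (simp add: scaleR_add_left[symmetric] cc)
  also have "\<dots> = complex_of_real (f (\<lambda>i. sqrt 2 *\<^sub>R \<alpha> i) * f (\<lambda>i. sqrt 2 *\<^sub>R \<gamma> i))"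
    by (simp add: X_zero_left X_zero_right)
  finally have "(cmod (X \<alpha> \<gamma>))\<^sup>2 = f (\<lambda>i. sqrt 2 *\<^sub>R \<alpha> i) * f (\<lambda>i. sqrt 2 *\<^sub>R \<gamma> i)"
    by (simp only: of_real_eq_iff)
  also have "\<dots> = (?C * (f \<alpha> / ?C)\<^sup>2) * (?C * (f \<gamma> / ?C)\<^sup>2)"
    using f_pos[of \<alpha>] f_pos[of \<gamma>] f_pos[of "\<lambda>_. 0"] by (simp add: f_scale powr_numeral)
  also have "\<dots> = (f \<alpha> * f \<gamma> / ?C)\<^sup>2"
    using f_pos[of "\<lambda>_. 0"] by (simp add: field_simps power2_eq_square)
  finally show ?thesis
    using f_pos by (simp add: power2_eq_iff_nonneg less_imp_le)
qed

text \<open>With \<open>a = f \<alpha> / f 0\<close> and \<open>b = f \<gamma> / f 0\<close>, the modulus is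
  \<open>f 0 * a * b\<close>, and the claim is the weighted inequality of arithmetic and
  geometric means for \<open>a powr (1 / l)\<close> and \<open>b powr (1 / (1 - l))\<close>.\<close>

lemma cmod_X_le:
  assumes l: "0 < l" "l < 1"
  shows "cmod (X \<alpha> \<gamma>) \<le> l * f (\<lambda>i. \<alpha> i /\<^sub>R sqrt l) + (1 - l) * f (\<lambda>i. \<gamma> i /\<^sub>R sqrt (1 - l))"
proof -
  let ?C = "f (\<lambda>_. 0)"
  define a b where "a = f \<alpha> / ?C" and "b = f \<gamma> / ?C"
  have ab: "0 < a" "0 < b" using f_pos by (auto simp: a_def b_def)
  have fa: "f (\<lambda>i. \<alpha> i /\<^sub>R sqrt l) = ?C * a powr (1 / l)"
    using f_scale[of "1 / l" \<alpha>] l by (simp add: a_def real_sqrt_divide inverse_eq_divide)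
  have fb: "f (\<lambda>i. \<gamma> i /\<^sub>R sqrt (1 - l)) = ?C * b powr (1 / (1 - l))"
    using f_scale[of "1 / (1 - l)" \<gamma>] l by (simp add: b_def real_sqrt_divide inverse_eq_divide)
  have "a * b = exp (ln a + ln b)" using ab by (simp add: exp_add)
  also have "ln a + ln b = l * (ln a / l) + (1 - l) * (ln b / (1 - l))" using l by simp
  also have "exp \<dots> \<le> l * exp (ln a / l) + (1 - l) * exp (ln b / (1 - l))"
    using l convex_onD[OF exp_convex, of l "ln b / (1 - l)" "ln a / l"] by (simp add: add.commute)
  also have "\<dots> = l * a powr (1 / l) + (1 - l) * b powr (1 / (1 - l))"
    using ab by (simp add: powr_def)
  finally have "?C * (a * b) \<le> ?C * (l * a powr (1 / l) + (1 - l) * b powr (1 / (1 - l)))"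
    using f_pos[of "\<lambda>_. 0"] by (intro mult_left_mono) auto
  moreover have "cmod (X \<alpha> \<gamma>) = ?C * (a * b)"
    using f_pos[of "\<lambda>_. 0"] by (simp add: cmod_X_eq a_def b_def)
  ultimately show ?thesis by (simp add: fa fb algebra_simps)
qed

end

lemma lin_adj_add: "lin_adj (\<lambda>b. T b + U b) \<xi> i = lin_adj T \<xi> i + lin_adj U \<xi> i"
  by (simp add: lin_adj_def inner_add_right scaleR_add_left sum.distrib)

lemma lin_adj_scaleR: "lin_adj (\<lambda>b. r *\<^sub>R T b) \<xi> i = r *\<^sub>R lin_adj T \<xi> i"
  by (simp add: lin_adj_def scaleR_sum_right)

lemma lin_adj_zero: "lin_adj (\<lambda>b. 0) \<xi> i = 0"
  by (simp add: lin_adj_def)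

lemma lin_on_plus: "lin_on I T \<Longrightarrow> lin_on I U \<Longrightarrow> lin_on I (\<lambda>b. T b + U b)"
  unfolding lin_on_def by (auto simp: scaleR_add_right) metis+

lemma lin_on_scale: "lin_on I T \<Longrightarrow> lin_on I (\<lambda>b. r *\<^sub>R T b)"
  unfolding lin_on_def by (auto simp: scaleR_add_right)

lemma lin_on_const_zero: "lin_on I (\<lambda>b. 0)"
  by (simp add: lin_on_def)

text \<open>The preceding estimate is now averaged over the characters that make up \<open>exp (- s
  |y|^2)\<close>. Here \<open>S\<close> is a symmetric bilinear map with values in a Euclidean
  space; pairing it with a fixed vector gives a symmetric form.\<close>

context
  fixes J :: "'i set" and S :: "('i \<Rightarrow> 'a::euclidean_space) \<Rightarrow> ('i \<Rightarrow> 'a) \<Rightarrow> 'b::euclidean_space" and s k :: real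
  assumes J: "finite J" and S: "\<And>c. lin_on J (\<lambda>b. S b c)" and S_sym: "\<And>b c. S b c = S c b" and s: "0 \<le> s"
  defines "k \<equiv> sqrt (2 * s * real DIM('b))"
begin

private abbreviation "N \<equiv> PiM J (\<lambda>_. gauss :: 'a measure)"

private definition form :: "'b \<Rightarrow> ('i \<Rightarrow> 'a) \<Rightarrow> 'i \<Rightarrow> 'a" where
  "form \<xi> c i = k *\<^sub>R lin_adj (\<lambda>b. S b c) \<xi> i"

private lemma S2: "lin_on J (S b)"
  using S[of b] by (simp add: S_sym[of _ b])

private lemma form: "symmetric_form J (form \<xi>)"
proof
  show "lin_on J (\<lambda>c. form \<xi> c i)" for i
    unfolding lin_on_def
  proof (intro conjI allI impI)
    fix x y :: "'i \<Rightarrow> 'a" and r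
    show "form \<xi> x i = form \<xi> y i" if "\<forall>i\<in>J. x i = y i"
      using lin_on_cong[OF S2, of x y] that by (simp add: form_def lin_adj_def)
    show "form \<xi> (\<lambda>i. x i + y i) i = form \<xi> x i + form \<xi> y i"
      by (simp add: form_def lin_adj_def lin_on_add[OF S2] inner_add_right scaleR_add_left sum.distrib scaleR_add_right)
    show "form \<xi> (\<lambda>i. r *\<^sub>R x i) i = r *\<^sub>R form \<xi> x i"
      by (simp add: form_def lin_adj_def lin_on_scaleR[OF S2] scaleR_sum_right mult_ac)
  qed
  have "(\<Sum>i\<in>J. b i \<bullet> form \<xi> c i) = k * (\<xi> \<bullet> S b c)" for b c
    unfolding form_def inner_lin_on[OF S J] by (simp add: sum_distrib_left)
  then show "(\<Sum>i\<in>J. b i \<bullet> form \<xi> c i) = (\<Sum>i\<in>J. c i \<bullet> form \<xi> b i)" for b c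
    by (simp add: S_sym)
qed (rule J)

private lemma measurable_form:
  assumes "i \<in> J"
  shows "(\<lambda>(\<xi>, c). form \<xi> c i) \<in> borel_measurable (gauss \<Otimes>\<^sub>M N)"
proof -
  have [measurable]: "S b \<in> borel_measurable N" for b
    by (rule measurable_lin_on[OF S2 J]) simp
  show ?thesis unfolding form_def lin_adj_def by measurable
qed

private definition E :: "(('i \<Rightarrow> 'a) \<Rightarrow> 'b) \<Rightarrow> (('i \<Rightarrow> 'a) \<Rightarrow> 'b) \<Rightarrow> real" where
  "E T U = (\<integral>c. \<integral>b. exp (- s * (norm (T c + U b + S b c))\<^sup>2) \<partial>N \<partial>N)"

private lemma measurable_S: "case_prod S \<in> borel_measurable (N \<Otimes>\<^sub>M N)"
proof -
  have [measurable]: "(\<lambda>c. c i) \<in> borel_measurable N" if "i \<in> J" for i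
    using that by (rule component_gauss)
  have [measurable]: "S b \<in> borel_measurable N" for b
    by (rule measurable_lin_on[OF S2 J]) simp
  show ?thesis
    by (subst lin_on_expand[OF S J, abs_def]) measurable
qed

private lemma nn_integral_E:
  assumes T: "lin_on J T" and U: "lin_on J U"
  shows "(\<integral>\<^sup>+c. \<integral>\<^sup>+b. gexp s (T c + U b + S b c) \<partial>N \<partial>N) = ennreal (E T U)"
proof -
  interpret pair_prob_space N N ..
  have [measurable]: "T \<in> borel_measurable N" "U \<in> borel_measurable N"
    by (rule measurable_lin_on[OF T J] measurable_lin_on[OF U J], simp)+
  note [measurable] = measurable_S
  have [measurable]: "(\<lambda>b. S b c) \<in> borel_measurable N" for c
    by (rule measurable_lin_on[OF S J]) simp
  have le1: "exp (- s * (norm x)\<^sup>2) \<le> 1" for x :: 'b using s by simp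
  have int1: "integrable N (\<lambda>b. exp (- s * (norm (T c + U b + S b c))\<^sup>2))" for c
    using s by (intro gauss_PiM.integrable_const_bound[where B = 1]) auto
  have inner: "(\<integral>\<^sup>+b. gexp s (T c + U b + S b c) \<partial>N) =
      ennreal (\<integral>b. exp (- s * (norm (T c + U b + S b c))\<^sup>2) \<partial>N)" for c
    by (rule nn_integral_eq_integral[OF int1]) simp
  have nn: "0 \<le> (\<integral>b. exp (- s * (norm (T c + U b + S b c))\<^sup>2) \<partial>N)" for c
    by (simp add: integral_nonneg_AE)
  have le: "(\<integral>b. exp (- s * (norm (T c + U b + S b c))\<^sup>2) \<partial>N) \<le> 1" for c
    by (intro prob_space.integral_le_const[OF _ int1] prob_space_PiM gauss.prob_space_axioms AE_I2 le1)
  show ?thesis unfolding inner E_def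
    by (intro nn_integral_eq_integral gauss_PiM.integrable_const_bound[where B = 1] AE_I2)
       (use nn le in \<open>simp_all\<close>)
qed

private definition form_char where
  "form_char T U \<xi> = symmetric_form.X J (form \<xi>) (\<lambda>i. k *\<^sub>R lin_adj T \<xi> i) (\<lambda>i. k *\<^sub>R lin_adj U \<xi> i)"

private lemma E_eq_integral_char:
  assumes T: "lin_on J T" and U: "lin_on J U"
  shows "integrable gauss (form_char T U)" "complex_of_real (E T U) = (\<integral>\<xi>. form_char T U \<xi> \<partial>gauss)"
proof -
  interpret P: pair_prob_space "gauss :: 'b measure" N ..
  have comp [measurable]: "(\<lambda>c. c i) \<in> borel_measurable N" if "i \<in> J" for i
    using that by (rule component_gauss)
  note [measurable] = measurable_form
  define H where "H \<xi> c = symmetric_form.h J (form \<xi>) (\<lambda>i. k *\<^sub>R lin_adj T \<xi> i) (\<lambda>i. k *\<^sub>R lin_adj U \<xi> i) c" for \<xi> c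
  have form_char: "form_char T U \<xi> = (\<integral>c. H \<xi> c \<partial>N)" for \<xi>
    unfolding form_char_def symmetric_form.X_def[OF form] H_def ..
  have [measurable]: "case_prod H \<in> borel_measurable (gauss \<Otimes>\<^sub>M N)"
    unfolding H_def symmetric_form.h_def[OF form] symmetric_form.Q_def[OF form] by measurable
  have int: "integrable (gauss \<Otimes>\<^sub>M N) (case_prod H)"
    by (rule P.P.integrable_const_bound[where B = 1])
       (auto intro!: AE_I2 symmetric_form.cmod_h_le_1[OF form] simp: H_def)
  show "integrable gauss (form_char T U)"
    using P.integrable_fst'[OF int] unfolding form_char[abs_def] by simp
  have "complex_of_real (E T U) = (\<integral>c. complex_of_real (\<integral>b. exp (- s * (norm ((U b + S b c) + T c))\<^sup>2) \<partial>N) \<partial>N)"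
    by (simp add: E_def add_ac)
  also have "\<dots> = (\<integral>c. \<integral>\<xi>. H \<xi> c \<partial>gauss \<partial>N)"
  proof (intro Bochner_Integration.integral_cong refl)
    fix c
    show "complex_of_real (\<integral>b. exp (- s * (norm ((U b + S b c) + T c))\<^sup>2) \<partial>N) = (\<integral>\<xi>. H \<xi> c \<partial>gauss)"
      unfolding integral_gauss_exp_neg_norm_lin_on[OF lin_on_plus[OF U S] J s] k_def[symmetric]
      by (simp add: H_def symmetric_form.h_def[OF form] symmetric_form.Q_def[OF form] form_def
          inner_lin_on[OF T J] sum_distrib_left lin_adj_add scaleR_add_right)
  qed
  also have "\<dots> = (\<integral>\<xi>. form_char T U \<xi> \<partial>gauss)"
    unfolding form_char by (rule P.Fubini_integral[OF int])
  finally show "complex_of_real (E T U) = (\<integral>\<xi>. form_char T U \<xi> \<partial>gauss)" .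
qed

text \<open>When one of the two linear terms is absent, the characteristic function is positive, so that
  nothing is lost in replacing the transforms on the right by averages of \<open>f\<close>.\<close>

lemma gauss_bilinear_split_le:
  assumes T: "lin_on J T" and U: "lin_on J U" and l: "0 < l" "l < 1"
  shows "(\<integral>\<^sup>+c. \<integral>\<^sup>+b. gexp s (T c + U b + S b c) \<partial>gauss_vec J \<partial>gauss_vec J)
    \<le> ennreal l * (\<integral>\<^sup>+c. \<integral>\<^sup>+b. gexp s (T c /\<^sub>R sqrt l + S b c) \<partial>gauss_vec J \<partial>gauss_vec J)
     + ennreal (1 - l) * (\<integral>\<^sup>+c. \<integral>\<^sup>+b. gexp s (U b /\<^sub>R sqrt (1 - l) + S b c) \<partial>gauss_vec J \<partial>gauss_vec J)"
proof -
  let ?T = "\<lambda>c. T c /\<^sub>R sqrt l" and ?U = "\<lambda>b. U b /\<^sub>R sqrt (1 - l)" and ?O = "\<lambda>_. 0 :: 'b"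
  note T' = lin_on_scale[OF T, of "inverse (sqrt l)"] and U' = lin_on_scale[OF U, of "inverse (sqrt (1 - l))"]
  note O = lin_on_const_zero[of J]
  define F where "F \<xi> x = symmetric_form.f J (form \<xi>) x" for \<xi> x
  have charT: "form_char ?T ?O \<xi> = complex_of_real (F \<xi> (\<lambda>i. (k *\<^sub>R lin_adj T \<xi> i) /\<^sub>R sqrt l))" for \<xi>
    by (simp add: form_char_def lin_adj_zero lin_adj_scaleR symmetric_form.X_zero_right[OF form] F_def mult.commute)
  have charU: "form_char ?O ?U \<xi> = complex_of_real (F \<xi> (\<lambda>i. (k *\<^sub>R lin_adj U \<xi> i) /\<^sub>R sqrt (1 - l)))" for \<xi>
    by (simp add: form_char_def lin_adj_zero lin_adj_scaleR symmetric_form.X_zero_left[OF form] F_def mult.commute)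
  note intT = E_eq_integral_char(1)[OF T' O] and intU = E_eq_integral_char(1)[OF O U']
  have "E T U = cmod (complex_of_real (E T U))"
    by (simp add: E_def integral_nonneg_AE)
  also have "\<dots> \<le> (\<integral>\<xi>. cmod (form_char T U \<xi>) \<partial>gauss)"
    unfolding E_eq_integral_char(2)[OF T U] by (rule integral_norm_bound)
  also have "\<dots> \<le> (\<integral>\<xi>. l * Re (form_char ?T ?O \<xi>) + (1 - l) * Re (form_char ?O ?U \<xi>) \<partial>gauss)"
  proof (rule integral_mono)
    show "cmod (form_char T U \<xi>) \<le> l * Re (form_char ?T ?O \<xi>) + (1 - l) * Re (form_char ?O ?U \<xi>)" for \<xi>
      unfolding charT charU F_def Re_complex_of_real unfolding form_char_def by (rule symmetric_form.cmod_X_le[OF form l])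
  qed (use E_eq_integral_char(1)[OF T U] intT intU in auto)
  also have "\<dots> = l * Re (\<integral>\<xi>. form_char ?T ?O \<xi> \<partial>gauss) + (1 - l) * Re (\<integral>\<xi>. form_char ?O ?U \<xi> \<partial>gauss)"
    using intT intU by simp
  also have "\<dots> = l * E ?T ?O + (1 - l) * E ?O ?U"
    by (simp add: E_eq_integral_char(2)[OF T' O, symmetric] E_eq_integral_char(2)[OF O U', symmetric])
  finally have "ennreal (E T U) \<le> ennreal l * ennreal (E ?T ?O) + ennreal (1 - l) * ennreal (E ?O ?U)"
    using l by (simp add: ennreal_mult[symmetric] ennreal_plus[symmetric] E_def integral_nonneg_AE del: ennreal_plus)
  then show ?thesis
    unfolding nn_integral_E[OF T U, symmetric] nn_integral_E[OF T' O, symmetric] nn_integral_E[OF O U', symmetric] by simp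
qed

end

section \<open>Permanents as multilinear forms\<close>

lemma row_per_cong:
  assumes "\<And>ij. ij \<in> mat_idx n \<Longrightarrow> A ij = B ij"
  shows "row_per n A = row_per n B"
  unfolding row_per_def
proof (intro sum.cong refl arg_cong[where f = prod_list] map_cong)
  fix \<sigma> i assume "\<sigma> \<in> {\<sigma>. \<sigma> permutes {1..n}}" "i \<in> set [1..<Suc n]"
  then have "i \<in> {1..n}" "\<sigma> i \<in> {1..n}" using permutes_in_image[of \<sigma> "{1..n}" i] by auto
  then show "A (i, \<sigma> i) = B (i, \<sigma> i)" using assms by auto
qed

lemma measurable_prod_list:
  fixes f :: "'i \<Rightarrow> 'w \<Rightarrow> 'k::{euclidean_space,real_normed_div_algebra}"
  assumes "\<And>i. i \<in> set xs \<Longrightarrow> f i \<in> borel_measurable M"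
  shows "(\<lambda>\<omega>. prod_list (map (\<lambda>i. f i \<omega>) xs)) \<in> borel_measurable M"
  using assms by (induction xs) (auto intro!: borel_measurable_times)

lemma measurable_row_per:
  fixes A :: "'w \<Rightarrow> 'k::{euclidean_space,real_normed_div_algebra} mat"
  assumes "\<And>ij. ij \<in> mat_idx n \<Longrightarrow> (\<lambda>\<omega>. A \<omega> ij) \<in> borel_measurable M"
  shows "(\<lambda>\<omega>. row_per n (A \<omega>)) \<in> borel_measurable M"
  unfolding row_per_def
proof (intro borel_measurable_sum measurable_prod_list assms)
  fix \<sigma> i assume "\<sigma> \<in> {\<sigma>. \<sigma> permutes {1..n}}" "i \<in> set [1..<Suc n]"
  then show "(i, \<sigma> i) \<in> mat_idx n" using permutes_in_image[of \<sigma> "{1..n}" i] by auto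
qed

lemma prod_list_split_at:
  assumes "i \<in> {1..n}"
  shows "prod_list (map g [1..<Suc n]) = prod_list (map g [1..<i]) * g i * prod_list (map g [Suc i..<Suc n])"
proof -
  have "[1..<Suc n] = [1..<i] @ i # [Suc i..<Suc n]"
    using assms upt_add_eq_append[of 1 i "Suc n - i"] by (auto simp: upt_conv_Cons simp del: upt_Suc)
  then show ?thesis by (simp add: mult.assoc del: upt_Suc)
qed

text \<open>Rows and columns share the property that the graph of every permutation meets them exactly once.
  This is all that is needed for the permanent to be linear in their entries.\<close>

definition crossing :: "nat \<Rightarrow> (nat \<times> nat) set \<Rightarrow> bool" where
  "crossing n I \<longleftrightarrow> (\<forall>\<sigma>. \<sigma> permutes {1..n} \<longrightarrow> (\<exists>k\<in>{1..n}. \<forall>i\<in>{1..n}. (i, \<sigma> i) \<in> I \<longleftrightarrow> i = k))"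

lemma crossing_row: "k \<in> {1..n} \<Longrightarrow> crossing n ({k} \<times> {1..n})"
  unfolding crossing_def using permutes_in_image by fastforce

lemma crossing_column:
  assumes "p \<in> {1..n}"
  shows "crossing n ({1..n} \<times> {p})"
  unfolding crossing_def
proof (intro allI impI)
  fix \<sigma> assume \<sigma>: "\<sigma> permutes {1..n}"
  show "\<exists>k\<in>{1..n}. \<forall>i\<in>{1..n}. (i, \<sigma> i) \<in> {1..n} \<times> {p} \<longleftrightarrow> i = k"
    using permutes_inverses[OF \<sigma>] permutes_in_image[OF permutes_inv[OF \<sigma>], of p] assms
    by (intro bexI[of _ "inv \<sigma> p"]) auto
qed

lemma lin_on_sum_fun: "(\<And>\<sigma>. \<sigma> \<in> A \<Longrightarrow> lin_on I (T \<sigma>)) \<Longrightarrow> lin_on I (\<lambda>x. \<Sum>\<sigma>\<in>A. T \<sigma> x)"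
  by (induction A rule: infinite_finite_induct) (simp_all add: lin_on_plus lin_on_const_zero)

lemma lin_on_comp: "lin_on I T \<Longrightarrow> f ` I \<subseteq> K \<Longrightarrow> lin_on K (\<lambda>x. T (\<lambda>i. x (f i)))"
  unfolding lin_on_def by (auto simp: image_subset_iff)

lemma lin_on_row_per:
  fixes C :: "'k::{euclidean_space,real_normed_div_algebra} mat"
  assumes "crossing n I"
  shows "lin_on I (\<lambda>x. row_per n (\<lambda>ij. if ij \<in> I then x ij else C ij))"
  unfolding row_per_def
proof (rule lin_on_sum_fun)
  fix \<sigma> assume "\<sigma> \<in> {\<sigma>. \<sigma> permutes {1..n}}"
  then obtain k where k: "k \<in> {1..n}" "\<And>i. i \<in> {1..n} \<Longrightarrow> (i, \<sigma> i) \<in> I \<longleftrightarrow> i = k"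
    using assms unfolding crossing_def by auto
  define L R where "L = prod_list (map (\<lambda>i. C (i, \<sigma> i)) [1..<k])" and "R = prod_list (map (\<lambda>i. C (i, \<sigma> i)) [Suc k..<Suc n])"
  have "prod_list (map (\<lambda>i. if (i, \<sigma> i) \<in> I then x (i, \<sigma> i) else C (i, \<sigma> i)) [1..<Suc n]) = L * x (k, \<sigma> k) * R" for x
  proof -
    have "map (\<lambda>i. if (i, \<sigma> i) \<in> I then x (i, \<sigma> i) else C (i, \<sigma> i)) [1..<k] = map (\<lambda>i. C (i, \<sigma> i)) [1..<k]"
      "map (\<lambda>i. if (i, \<sigma> i) \<in> I then x (i, \<sigma> i) else C (i, \<sigma> i)) [Suc k..<Suc n] = map (\<lambda>i. C (i, \<sigma> i)) [Suc k..<Suc n]"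
      using k by (auto simp del: upt_Suc)
    then show ?thesis
      using k(2)[OF k(1)] unfolding L_def R_def prod_list_split_at[OF k(1)] by (simp only: refl if_True)
  qed
  moreover have "lin_on I (\<lambda>x. L * x (k, \<sigma> k) * R)"
    using k unfolding lin_on_def by (auto simp: distrib_left distrib_right)
  ultimately show "lin_on I (\<lambda>x. prod_list (map (\<lambda>i. if (i, \<sigma> i) \<in> I then x (i, \<sigma> i) else C (i, \<sigma> i)) [1..<Suc n]))"
    by simp
qed

text \<open>Permuting the columns leaves the row order of the factors alone, so this also holds for
  quaternions.\<close>

lemma row_per_permute_columns:
  assumes "\<tau> permutes {1..n}"
  shows "row_per n (\<lambda>(i, j). A (i, \<tau> j)) = row_per n A"
  unfolding row_per_def
  by (rule sum.reindex_bij_witness[where i = "\<lambda>\<sigma>. inv \<tau> \<circ> \<sigma>" and j = "\<lambda>\<sigma>. \<tau> \<circ> \<sigma>"])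
     (auto simp: permutes_inverses[OF assms] o_def permutes_compose[OF _ assms, unfolded o_def]
        permutes_compose[OF _ permutes_inv[OF assms], unfolded o_def] simp del: One_nat_def)

section \<open>Removing the shift row by row\<close>

lemma nn_integral_PiM_gauss_split:
  assumes "finite K" "finite I" "K \<inter> I = {}" "K \<union> I = M" and f: "f \<in> borel_measurable (gauss_vec M)"
  shows "(\<integral>\<^sup>+x. f x \<partial>gauss_vec M) =
    (\<integral>\<^sup>+R. \<integral>\<^sup>+x. f (merge K I (R, x)) \<partial>gauss_vec I \<partial>gauss_vec K)"
  using f assms(1-3) unfolding assms(4)[symmetric]
  by (intro gauss_PiM.product_nn_integral_fold)

definition laplace_per :: "'k::{euclidean_space,real_normed_div_algebra} itself \<Rightarrow> nat \<Rightarrow> real \<Rightarrow> ennreal" where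
  "laplace_per _ n s = (\<integral>\<^sup>+A. gexp s (row_per n A :: 'k) \<partial>gauss_vec (mat_idx n))"

text \<open>With all other rows fixed, the permanent is a linear map of row \<open>k\<close>. The
  contribution of row \<open>k\<close> of \<open>z\<close> and the point \<open>w\<close> are
  constants for this map, and both disappear.\<close>

lemma shift_row_le:
  fixes z :: "'k::{euclidean_space,real_normed_div_algebra} mat"
  assumes k: "k \<in> {1..n}" and s: "0 \<le> s"
  shows "(\<integral>\<^sup>+A. gexp s (row_per n (\<lambda>ij. z ij + A ij) - w) \<partial>gauss_vec (mat_idx n))
    \<le> (\<integral>\<^sup>+A. gexp s (row_per n (\<lambda>ij. (if fst ij = k then 0 else z ij) + A ij)) \<partial>gauss_vec (mat_idx n))"
proof -
  define I where "I = {k} \<times> {1..n}"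
  define K where "K = mat_idx n - I"
  have I: "finite I" and K: "finite K" and split: "K \<inter> I = {}" "K \<union> I = mat_idx n"
    using k by (auto simp: I_def K_def)
  have fold: "(\<integral>\<^sup>+A. gexp s (row_per n (\<lambda>ij. y ij + A ij) - v) \<partial>gauss_vec (mat_idx n)) =
      (\<integral>\<^sup>+R. \<integral>\<^sup>+x. gexp s (row_per n (\<lambda>ij. y ij + merge K I (R, x) ij) - v)
        \<partial>gauss_vec I \<partial>gauss_vec K)" for y :: "'k mat" and v
  proof (rule nn_integral_PiM_gauss_split[OF K I split])
    have [measurable]: "(\<lambda>A. row_per n (\<lambda>ij. y ij + A ij)) \<in> borel_measurable (gauss_vec (mat_idx n))"
      by (rule measurable_row_per) (auto intro!: borel_measurable_add component_gauss)
    show "(\<lambda>A. gexp s (row_per n (\<lambda>ij. y ij + A ij) - v)) \<in> borel_measurable (gauss_vec (mat_idx n))"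
      by measurable
  qed
  define T where "T R x = row_per n (\<lambda>ij. if ij \<in> I then x ij else z ij + R ij)" for R x
  have T: "lin_on I (T R)" for R
    unfolding T_def I_def by (rule lin_on_row_per[OF crossing_row[OF k]])
  have 1: "row_per n (\<lambda>ij. z ij + merge K I (R, x) ij) = T R x + T R z" for R x
  proof -
    have "row_per n (\<lambda>ij. z ij + merge K I (R, x) ij) = T R (\<lambda>ij. x ij + z ij)"
      unfolding T_def by (rule row_per_cong) (auto simp: merge_def K_def)
    then show ?thesis by (simp add: lin_on_add[OF T])
  qed
  have 2: "row_per n (\<lambda>ij. (if fst ij = k then 0 else z ij) + merge K I (R, x) ij) = T R x" for R x
    unfolding T_def by (rule row_per_cong) (auto simp: merge_def K_def I_def)
  show ?thesis
    unfolding fold[of _ 0, unfolded diff_zero] fold[of z w] 1 2 add_diff_eq[symmetric]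
    by (intro nn_integral_mono gauss_lin_on_shift_le[OF T I s])
qed

lemma shifted_per_le_laplace_per:
  fixes z :: "'k::{euclidean_space,real_normed_div_algebra} mat"
  assumes n: "1 \<le> n" and s: "0 \<le> s"
  shows "(\<integral>\<^sup>+A. gexp s (row_per n (\<lambda>ij. z ij + A ij) - w) \<partial>gauss_vec (mat_idx n))
    \<le> laplace_per TYPE('k) n s"
proof -
  let ?\<Gamma> = "PiM (mat_idx n) (\<lambda>_. gauss :: 'k measure)"
  define e where "e y v = (\<integral>\<^sup>+A. gexp s (row_per n (\<lambda>ij. y ij + A ij) - v) \<partial>?\<Gamma>)" for y v
  have step: "e y v \<le> e (\<lambda>ij. if fst ij = k then 0 else y ij) 0" if "k \<in> {1..n}" for k y v
    using shift_row_le[OF that s] unfolding e_def by simp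
  have rows: "e z w \<le> e (\<lambda>ij. if fst ij \<le> Suc m then 0 else z ij) 0" if "Suc m \<le> n" for m
    using that
  proof (induction m)
    case 0
    have "e z w \<le> e (\<lambda>ij. if fst ij = 1 then 0 else z ij) 0" using n by (intro step) auto
    also have "\<dots> = e (\<lambda>ij. if fst ij \<le> Suc 0 then 0 else z ij) 0"
      unfolding e_def by (intro nn_integral_cong arg_cong[where f = "\<lambda>x. gexp s (x - 0)"] row_per_cong) auto
    finally show ?case .
  next
    case (Suc m)
    then have "e z w \<le> e (\<lambda>ij. if fst ij \<le> Suc m then 0 else z ij) 0" by simp
    also have "\<dots> \<le> e (\<lambda>ij. if fst ij = Suc (Suc m) then 0 else if fst ij \<le> Suc m then 0 else z ij) 0"
      using Suc.prems by (intro step) auto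
    also have "(\<lambda>ij. if fst ij = Suc (Suc m) then 0 else if fst ij \<le> Suc m then 0 else z ij) =
        (\<lambda>ij. if fst ij \<le> Suc (Suc m) then 0 else z ij)" by (auto simp: fun_eq_iff)
    finally show ?case .
  qed
  obtain m where m: "n = Suc m" using n by (cases n) auto
  have "e (\<lambda>ij. if fst ij \<le> Suc m then 0 else z ij) 0 = laplace_per TYPE('k) n s"
    unfolding e_def laplace_per_def diff_zero
    by (intro nn_integral_cong arg_cong[where f = "\<lambda>x. gexp s x"] row_per_cong) (auto simp: m)
  then show ?thesis using rows[of m] m by (simp add: e_def)
qed

section \<open>Concentrating the last row in one column\<close>

definition last_row :: "nat \<Rightarrow> (nat \<Rightarrow> 'k) \<Rightarrow> 'k mat \<Rightarrow> 'k mat" where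
  "last_row n u B = (\<lambda>(i, j). if i = n then u j else B (i, j))"

definition laplace_last_row :: "nat \<Rightarrow> real \<Rightarrow> (nat \<Rightarrow> 'k::{euclidean_space,real_normed_div_algebra}) \<Rightarrow> ennreal" where
  "laplace_last_row n s u = (\<integral>\<^sup>+B. gexp s (row_per n (last_row n u B))
     \<partial>gauss_vec ({1..<n} \<times> {1..n}))"

definition two_columns :: "nat \<Rightarrow> nat \<Rightarrow> nat \<Rightarrow> 'k mat \<Rightarrow> (nat \<Rightarrow> 'k) \<Rightarrow> (nat \<Rightarrow> 'k) \<Rightarrow> 'k::ring_1" where
  "two_columns n p q R x y = row_per n (\<lambda>(i, j). if j = p then x i else if j = q then y i else R (i, j))"

lemma lin_on_two_columns_left:
  fixes R :: "'k::{euclidean_space,real_normed_div_algebra} mat"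
  assumes p: "p \<in> {1..n}"
  shows "lin_on {1..n} (\<lambda>x. two_columns n p q R x y)"
proof -
  have "two_columns n p q R x y = row_per n (\<lambda>ij. if ij \<in> {1..n} \<times> {p} then x (fst ij)
      else (\<lambda>(i, j). if j = q then y i else R (i, j)) ij)" for x
    unfolding two_columns_def by (rule row_per_cong) (auto split: if_splits)
  then show ?thesis
    using lin_on_comp[OF lin_on_row_per[OF crossing_column[OF p]], where f = fst and K = "{1..n}"] by simp
qed

lemma two_columns_commute:
  assumes "p \<in> {1..n}" "q \<in> {1..n}" "p \<noteq> q"
  shows "two_columns n p q R x y = two_columns n p q R y x"
proof -
  let ?A = "\<lambda>x y (i, j). if j = p then x i else if j = q then y i else R (i, j)"
  have "row_per n (?A x y) = row_per n (\<lambda>(i, j). ?A x y (i, Transposition.transpose p q j))"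
    by (rule row_per_permute_columns[symmetric]) (rule permutes_swap_id[OF assms(1,2)])
  also have "\<dots> = row_per n (?A y x)"
    using assms(3) by (intro row_per_cong) (auto simp: Transposition.transpose_def)
  finally show ?thesis by (simp add: two_columns_def)
qed

text \<open>No permutation passes through both entries.\<close>

lemma two_columns_same_row:
  fixes R :: "'k::{euclidean_space,real_normed_div_algebra} mat"
  assumes "p \<in> {1..n}" "q \<in> {1..n}" "p \<noteq> q"
  shows "two_columns n p q R (single k u) (single k v) = 0"
  unfolding two_columns_def row_per_def
proof (rule sum.neutral, rule ballI)
  fix \<sigma> assume "\<sigma> \<in> {\<sigma>. \<sigma> permutes {1..n}}"
  then have \<sigma>: "\<sigma> permutes {1..n}" by simp
  define i j where "i = inv \<sigma> p" and "j = inv \<sigma> q"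
  have ij: "\<sigma> i = p" "\<sigma> j = q" "i \<in> {1..n}" "j \<in> {1..n}"
    using permutes_inverses[OF \<sigma>] permutes_in_image[OF permutes_inv[OF \<sigma>]] assms by (auto simp: i_def j_def)
  have "i \<noteq> k \<or> j \<noteq> k" using ij assms by auto
  define g where "g i = (\<lambda>(i, j). if j = p then single k u i else if j = q then single k v i else R (i, j)) (i, \<sigma> i)" for i
  have "\<exists>i\<in>{1..n}. g i = 0"
    using \<open>i \<noteq> k \<or> j \<noteq> k\<close> ij assms by (auto simp: single_def g_def intro: bexI[of _ i] bexI[of _ j])
  then obtain r where r: "r \<in> {1..n}" "g r = 0" ..
  have "g r \<in> set (map g [1..<Suc n])" using r by (auto simp del: upt_Suc)
  then have "prod_list (map g [1..<Suc n]) = 0" using r by (metis prod_list_zero_iff)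
  then show "prod_list (map (\<lambda>i. (\<lambda>(i, j). if j = p then single k u i else if j = q then single k v i else R (i, j)) (i, \<sigma> i)) [1..<Suc n]) = 0"
    unfolding g_def .
qed

text \<open>A column with lower entry \<open>v\<close> whose upper entries are those of \<open>b\<close>.\<close>

definition snoc_entry :: "nat \<Rightarrow> 'k \<Rightarrow> (nat \<Rightarrow> 'k) \<Rightarrow> nat \<Rightarrow> 'k" where
  "snoc_entry n v b = (\<lambda>i. if i = n then v else b i)"

text \<open>Of the four terms of the bilinear expansion, the one that takes the last entry in both columns
  vanishes. The others have the shape required by \<open>gauss_bilinear_split_le\<close>.\<close>

lemma two_columns_snoc:
  fixes R :: "'k::{euclidean_space,real_normed_div_algebra} mat"
  assumes p: "p \<in> {1..n}" and q: "q \<in> {1..n}" and pq: "p \<noteq> q"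
  shows "two_columns n p q R (snoc_entry n u b) (snoc_entry n v c) =
    two_columns n p q R (single n u) (snoc_entry n 0 c) + two_columns n p q R (single n v) (snoc_entry n 0 b) +
    two_columns n p q R (snoc_entry n 0 b) (snoc_entry n 0 c)"
proof -
  note comm = two_columns_commute[OF p q pq]
  note add = lin_on_add[OF lin_on_two_columns_left[OF p]]
  have snoc: "snoc_entry n w d = (\<lambda>i. single n w i + snoc_entry n 0 d i)" for w :: 'k and d
    by (auto simp: single_def snoc_entry_def)
  have "two_columns n p q R (snoc_entry n u b) (snoc_entry n v c) =
      two_columns n p q R (single n u) (snoc_entry n v c) + two_columns n p q R (snoc_entry n 0 b) (snoc_entry n v c)"
    unfolding snoc[of u b] by (rule add)
  also have "two_columns n p q R (single n u) (snoc_entry n v c) = two_columns n p q R (single n u) (snoc_entry n 0 c)"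
    unfolding snoc[of v c] comm[of R "single n u"] add using two_columns_same_row[OF p q pq] by simp
  also have "two_columns n p q R (snoc_entry n 0 b) (snoc_entry n v c) =
      two_columns n p q R (single n v) (snoc_entry n 0 b) + two_columns n p q R (snoc_entry n 0 b) (snoc_entry n 0 c)"
    unfolding snoc[of v c] comm[of R "snoc_entry n 0 b"] add ..
  finally show ?thesis by (simp only: add.assoc)
qed

lemma nn_integral_PiM_gauss_column:
  fixes f :: "(nat \<times> nat \<Rightarrow> 'k::euclidean_space) \<Rightarrow> ennreal"
  assumes "finite K" "finite J" "K \<inter> J \<times> {p} = {}" "K \<union> J \<times> {p} = M" and f [measurable]: "f \<in> borel_measurable (gauss_vec M)"
  shows "(\<integral>\<^sup>+x. f x \<partial>gauss_vec M) =
    (\<integral>\<^sup>+R. \<integral>\<^sup>+b. f (merge K (J \<times> {p}) (R, \<lambda>ij\<in>J \<times> {p}. b (fst ij))) \<partial>gauss_vec J \<partial>gauss_vec K)"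
proof -
  have distr: "distr (gauss_vec J) (gauss_vec (J \<times> {p})) (\<lambda>b. \<lambda>ij\<in>J \<times> {p}. b (fst ij)) = PiM (J \<times> {p}) (\<lambda>_. gauss :: 'k measure)"
    by (rule distr_PiM_reindex[where K = J and M = "\<lambda>_. gauss :: 'k measure" and f = fst]) (auto simp: inj_on_def gauss.prob_space_axioms)
  have [measurable]: "(\<lambda>b. \<lambda>ij\<in>J \<times> {p}. b (fst ij)) \<in> measurable (PiM J (\<lambda>_. gauss :: 'k measure)) (gauss_vec (J \<times> {p}))"
    by (rule measurable_restrict) (auto intro: measurable_component_singleton)
  have "(\<integral>\<^sup>+x. f x \<partial>gauss_vec M) =
    (\<integral>\<^sup>+R. \<integral>\<^sup>+x. f (merge K (J \<times> {p}) (R, x)) \<partial>gauss_vec (J \<times> {p}) \<partial>gauss_vec K)"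
    using assms by (intro nn_integral_PiM_gauss_split) auto
  also have "\<dots> = (\<integral>\<^sup>+R. \<integral>\<^sup>+b. f (merge K (J \<times> {p}) (R, \<lambda>ij\<in>J \<times> {p}. b (fst ij))) \<partial>gauss_vec J \<partial>gauss_vec K)"
  proof (rule nn_integral_cong)
    fix R assume R: "R \<in> space (PiM K (\<lambda>_. gauss :: 'k measure))"
    have "(\<lambda>x. merge K (J \<times> {p}) (R, x)) \<in> measurable (gauss_vec (J \<times> {p})) (gauss_vec (K \<union> J \<times> {p}))"
      by (rule measurable_compose[OF measurable_Pair1'[OF R] measurable_merge])
    then have [measurable]: "(\<lambda>x. f (merge K (J \<times> {p}) (R, x))) \<in> borel_measurable (gauss_vec (J \<times> {p}))"
      using f unfolding assms(4)[symmetric] by (rule measurable_compose)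
    show "(\<integral>\<^sup>+x. f (merge K (J \<times> {p}) (R, x)) \<partial>gauss_vec (J \<times> {p})) =
      (\<integral>\<^sup>+b. f (merge K (J \<times> {p}) (R, \<lambda>ij\<in>J \<times> {p}. b (fst ij))) \<partial>gauss_vec J)"
      by (subst distr[symmetric], subst nn_integral_distr) measurable
  qed
  finally show ?thesis .
qed

lemma measurable_last_row:
  fixes u :: "nat \<Rightarrow> 'k::{euclidean_space,real_normed_div_algebra}"
  shows "(\<lambda>B. row_per n (last_row n u B)) \<in> borel_measurable (gauss_vec ({1..<n} \<times> {1..n}))"
proof (rule measurable_row_per)
  fix ij assume "ij \<in> mat_idx n"
  then show "(\<lambda>B. last_row n u B ij) \<in> borel_measurable (gauss_vec ({1..<n} \<times> {1..n}))"
    by (cases ij; cases "fst ij = n") (auto simp: last_row_def intro!: component_gauss)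
qed

lemma laplace_last_row_two_columns:
  fixes u :: "nat \<Rightarrow> 'k::{euclidean_space,real_normed_div_algebra}"
  assumes p: "p \<in> {1..n}" and q: "q \<in> {1..n}" and pq: "p \<noteq> q"
  defines "J \<equiv> {1..<n}"
  defines "K \<equiv> J \<times> ({1..n} - {p, q})"
  shows "laplace_last_row n s u = (\<integral>\<^sup>+R. \<integral>\<^sup>+c. \<integral>\<^sup>+b. gexp s (two_columns n p q (last_row n u R)
      (snoc_entry n (u p) b) (snoc_entry n (u q) c)) \<partial>gauss_vec J \<partial>gauss_vec J \<partial>gauss_vec K)"
proof -
  define K' where "K' = K \<union> J \<times> {q}"
  have fin: "finite K" "finite K'" "finite J" by (auto simp: K_def K'_def J_def)
  have s1: "K' \<inter> J \<times> {p} = {}" "K' \<union> J \<times> {p} = {1..<n} \<times> {1..n}" using p q pq by (auto simp: K'_def K_def J_def)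
  have s2: "K \<inter> J \<times> {q} = {}" "K \<union> J \<times> {q} = K'" using pq by (auto simp: K'_def K_def)
  note [measurable] = measurable_last_row
  have [measurable]: "(\<lambda>b. \<lambda>ij\<in>J \<times> {p}. b (fst ij)) \<in> measurable (PiM J (\<lambda>_. gauss :: 'k measure)) (gauss_vec (J \<times> {p}))"
    by (rule measurable_restrict) (auto intro: measurable_component_singleton)
  have mg [measurable]: "merge K' (J \<times> {p}) \<in> measurable (gauss_vec K' \<Otimes>\<^sub>M gauss_vec (J \<times> {p})) (PiM ({1..<n} \<times> {1..n}) (\<lambda>_. gauss :: 'k measure))"
    unfolding s1(2)[symmetric] by (rule measurable_merge)
  define F where "F B = gexp s (row_per n (last_row n u B))" for B
  have F [measurable]: "F \<in> borel_measurable (gauss_vec ({1..<n} \<times> {1..n}))" unfolding F_def by measurable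
  have "laplace_last_row n s u = (\<integral>\<^sup>+R'. \<integral>\<^sup>+b. F (merge K' (J \<times> {p}) (R', \<lambda>ij\<in>J \<times> {p}. b (fst ij))) \<partial>gauss_vec J \<partial>gauss_vec K')"
    unfolding laplace_last_row_def F_def[symmetric] by (rule nn_integral_PiM_gauss_column[OF fin(2,3) s1 F])
  also have "\<dots> = (\<integral>\<^sup>+R. \<integral>\<^sup>+c. \<integral>\<^sup>+b. F (merge K' (J \<times> {p}) (merge K (J \<times> {q}) (R, \<lambda>ij\<in>J \<times> {q}. c (fst ij)), \<lambda>ij\<in>J \<times> {p}. b (fst ij)))
      \<partial>gauss_vec J \<partial>gauss_vec J \<partial>gauss_vec K)"
    by (rule nn_integral_PiM_gauss_column[OF fin(1,3) s2]) measurable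
  also have "\<dots> = (\<integral>\<^sup>+R. \<integral>\<^sup>+c. \<integral>\<^sup>+b. gexp s (two_columns n p q (last_row n u R)
      (snoc_entry n (u p) b) (snoc_entry n (u q) c)) \<partial>gauss_vec J \<partial>gauss_vec J \<partial>gauss_vec K)"
    unfolding F_def two_columns_def
    by (intro nn_integral_cong arg_cong[where f = "\<lambda>x. gexp s x"] row_per_cong)
       (use pq in \<open>auto simp: last_row_def snoc_entry_def merge_def K'_def K_def J_def\<close>)
  finally show ?thesis .
qed

text \<open>Conditionally on the other columns this is \<open>gauss_bilinear_split_le\<close>, applied to
  the expansion \<open>two_columns_snoc\<close>.\<close>

lemma laplace_last_row_split_le:
  fixes u :: "nat \<Rightarrow> 'k::{euclidean_space,real_normed_div_algebra}"
  assumes p: "p \<in> {1..n}" and q: "q \<in> {1..n}" and pq: "p \<noteq> q" and s: "0 \<le> s" and l: "0 < l" "l < 1"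
  shows "laplace_last_row n s u \<le> ennreal l * laplace_last_row n s (u(p := u p /\<^sub>R sqrt l, q := 0)) +
    ennreal (1 - l) * laplace_last_row n s (u(p := 0, q := u q /\<^sub>R sqrt (1 - l)))"
proof -
  define J where "J = {1..<n}"
  define K where "K = J \<times> ({1..n} - {p, q})"
  note two = laplace_last_row_two_columns[OF p q pq, of s, folded J_def, folded K_def]
  define W where "W R = two_columns n p q (last_row n u R)" for R
  define D where "D v w R = (\<integral>\<^sup>+c. \<integral>\<^sup>+b. gexp s (W R (snoc_entry n v b) (snoc_entry n w c))
    \<partial>gauss_vec J \<partial>gauss_vec J)" for v w R
  have D: "laplace_last_row n s (u(p := v, q := w)) = (\<integral>\<^sup>+R. D v w R \<partial>gauss_vec K)" for v w
  proof -
    have "two_columns n p q (last_row n (u(p := v, q := w)) R) x y = W R x y" for R x y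
      unfolding W_def two_columns_def by (rule row_per_cong) (auto simp: last_row_def)
    then show ?thesis unfolding two D_def using pq by simp
  qed
  have WM: "(\<lambda>z. W (fst (fst z)) (snoc_entry n v (snd z)) (snoc_entry n w (snd (fst z)))) \<in>
      borel_measurable ((gauss_vec K \<Otimes>\<^sub>M gauss_vec J) \<Otimes>\<^sub>M gauss_vec J)" for v w
    unfolding W_def two_columns_def
  proof (rule measurable_row_per)
    fix ij assume ij: "ij \<in> mat_idx n"
    obtain i j where ij': "ij = (i, j)" by force
    let ?M = "(gauss_vec K \<Otimes>\<^sub>M gauss_vec J) \<Otimes>\<^sub>M PiM J (\<lambda>_. gauss :: 'k measure)"
    have "(\<lambda>z. snd z i) \<in> borel_measurable ?M" "(\<lambda>z. snd (fst z) i) \<in> borel_measurable ?M" if "i \<noteq> n"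
      using that ij ij' by (auto simp: J_def intro!: measurable_compose[OF _ component_gauss])
    moreover have "(\<lambda>z. fst (fst z) (i, j)) \<in> borel_measurable ?M" if "i \<noteq> n" "j \<noteq> p" "j \<noteq> q"
      using that ij ij' by (auto simp: J_def K_def intro!: measurable_compose[OF _ component_gauss])
    ultimately show "(\<lambda>z. (\<lambda>(i, j). if j = p then snoc_entry n v (snd z) i else if j = q then snoc_entry n w (snd (fst z)) i
        else last_row n u (fst (fst z)) (i, j)) ij) \<in> borel_measurable ?M"
      unfolding ij' by (cases "i = n"; cases "j = p"; cases "j = q") (simp_all add: snoc_entry_def last_row_def)
  qed
  have [measurable]: "D v w \<in> borel_measurable (gauss_vec K)" for v w
  proof -
    define g where "g z = gexp s (W (fst (fst z)) (snoc_entry n v (snd z)) (snoc_entry n w (snd (fst z))))" for z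
    have [measurable]: "g \<in> borel_measurable ((gauss_vec K \<Otimes>\<^sub>M gauss_vec J) \<Otimes>\<^sub>M gauss_vec J)"
      unfolding g_def by (intro measurable_compose[OF _ measurable_ennreal] measurable_compose[OF _ borel_measurable_exp] borel_measurable_times
        borel_measurable_power borel_measurable_const measurable_compose[OF WM borel_measurable_norm])
    have "D v w = (\<lambda>R. \<integral>\<^sup>+c. \<integral>\<^sup>+b. g ((R, c), b) \<partial>gauss_vec J \<partial>gauss_vec J)"
      by (simp add: D_def g_def fun_eq_iff)
    then show ?thesis by simp
  qed
  have split: "D (u p) (u q) R \<le> ennreal l * D (u p /\<^sub>R sqrt l) 0 R + ennreal (1 - l) * D 0 (u q /\<^sub>R sqrt (1 - l)) R" for R
  proof -
    define S where "S b c = W R (snoc_entry n 0 b) (snoc_entry n 0 c)" for b c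
    define T where "T v c = W R (single n v) (snoc_entry n 0 c)" for v c
    have comm: "W R x y = W R y x" for x y unfolding W_def by (rule two_columns_commute[OF p q pq])
    have W: "W R (snoc_entry n v b) (snoc_entry n w c) = T v c + T w b + S b c" for v w b c
      unfolding W_def T_def S_def by (rule two_columns_snoc[OF p q pq])
    have lin: "lin_on {1..n} (\<lambda>x. W R x y)" for y unfolding W_def by (rule lin_on_two_columns_left[OF p])
    have T_scale: "T (v /\<^sub>R r) c = T v c /\<^sub>R r" for v r c
    proof -
      have "T (v /\<^sub>R r) c = W R (\<lambda>i. (single n v i) /\<^sub>R r) (snoc_entry n 0 c)"
        unfolding T_def by (rule arg_cong2[where f = "W R"]) (auto simp: single_def)
      then show ?thesis by (simp add: lin_on_scaleR[OF lin] T_def)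
    qed
    have T_0: "T 0 c = 0" for c using T_scale[of 0 0 c] by simp
    have snoc: "lin_on J (\<lambda>b. W R (snoc_entry n 0 b) y)" for y
    proof -
      have "snoc_entry n 0 (\<lambda>i. x i + y i) = (\<lambda>i. snoc_entry n 0 x i + snoc_entry n 0 y i)"
        "snoc_entry n 0 (\<lambda>i. r *\<^sub>R x i) = (\<lambda>i. r *\<^sub>R snoc_entry n 0 x i)" for x y :: "nat \<Rightarrow> 'k" and r
        by (auto simp: snoc_entry_def)
      moreover have "W R (snoc_entry n 0 a) y = W R (snoc_entry n 0 b) y" if "\<forall>i\<in>J. a i = b i" for a b
        by (rule lin_on_cong[OF lin]) (use that in \<open>auto simp: snoc_entry_def J_def\<close>)
      ultimately show ?thesis
        unfolding lin_on_def using lin_on_add[OF lin] lin_on_scaleR[OF lin] by simp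
    qed
    have S_lin: "lin_on J (\<lambda>b. S b c)" for c unfolding S_def by (rule snoc)
    have S_sym: "S b c = S c b" for b c unfolding S_def by (rule comm)
    have T_lin: "lin_on J (T v)" for v
      unfolding T_def[abs_def] comm[of "single n v"] by (rule snoc)
    have J: "finite J" by (simp add: J_def)
    show ?thesis
      unfolding D_def W T_0 T_scale add_0_left add_0_right
      by (rule gauss_bilinear_split_le[OF J S_lin S_sym s T_lin T_lin l])
  qed
  have "laplace_last_row n s u = laplace_last_row n s (u(p := u p, q := u q))" by simp
  also have "\<dots> \<le> (\<integral>\<^sup>+R. ennreal l * D (u p /\<^sub>R sqrt l) 0 R + ennreal (1 - l) * D 0 (u q /\<^sub>R sqrt (1 - l)) R \<partial>gauss_vec K)"
    unfolding D by (intro nn_integral_mono split)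
  also have "\<dots> = ennreal l * (\<integral>\<^sup>+R. D (u p /\<^sub>R sqrt l) 0 R \<partial>gauss_vec K) +
      ennreal (1 - l) * (\<integral>\<^sup>+R. D 0 (u q /\<^sub>R sqrt (1 - l)) R \<partial>gauss_vec K)"
    by (simp add: nn_integral_add nn_integral_cmult)
  finally show ?thesis unfolding D .
qed

text \<open>Expansion along a last row that is concentrated in the corner. The corner entry is the last
  factor of each product, so it can be split off on the right.\<close>

lemma row_per_Suc:
  fixes A :: "'k::{euclidean_space,real_normed_div_algebra} mat"
  assumes "\<And>k. k \<in> {1..m} \<Longrightarrow> A (Suc m, k) = 0"
  shows "row_per (Suc m) A = row_per m A * A (Suc m, Suc m)"
proof -
  have split: "prod_list (map (\<lambda>i. A (i, \<sigma> i)) [1..<Suc (Suc m)]) =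
      prod_list (map (\<lambda>i. A (i, \<sigma> i)) [1..<Suc m]) * A (Suc m, \<sigma> (Suc m))" for \<sigma> :: "nat \<Rightarrow> nat"
    by (subst prod_list_split_at[of "Suc m"]) (simp_all del: upt_Suc)
  have "row_per (Suc m) A = (\<Sum>\<sigma> | \<sigma> permutes {1..m}. prod_list (map (\<lambda>i. A (i, \<sigma> i)) [1..<Suc m]) * A (Suc m, \<sigma> (Suc m)))"
    unfolding row_per_def split
  proof (rule sum.mono_neutral_right)
    show "{\<sigma>. \<sigma> permutes {1..m}} \<subseteq> {\<sigma>. \<sigma> permutes {1..Suc m}}"
      by (auto intro: permutes_subset)
    show "\<forall>\<sigma>\<in>{\<sigma>. \<sigma> permutes {1..Suc m}} - {\<sigma>. \<sigma> permutes {1..m}}.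
        prod_list (map (\<lambda>i. A (i, \<sigma> i)) [1..<Suc m]) * A (Suc m, \<sigma> (Suc m)) = 0"
    proof
      fix \<sigma> assume \<sigma>: "\<sigma> \<in> {\<sigma>. \<sigma> permutes {1..Suc m}} - {\<sigma>. \<sigma> permutes {1..m}}"
      then have "\<sigma> (Suc m) \<noteq> Suc m"
        using permutes_superset[of \<sigma> "{1..Suc m}" "{1..m}"] by (auto simp: le_Suc_eq)
      moreover have "\<sigma> (Suc m) \<in> {1..Suc m}" using \<sigma> permutes_in_image[of \<sigma> "{1..Suc m}" "Suc m"] by auto
      ultimately have "\<sigma> (Suc m) \<in> {1..m}" by auto
      then show "prod_list (map (\<lambda>i. A (i, \<sigma> i)) [1..<Suc m]) * A (Suc m, \<sigma> (Suc m)) = 0"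
        using assms by simp
    qed
  qed (simp add: finite_permutations)
  also have "\<dots> = (\<Sum>\<sigma> | \<sigma> permutes {1..m}. prod_list (map (\<lambda>i. A (i, \<sigma> i)) [1..<Suc m]) * A (Suc m, Suc m))"
    by (intro sum.cong refl) (auto simp: permutes_not_in)
  finally show ?thesis by (simp add: row_per_def sum_distrib_right)
qed

text \<open>Exchanging column \<open>j\<close> with the last column moves the only entry of the last row
  into the corner. The remaining minor consists of independent Gaussian entries again.\<close>

lemma laplace_last_row_single:
  fixes v :: "'k::{euclidean_space,real_normed_div_algebra}"
  assumes j: "j \<in> {1..Suc m}"
  shows "laplace_last_row (Suc m) s (single j v) = laplace_per TYPE('k) m (s * (norm v)\<^sup>2)"
proof -
  let ?n = "Suc m"
  define \<tau> where "\<tau> = Transposition.transpose j ?n"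
  have \<tau>: "\<tau> permutes {1..?n}" unfolding \<tau>_def using j by (intro permutes_swap_id) auto
  define h where "h B = (\<lambda>ij\<in>mat_idx m. B (fst ij, \<tau> (snd ij)))" for B :: "'k mat"
  have per: "row_per ?n (last_row ?n (single j v) B) = row_per m (h B) * v" for B
  proof -
    let ?A = "\<lambda>(i, k). last_row ?n (single j v) B (i, \<tau> k)"
    have "row_per ?n (last_row ?n (single j v) B) = row_per ?n ?A"
      by (rule row_per_permute_columns[OF \<tau>, symmetric])
    also have "\<dots> = row_per m ?A * ?A (?n, ?n)"
      by (rule row_per_Suc) (auto simp: last_row_def single_def \<tau>_def Transposition.transpose_def)
    also have "?A (?n, ?n) = v" by (simp add: last_row_def single_def \<tau>_def)
    also have "row_per m ?A = row_per m (h B)"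
      by (rule row_per_cong) (auto simp: last_row_def h_def)
    finally show ?thesis .
  qed
  have distr: "distr (gauss_vec ({1..<?n} \<times> {1..?n})) (gauss_vec (mat_idx m)) h = PiM (mat_idx m) (\<lambda>_. gauss :: 'k measure)"
    unfolding h_def
  proof (rule distr_PiM_reindex[where K = "{1..<?n} \<times> {1..?n}" and M = "\<lambda>_. gauss :: 'k measure" and f = "\<lambda>ij. (fst ij, \<tau> (snd ij))"])
    show "inj_on (\<lambda>ij. (fst ij, \<tau> (snd ij))) (mat_idx m)"
      using permutes_inj[OF \<tau>] by (auto simp: inj_on_def inj_def)
    show "(\<lambda>ij. (fst ij, \<tau> (snd ij))) \<in> mat_idx m \<rightarrow> {1..<?n} \<times> {1..?n}"
      using permutes_in_image[OF \<tau>] by fastforce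
  qed (rule gauss.prob_space_axioms)
  have [measurable]: "h \<in> measurable (gauss_vec ({1..<?n} \<times> {1..?n})) (gauss_vec (mat_idx m))"
    unfolding h_def
  proof (rule measurable_restrict)
    fix ij assume "ij \<in> mat_idx m"
    then have "(fst ij, \<tau> (snd ij)) \<in> {1..<?n} \<times> {1..?n}" using permutes_in_image[OF \<tau>] by fastforce
    then show "(\<lambda>B. B (fst ij, \<tau> (snd ij))) \<in> measurable (gauss_vec ({1..<?n} \<times> {1..?n})) gauss"
      by (rule measurable_component_singleton)
  qed
  have [measurable]: "row_per m \<in> borel_measurable (PiM (mat_idx m) (\<lambda>_. gauss :: 'k measure))"
    by (rule measurable_row_per) (rule component_gauss)
  have "laplace_last_row ?n s (single j v) = (\<integral>\<^sup>+B. gexp (s * (norm v)\<^sup>2) (row_per m (h B))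
      \<partial>gauss_vec ({1..<?n} \<times> {1..?n}))"
    unfolding laplace_last_row_def per by (simp add: norm_mult power_mult_distrib mult_ac)
  also have "\<dots> = laplace_per TYPE('k) m (s * (norm v)\<^sup>2)"
    unfolding laplace_per_def by (subst distr[symmetric], subst nn_integral_distr) measurable
  finally show ?thesis .
qed

lemma laplace_last_row_cong:
  assumes "\<And>j. j \<in> {1..n} \<Longrightarrow> u j = v j"
  shows "laplace_last_row n s u = laplace_last_row n s v"
proof -
  have "row_per n (last_row n u B) = row_per n (last_row n v B)" for B
    using assms by (intro row_per_cong) (auto simp: last_row_def)
  then show ?thesis by (simp add: laplace_last_row_def)
qed

text \<open>By induction on the number of nonzero entries of \<open>u\<close>. As long as there are two of
  them, the splitting inequality bounds the left-hand side by an average of two values with one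
  nonzero entry fewer and the same norm of \<open>u\<close>.\<close>

lemma laplace_last_row_le:
  fixes u :: "nat \<Rightarrow> 'k::{euclidean_space,real_normed_div_algebra}"
  assumes s: "0 \<le> s"
  shows "laplace_last_row (Suc m) s u \<le> laplace_per TYPE('k) m (s * (\<Sum>j\<in>{1..Suc m}. (norm (u j))\<^sup>2))"
proof (induction "card {j \<in> {1..Suc m}. u j \<noteq> 0}" arbitrary: u rule: less_induct)
  case less
  let ?n = "Suc m" and ?T = "\<lambda>u. {j \<in> {1..Suc m}. u j \<noteq> 0}" and ?N = "\<lambda>u. \<Sum>j\<in>{1..Suc m}. (norm (u j))\<^sup>2"
  show ?case
  proof (cases "\<exists>p\<in>?T u. \<exists>q\<in>?T u. p \<noteq> q")
    case False
    \<comment> \<open>If \<open>u\<close> vanishes, any column will do.\<close>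
    obtain j where j: "j \<in> {1..?n}" and u: "\<And>k. k \<in> {1..?n} \<Longrightarrow> k \<noteq> j \<Longrightarrow> u k = 0"
    proof (cases "?T u = {}")
      case True
      then show ?thesis by (intro that[of 1]) auto
    next
      case nonempty: False
      then obtain j where "j \<in> ?T u" by auto
      with False show ?thesis by (intro that[of j]) auto
    qed
    have "laplace_last_row ?n s u = laplace_last_row ?n s (single j (u j))"
      using u by (intro laplace_last_row_cong) (auto simp: single_def)
    also have "\<dots> = laplace_per TYPE('k) m (s * (norm (u j))\<^sup>2)"
      by (rule laplace_last_row_single[OF j])
    also have "(norm (u j))\<^sup>2 = ?N u"
      using j u by (subst sum.remove[of _ j]) (auto intro!: sum.neutral)
    finally show ?thesis by simp
  next
    case True
    then obtain p q where p: "p \<in> {1..?n}" "u p \<noteq> 0" and q: "q \<in> {1..?n}" "u q \<noteq> 0" and pq: "p \<noteq> q" by auto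
    define r where "r = (norm (u p))\<^sup>2 + (norm (u q))\<^sup>2"
    \<comment> \<open>With this weight both new rows have the same norm as \<open>u\<close>.\<close>
    define l where "l = (norm (u p))\<^sup>2 / r"
    have r: "0 < r" using p q by (simp add: r_def add_pos_pos)
    have l: "0 < l" "l < 1" using p q r by (auto simp: l_def) (simp add: r_def)
    have "l + (norm (u q))\<^sup>2 / r = 1"
      using r by (simp add: l_def add_divide_distrib[symmetric] r_def[symmetric])
    then have l': "1 - l = (norm (u q))\<^sup>2 / r" by simp
    define v where "v = u(p := u p /\<^sub>R sqrt l, q := 0)"
    define w where "w = u(p := 0, q := u q /\<^sub>R sqrt (1 - l))"
    have N: "?N x = (norm (x p))\<^sup>2 + (norm (x q))\<^sup>2 + (\<Sum>j\<in>{1..?n} - {p, q}. (norm (u j))\<^sup>2)"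
      if "\<And>j. j \<noteq> p \<Longrightarrow> j \<noteq> q \<Longrightarrow> x j = u j" for x
    proof -
      have "?N x = (norm (x p))\<^sup>2 + ((norm (x q))\<^sup>2 + (\<Sum>j\<in>{1..?n} - {p} - {q}. (norm (x j))\<^sup>2))"
        using p q pq by (subst sum.remove[of _ p], simp, simp, subst sum.remove[of _ q]) auto
      moreover have "(\<Sum>j\<in>{1..?n} - {p} - {q}. (norm (x j))\<^sup>2) = (\<Sum>j\<in>{1..?n} - {p, q}. (norm (u j))\<^sup>2)"
        using that by (intro sum.cong) auto
      ultimately show ?thesis by simp
    qed
    have "(norm (u p /\<^sub>R sqrt l))\<^sup>2 = r"
      using l r p by (simp add: power_mult_distrib power_divide divide_simps) (simp add: l_def)
    then have Nv: "?N v = ?N u" using pq by (subst (1 2) N) (auto simp: v_def r_def)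
    have "(norm (u q /\<^sub>R sqrt (1 - l)))\<^sup>2 = r"
      using l r q by (simp add: power_mult_distrib power_divide divide_simps) (simp add: l')
    then have Nw: "?N w = ?N u" using pq by (subst (1 2) N) (auto simp: w_def r_def)
    have v: "laplace_last_row ?n s v \<le> laplace_per TYPE('k) m (s * ?N u)"
      unfolding Nv[symmetric]
    proof (rule less.hyps, rule psubset_card_mono)
      show "?T v \<subset> ?T u" using p q pq by (auto simp: v_def)
    qed simp
    have w: "laplace_last_row ?n s w \<le> laplace_per TYPE('k) m (s * ?N u)"
      unfolding Nw[symmetric]
    proof (rule less.hyps, rule psubset_card_mono)
      show "?T w \<subset> ?T u" using p q pq by (auto simp: w_def)
    qed simp
    have "laplace_last_row ?n s u \<le> ennreal l * laplace_last_row ?n s v + ennreal (1 - l) * laplace_last_row ?n s w"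
      unfolding v_def w_def by (rule laplace_last_row_split_le[OF p(1) q(1) pq s l])
    also have "\<dots> \<le> ennreal l * laplace_per TYPE('k) m (s * ?N u) + ennreal (1 - l) * laplace_per TYPE('k) m (s * ?N u)"
      by (intro add_mono mult_left_mono v w) auto
    also have "\<dots> = laplace_per TYPE('k) m (s * ?N u)"
      using l by (simp add: distrib_right[symmetric] ennreal_plus[symmetric] del: ennreal_plus)
    finally show ?thesis .
  qed
qed

lemma laplace_per_Suc_le:
  assumes s: "0 \<le> s"
  shows "laplace_per TYPE('k::{euclidean_space,real_normed_div_algebra}) (Suc m) s \<le>
    (\<integral>\<^sup>+x. laplace_per TYPE('k) m (s * (\<Sum>ij\<in>{Suc m} \<times> {1..Suc m}. (norm (x ij))\<^sup>2)) \<partial>PiM ({Suc m} \<times> {1..Suc m}) (\<lambda>_. gauss :: 'k measure))"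
proof -
  let ?n = "Suc m"
  let ?I = "{?n} \<times> {1..?n}" and ?K = "{1..<?n} \<times> {1..?n}"
  have [measurable]: "row_per ?n \<in> borel_measurable (PiM (mat_idx ?n) (\<lambda>_. gauss :: 'k measure))"
    by (rule measurable_row_per) (rule component_gauss)
  have "laplace_per TYPE('k) ?n s = (\<integral>\<^sup>+x. \<integral>\<^sup>+B. gexp s (row_per ?n (merge ?I ?K (x, B)))
      \<partial>PiM ?K (\<lambda>_. gauss :: 'k measure) \<partial>gauss_vec ?I)"
    unfolding laplace_per_def
  proof (rule nn_integral_PiM_gauss_split)
    show "(\<lambda>A. gexp s (row_per ?n A :: 'k)) \<in> borel_measurable (gauss_vec (mat_idx ?n))"
      by measurable
  qed auto
  also have "\<dots> = (\<integral>\<^sup>+x. laplace_last_row ?n s (\<lambda>j. x (?n, j)) \<partial>PiM ?I (\<lambda>_. gauss :: 'k measure))"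
    unfolding laplace_last_row_def
    by (intro nn_integral_cong arg_cong[where f = "\<lambda>x. gexp s x"] row_per_cong)
       (auto simp: last_row_def merge_def)
  also have "\<dots> \<le> (\<integral>\<^sup>+x. laplace_per TYPE('k) m (s * (\<Sum>ij\<in>?I. (norm (x ij))\<^sup>2)) \<partial>PiM ?I (\<lambda>_. gauss :: 'k measure))"
  proof (rule nn_integral_mono)
    fix x :: "'k mat"
    have "(\<Sum>ij\<in>?I. (norm (x ij))\<^sup>2) = (\<Sum>j\<in>{1..?n}. (norm (x (?n, j)))\<^sup>2)"
      by (rule sum.reindex_bij_witness[where i = "\<lambda>j. (?n, j)" and j = snd]) auto
    then show "laplace_last_row ?n s (\<lambda>j. x (?n, j)) \<le> laplace_per TYPE('k) m (s * (\<Sum>ij\<in>?I. (norm (x ij))\<^sup>2))"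
      using laplace_last_row_le[OF s, of m "\<lambda>j. x (?n, j)"] by simp
  qed
  finally show ?thesis .
qed

section \<open>Negative moments of Gaussian vectors\<close>

lemma nn_integral_powr_exp:
  assumes a: "0 < a" and c: "0 < c"
  shows "(\<integral>\<^sup>+t. ennreal (indicator {0..} t * t powr (a - 1) * exp (- c * t)) \<partial>lborel) = ennreal (Gamma a / c powr a)"
proof -
  have "(\<integral>\<^sup>+t. ennreal (indicator {0..} t * t powr (a - 1) * exp (- c * t)) \<partial>lborel) =
      (\<integral>\<^sup>+t. ennreal (1 / c) * ennreal (indicator {0..} (0 + (1 / c) * t) * (0 + (1 / c) * t) powr (a - 1) * exp (- c * (0 + (1 / c) * t))) \<partial>lborel)"
    using c by (subst nn_integral_real_affine[where c = "1 / c" and t = 0]) (auto simp: nn_integral_cmult)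
  also have "\<dots> = (\<integral>\<^sup>+t. ennreal (1 / c powr a) * ennreal (indicator {0..} t * t powr (a - 1) / exp t) \<partial>lborel)"
  proof (intro nn_integral_cong)
    fix t :: real
    have "(1 / c) * (t / c) powr (a - 1) = (1 / c powr a) * t powr (a - 1)" if "0 \<le> t"
      using that c by (simp add: powr_divide powr_diff field_simps)
    then show "ennreal (1 / c) * ennreal (indicator {0..} (0 + (1 / c) * t) * (0 + (1 / c) * t) powr (a - 1) * exp (- c * (0 + (1 / c) * t))) =
        ennreal (1 / c powr a) * ennreal (indicator {0..} t * t powr (a - 1) / exp t)"
      using c by (cases "0 \<le> t") (auto simp: ennreal_mult[symmetric] indicator_def zero_le_divide_iff exp_minus field_simps)
  qed
  also have "\<dots> = ennreal (1 / c powr a) * ennreal (Gamma a)"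
    using a by (subst nn_integral_cmult) (simp_all add: Gamma_conv_nn_integral_real)
  finally show ?thesis using a by (simp add: ennreal_mult[symmetric] Gamma_real_pos less_imp_le)
qed

text \<open>Equality holds by the Gamma integral. For \<open>r = 0\<close> both sides are infinite: the
  integral dominates those for positive values of \<open>r\<close>, whose values are unbounded.\<close>

lemma inverse_powr_le_nn_integral:
  assumes b: "0 < b" and r: "0 \<le> r"
  shows "inverse (ennreal (r powr b)) \<le> ennreal (1 / Gamma b) * (\<integral>\<^sup>+t. ennreal (indicator {0..} t * t powr (b - 1) * exp (- r * t)) \<partial>lborel)"
proof -
  have pos: "inverse (ennreal (x powr b)) = ennreal (1 / Gamma b) * (\<integral>\<^sup>+t. ennreal (indicator {0..} t * t powr (b - 1) * exp (- x * t)) \<partial>lborel)"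
    if "0 < x" for x
    using that b Gamma_real_pos[OF b, THEN less_imp_neq]
    by (subst nn_integral_powr_exp) (simp_all add: inverse_ennreal ennreal_mult[symmetric] divide_inverse)
  show ?thesis
  proof (cases "r = 0")
    case True
    let ?X = "ennreal (1 / Gamma b) * (\<integral>\<^sup>+t. ennreal (indicator {0..} t * t powr (b - 1) * exp (- r * t)) \<partial>lborel)"
    have ge: "ennreal K \<le> ?X" if "0 < K" for K
    proof -
      define x where "x = (1 / K) powr (1 / b)"
      have x: "0 < x" "x powr b = 1 / K" using that b by (auto simp: x_def powr_powr)
      have "ennreal K = inverse (ennreal (x powr b))" using that by (simp add: x inverse_ennreal)
      also have "\<dots> \<le> ?X"
        unfolding pos[OF x(1)]
      proof (rule mult_left_mono, rule nn_integral_mono, rule ennreal_leI)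
        fix t :: real
        have "exp (- x * t) \<le> exp (- r * t)" if "0 \<le> t" using that x True by simp
        then show "indicator {0..} t * t powr (b - 1) * exp (- x * t) \<le> indicator {0..} t * t powr (b - 1) * exp (- r * t)"
          by (cases "0 \<le> t") (auto intro!: mult_left_mono)
      qed simp
      finally show ?thesis .
    qed
    have "?X = top"
    proof (rule ccontr)
      assume "?X \<noteq> top"
      then obtain c where c: "0 \<le> c" "?X = ennreal c" by (cases ?X) auto
      have "ennreal (c + 1) \<le> ennreal c"
        using ge[of "c + 1"] c(1) unfolding c(2) by simp
      then show False using c(1) by (simp add: ennreal_le_iff)
    qed
    then show ?thesis by simp
  qed (use pos r in auto)
qed

lemma nn_integral_PiM_gauss_laplace:
  assumes I: "finite I" and t: "0 \<le> t"
  shows "(\<integral>\<^sup>+x. ennreal (exp (- t * (\<Sum>i\<in>I. (norm (x i))\<^sup>2))) \<partial>PiM I (\<lambda>_. gauss :: 'a::euclidean_space measure)) =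
    ennreal ((1 + 2 * t / real DIM('a)) powr (- (real DIM('a) / 2 * real (card I))))"
proof -
  have "(\<integral>\<^sup>+x. ennreal (exp (- t * (\<Sum>i\<in>I. (norm (x i))\<^sup>2))) \<partial>PiM I (\<lambda>_. gauss :: 'a measure)) =
      (\<integral>\<^sup>+x. (\<Prod>i\<in>I. gexp t (x i)) \<partial>PiM I (\<lambda>_. gauss :: 'a measure))"
    using I by (simp add: prod_ennreal exp_sum[symmetric] sum_distrib_left sum_negf)
  also have "\<dots> = (\<Prod>i\<in>I. (\<integral>\<^sup>+x. gexp t x \<partial>(gauss :: 'a measure)))"
    using I by (intro gauss_PiM.product_nn_integral_prod) auto
  also have "\<dots> = ennreal (((1 + 2 * t / real DIM('a)) powr (- (real DIM('a) / 2))) ^ card I)"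
    using t by (simp only: nn_integral_gauss_exp_neg_norm_square prod_constant ennreal_power powr_ge_zero)
  also have "((1 + 2 * t / real DIM('a)) powr (- (real DIM('a) / 2))) ^ card I = (1 + 2 * t / real DIM('a)) powr (- (real DIM('a) / 2 * real (card I)))"
  proof -
    have "0 < 1 + 2 * t / real DIM('a)" using t by (intro add_pos_nonneg) auto
    then show ?thesis by (simp add: powr_realpow[symmetric] powr_powr)
  qed
  finally show ?thesis .
qed

text \<open>A Gaussian vector of N blocks has (N d)/2 as exponent of its Laplace transform. Integrating this
  transform against \<open>t powr (b - 1)\<close>, with \<open>b = d/2\<close>, gives the
  negative moment. The resulting Beta integral is evaluated by writing the power of \<open>1 + t
  / b\<close> as a Gamma integral too and exchanging the order of integration. Convergence at
  infinity needs at least two blocks.\<close>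

lemma nn_integral_PiM_gauss_inverse_norm_le:
  fixes I :: "'i set"
  assumes I: "finite I" "2 \<le> card I"
  defines "b \<equiv> real DIM('a) / 2"
  shows "(\<integral>\<^sup>+x. inverse (ennreal ((\<Sum>i\<in>I. (norm (x i))\<^sup>2) powr b)) \<partial>PiM I (\<lambda>_. gauss :: 'a::euclidean_space measure)) \<le>
    ennreal (b powr b * Gamma (b * (real (card I) - 1)) / Gamma (b * real (card I)))"
proof -
  let ?N = "PiM I (\<lambda>_. gauss :: 'a measure)"
  define a where "a = b * real (card I)"
  have b: "0 < b" by (simp add: b_def)
  have ab: "b < a" "0 < a" "a - b = b * (real (card I) - 1)"
    using I b by (auto simp: a_def algebra_simps)
  interpret P: pair_sigma_finite ?N "lborel :: real measure" ..
  have [measurable]: "i \<in> I \<Longrightarrow> (\<lambda>x. x i) \<in> borel_measurable ?N" for i by (rule component_gauss)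
  define w where "w t = indicator {0..} t * t powr (b - 1)" for t :: real
  have [measurable]: "w \<in> borel_measurable borel" unfolding w_def by measurable
  have w0: "0 \<le> w t" for t by (simp add: w_def)
  define v where "v x = indicator {0..} x * x powr (a - 1)" for x :: real
  have [measurable]: "v \<in> borel_measurable borel" unfolding v_def by measurable
  have v0: "0 \<le> v t" for t by (simp add: v_def)
  have gam: "(1 + t / b) powr (- a) = 1 / Gamma a * (Gamma a / (1 + t / b) powr a)" for t
    using Gamma_real_pos[OF ab(2)] by (simp add: powr_minus field_simps)
  have "(\<integral>\<^sup>+x. inverse (ennreal ((\<Sum>i\<in>I. (norm (x i))\<^sup>2) powr b)) \<partial>?N) \<le>
      (\<integral>\<^sup>+x. ennreal (1 / Gamma b) * (\<integral>\<^sup>+t. ennreal (w t * exp (- (\<Sum>i\<in>I. (norm (x i))\<^sup>2) * t)) \<partial>lborel) \<partial>?N)"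
    unfolding w_def by (intro nn_integral_mono inverse_powr_le_nn_integral b sum_nonneg) simp
  also have "\<dots> = ennreal (1 / Gamma b) * (\<integral>\<^sup>+x. (\<integral>\<^sup>+t. ennreal (w t * exp (- (\<Sum>i\<in>I. (norm (x i))\<^sup>2) * t)) \<partial>lborel) \<partial>?N)"
    by (rule nn_integral_cmult) measurable
  also have "(\<integral>\<^sup>+x. (\<integral>\<^sup>+t. ennreal (w t * exp (- (\<Sum>i\<in>I. (norm (x i))\<^sup>2) * t)) \<partial>lborel) \<partial>?N) =
      (\<integral>\<^sup>+t. (\<integral>\<^sup>+x. ennreal (w t * exp (- (\<Sum>i\<in>I. (norm (x i))\<^sup>2) * t)) \<partial>?N) \<partial>lborel)"
    by (rule P.Fubini'[symmetric]) measurable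
  also have "\<dots> = (\<integral>\<^sup>+t. ennreal (w t) * ennreal ((1 + t / b) powr (- a)) \<partial>lborel)"
  proof (rule nn_integral_cong)
    fix t :: real
    have "(\<integral>\<^sup>+x. ennreal (w t * exp (- (\<Sum>i\<in>I. (norm (x i))\<^sup>2) * t)) \<partial>?N) =
        ennreal (w t) * (\<integral>\<^sup>+x. ennreal (exp (- t * (\<Sum>i\<in>I. (norm (x i))\<^sup>2))) \<partial>?N)"
      by (subst nn_integral_cmult[symmetric]) (auto simp: ennreal_mult[symmetric] w0 mult.commute)
    also have "\<dots> = ennreal (w t) * ennreal ((1 + t / b) powr (- a))"
    proof (cases "0 \<le> t")
      case True
      then show ?thesis by (subst nn_integral_PiM_gauss_laplace[OF I(1)]) (simp_all add: a_def b_def mult.commute)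
    qed (simp add: w_def)
    finally show "(\<integral>\<^sup>+x. ennreal (w t * exp (- (\<Sum>i\<in>I. (norm (x i))\<^sup>2) * t)) \<partial>?N) = ennreal (w t) * ennreal ((1 + t / b) powr (- a))" .
  qed
  also have "\<dots> = (\<integral>\<^sup>+t. \<integral>\<^sup>+x. ennreal (1 / Gamma a) * ennreal (w t * (v x * exp (- (1 + t / b) * x))) \<partial>lborel \<partial>lborel)"
  proof (rule nn_integral_cong)
    fix t :: real
    show "ennreal (w t) * ennreal ((1 + t / b) powr (- a)) = (\<integral>\<^sup>+x. ennreal (1 / Gamma a) * ennreal (w t * (v x * exp (- (1 + t / b) * x))) \<partial>lborel)"
    proof (cases "0 \<le> t")
      case True
      have "(\<integral>\<^sup>+x. ennreal (1 / Gamma a) * ennreal (w t * (v x * exp (- (1 + t / b) * x))) \<partial>lborel) =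
          ennreal (1 / Gamma a) * (ennreal (w t) * (\<integral>\<^sup>+x. ennreal (v x * exp (- (1 + t / b) * x)) \<partial>lborel))"
        by (simp add: nn_integral_cmult ennreal_mult w0 v0)
      also have "\<dots> = ennreal (w t) * ennreal ((1 + t / b) powr (- a))"
        unfolding v_def using True b ab Gamma_real_pos[OF ab(2)]
        by (subst nn_integral_powr_exp) (simp_all add: gam ennreal_mult[symmetric] w0 add_pos_nonneg mult_ac)
      finally show ?thesis by simp
    qed (simp add: w_def)
  qed
  also have "\<dots> = ennreal (1 / Gamma a) * (\<integral>\<^sup>+t. \<integral>\<^sup>+x. ennreal (w t * (v x * exp (- (1 + t / b) * x))) \<partial>lborel \<partial>lborel)"
    by (simp add: nn_integral_cmult)
  also have "(\<integral>\<^sup>+t. \<integral>\<^sup>+x. ennreal (w t * (v x * exp (- (1 + t / b) * x))) \<partial>lborel \<partial>lborel) =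
      (\<integral>\<^sup>+x. \<integral>\<^sup>+t. ennreal (w t * (v x * exp (- (1 + t / b) * x))) \<partial>lborel \<partial>lborel)"
    by (rule lborel_pair.Fubini') measurable
  also have "\<dots> = (\<integral>\<^sup>+x. ennreal (Gamma b * b powr b) * ennreal (indicator {0..} x * x powr (a - b - 1) * exp (- 1 * x)) \<partial>lborel)"
  proof (rule nn_integral_cong_AE)
    have "AE x in lborel. x \<noteq> (0 :: real)" by (rule AE_lborel_singleton)
    then show "AE x in lborel. (\<integral>\<^sup>+t. ennreal (w t * (v x * exp (- (1 + t / b) * x))) \<partial>lborel) =
        ennreal (Gamma b * b powr b) * ennreal (indicator {0..} x * x powr (a - b - 1) * exp (- 1 * x))"
    proof eventually_elim
      fix x :: real assume x0: "x \<noteq> 0"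
      show "(\<integral>\<^sup>+t. ennreal (w t * (v x * exp (- (1 + t / b) * x))) \<partial>lborel) =
        ennreal (Gamma b * b powr b) * ennreal (indicator {0..} x * x powr (a - b - 1) * exp (- 1 * x))"
      proof (cases "0 < x")
        case True
        have "w t * (v x * exp (- (1 + t / b) * x)) = (v x * exp (- x)) * (w t * exp (- (x / b) * t))" for t
        proof -
          have "- (1 + t / b) * x = - x + - (x / b) * t" by (simp add: algebra_simps)
          then show ?thesis by (simp only: exp_add mult_ac)
        qed
        then have "(\<integral>\<^sup>+t. ennreal (w t * (v x * exp (- (1 + t / b) * x))) \<partial>lborel) =
            ennreal (v x * exp (- x)) * (\<integral>\<^sup>+t. ennreal (w t * exp (- (x / b) * t)) \<partial>lborel)"
          by (simp only: ennreal_mult[OF mult_nonneg_nonneg[OF v0 exp_ge_zero] mult_nonneg_nonneg[OF w0 exp_ge_zero]])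
             (rule nn_integral_cmult, measurable)
        also have "\<dots> = ennreal (v x * exp (- x)) * ennreal (Gamma b / (x / b) powr b)"
          unfolding w_def using True b by (subst nn_integral_powr_exp) auto
        also have "\<dots> = ennreal (v x * exp (- x) * (Gamma b / (x / b) powr b))"
          using Gamma_real_pos[OF b] by (intro ennreal_mult[symmetric]) (simp_all add: v0)
        also have "v x * exp (- x) * (Gamma b / (x / b) powr b) = (Gamma b * b powr b) * (indicator {0..} x * x powr (a - b - 1) * exp (- 1 * x))"
          using True b by (simp add: v_def powr_divide powr_diff powr_add field_simps)
        finally show ?thesis
          using Gamma_real_pos[OF b] by (simp add: ennreal_mult[symmetric])
      qed (use x0 in \<open>simp add: v_def\<close>)
    qed
  qed
  also have "\<dots> = ennreal (Gamma b * b powr b) * ennreal (Gamma (a - b))"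
    using ab by (subst nn_integral_cmult, measurable, subst nn_integral_powr_exp) auto
  also have "ennreal (1 / Gamma b) * (ennreal (1 / Gamma a) * (ennreal (Gamma b * b powr b) * ennreal (Gamma (a - b)))) =
      ennreal (1 / Gamma b * (1 / Gamma a * (Gamma b * b powr b * Gamma (a - b))))"
  proof -
    have nonneg: "0 \<le> 1 / Gamma b" "0 \<le> 1 / Gamma a" "0 \<le> Gamma b * b powr b"
      using Gamma_real_pos[OF b] Gamma_real_pos[OF ab(2)] by simp_all
    show ?thesis
      by (simp only: ennreal_mult'[OF nonneg(1)] ennreal_mult'[OF nonneg(2)] ennreal_mult'[OF nonneg(3)])
  qed
  also have "1 / Gamma b * (1 / Gamma a * (Gamma b * b powr b * Gamma (a - b))) = b powr b * Gamma (b * (real (card I) - 1)) / Gamma (b * real (card I))"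
    unfolding ab(3) using Gamma_real_pos[OF b, THEN less_imp_neq] by (simp add: a_def)
  finally show ?thesis .
qed

section \<open>Decay of the Laplace transform of the permanent\<close>

text \<open>For the squared product of independent Gaussian norms with \<open>1, ..., n\<close> blocks of
  dimension \<open>d\<close>, the Laplace transform at \<open>s\<close> behaves like
  \<open>decay d n * s powr (- d/2)\<close> for large \<open>s\<close>; the Gamma factors of the
  negative moments telescope to the quotient seen here.\<close>

definition decay :: "nat \<Rightarrow> nat \<Rightarrow> real" where
  "decay d n = (real d / 2) powr (real d / 2 * real n) * Gamma (real d / 2) / Gamma (real d / 2 * real n)"

text \<open>In the induction step the last row contributes its norm as an independent factor, and the bound
  for size \<open>m\<close> is averaged over it. For \<open>s = 0\<close> the right-hand side is
  infinite.\<close>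

lemma laplace_per_decay:
  assumes n: "1 \<le> n" and s: "0 \<le> s"
  shows "laplace_per TYPE('k::{euclidean_space,real_normed_div_algebra}) n s \<le>
    ennreal (decay DIM('k) n) * inverse (ennreal (s powr (real DIM('k) / 2)))"
  using n s
proof (induction n arbitrary: s rule: nat_induct_at_least)
  case base
  define b where "b = real DIM('k) / 2"
  have b: "0 < b" by (simp add: b_def)
  have per1: "row_per 1 A = A (1, 1)" for A :: "'k mat" by (simp add: row_per_def)
  have "laplace_per TYPE('k) 1 s = (\<integral>\<^sup>+x. ennreal (exp (- s * (\<Sum>i\<in>{(1 :: nat, 1 :: nat)}. (norm (x i))\<^sup>2))) \<partial>PiM {(1, 1)} (\<lambda>_. gauss :: 'k measure))"
    unfolding laplace_per_def per1 by simp
  also have "\<dots> = ennreal ((1 + s / b) powr (- b))"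
    by (subst nn_integral_PiM_gauss_laplace) (simp_all add: b_def base mult.commute)
  also have "\<dots> \<le> ennreal (decay DIM('k) 1) * inverse (ennreal (s powr b))"
  proof (cases "s = 0")
    case True
    have "0 < decay DIM('k) 1" using b Gamma_real_pos[OF b, THEN less_imp_neq] by (simp add: decay_def b_def)
    then show ?thesis using True by (simp add: ennreal_mult_top)
  next
    case False
    then have s: "0 < s" using base by simp
    have "(1 + s / b) powr (- b) \<le> (s / b) powr (- b)"
      using s b by (intro powr_mono2') auto
    also have "\<dots> = b powr b / s powr b"
      using s b by (simp add: powr_minus powr_divide)
    also have "b powr b = decay DIM('k) 1"
      using b Gamma_real_pos[OF b, THEN less_imp_neq] by (simp add: decay_def b_def[symmetric])
    also have "decay DIM('k) 1 / s powr b = decay DIM('k) 1 * inverse (s powr b)"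
      by (rule divide_inverse)
    finally show ?thesis
      using s b Gamma_real_pos[OF b, THEN less_imp_neq] by (simp add: inverse_ennreal ennreal_mult[symmetric] decay_def b_def[symmetric])
  qed
  finally show ?case by (simp add: b_def)
next
  case (Suc m)
  define b where "b = real DIM('k) / 2"
  have b: "0 < b" by (simp add: b_def)
  let ?I = "{Suc m} \<times> {1..Suc m}"
  let ?N = "PiM ?I (\<lambda>_. gauss :: 'k measure)"
  define N where "N x = (\<Sum>ij\<in>?I. (norm (x ij :: 'k))\<^sup>2)" for x
  have [measurable]: "N \<in> borel_measurable ?N"
    unfolding N_def by (intro borel_measurable_sum borel_measurable_power measurable_compose[OF component_gauss borel_measurable_norm])
  have N: "0 \<le> N x" for x by (simp add: N_def sum_nonneg)
  have pos: "0 < decay DIM('k) k" if "1 \<le> k" for k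
    using that b Gamma_real_pos[OF b] Gamma_real_pos[of "b * real k"] by (simp add: decay_def b_def)
  show ?case
  proof (cases "s = 0")
    case True
    then show ?thesis using pos[of "Suc m"] by (simp add: ennreal_mult_top)
  next
    case False
    then have s: "0 < s" using Suc.prems by simp
    have "laplace_per TYPE('k) (Suc m) s \<le> (\<integral>\<^sup>+x. laplace_per TYPE('k) m (s * N x) \<partial>?N)"
      unfolding N_def by (rule laplace_per_Suc_le[OF Suc.prems])
    also have "\<dots> \<le> (\<integral>\<^sup>+x. ennreal (decay DIM('k) m * inverse (s powr b)) * inverse (ennreal (N x powr b)) \<partial>?N)"
    proof (rule nn_integral_mono)
      fix x
      have "inverse (ennreal ((s * N x) powr b)) = ennreal (inverse (s powr b)) * inverse (ennreal (N x powr b))"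
      proof (cases "N x = 0")
        case True
        then show ?thesis using s by (simp add: ennreal_mult_top)
      next
        case False
        then have "0 < N x" using N[of x] by simp
        then show ?thesis using s by (simp add: inverse_ennreal ennreal_mult[symmetric] powr_mult)
      qed
      then show "laplace_per TYPE('k) m (s * N x) \<le> ennreal (decay DIM('k) m * inverse (s powr b)) * inverse (ennreal (N x powr b))"
        using Suc.IH[of "s * N x"] s N[of x] pos[of m] Suc.hyps by (simp add: b_def ennreal_mult mult.assoc)
    qed
    also have "\<dots> = ennreal (decay DIM('k) m * inverse (s powr b)) * (\<integral>\<^sup>+x. inverse (ennreal (N x powr b)) \<partial>?N)"
      by (rule nn_integral_cmult) measurable
    also have "\<dots> \<le> ennreal (decay DIM('k) m * inverse (s powr b)) * ennreal (b powr b * Gamma (b * (real (card ?I) - 1)) / Gamma (b * real (card ?I)))"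
      unfolding N_def b_def using Suc.hyps
      by (intro mult_left_mono nn_integral_PiM_gauss_inverse_norm_le) (auto simp: card_cartesian_product)
    also have "\<dots> = ennreal (decay DIM('k) m * inverse (s powr b) * (b powr b * Gamma (b * real m) / Gamma (b * real (Suc m))))"
    proof -
      have card: "real (card ?I) = real (Suc m)" and Suc_m: "real (Suc m) - 1 = real m"
        by (simp_all add: card_cartesian_product)
      show ?thesis
        unfolding card Suc_m
        using b Suc.hyps pos[of m] Gamma_real_pos[of "b * real m"] Gamma_real_pos[of "b * real (Suc m)"]
        by (intro ennreal_mult[symmetric] mult_nonneg_nonneg divide_nonneg_nonneg) (simp_all add: less_imp_le)
    qed
    also have "decay DIM('k) m * inverse (s powr b) * (b powr b * Gamma (b * real m) / Gamma (b * real (Suc m))) =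
        decay DIM('k) (Suc m) * inverse (s powr b)"
      using b Suc.hyps Gamma_real_pos[of "b * real m", THEN less_imp_neq]
      by (simp add: decay_def b_def[symmetric] powr_add distrib_left)
    finally show ?thesis
      using s pos[of "Suc m"] by (simp add: inverse_ennreal ennreal_mult[symmetric] b_def)
  qed
qed

section \<open>Gaussian transforms of measures\<close>

lemma emeasure_gauss_UNIV: "emeasure (gauss :: 'a::euclidean_space measure) UNIV = 1"
  using gauss.emeasure_space_1 by (simp only: space_gauss)

text \<open>Up to normalisation, the density of the convolution of \<open>\<mu>\<close> with a centred
  Gaussian whose variance tends to 0 as \<open>s\<close> grows.\<close>

definition gauss_transform :: "'a::euclidean_space measure \<Rightarrow> real \<Rightarrow> 'a \<Rightarrow> ennreal" where
  "gauss_transform \<mu> s w = (\<integral>\<^sup>+y. gexp s (y - w) \<partial>\<mu>)"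

lemma measurable_gauss_transform [measurable]:
  assumes "sigma_finite_measure \<mu>" and [measurable_cong]: "sets \<mu> = sets borel"
  shows "gauss_transform \<mu> s \<in> borel_measurable borel"
proof -
  interpret sigma_finite_measure \<mu> by fact
  show ?thesis unfolding gauss_transform_def by measurable
qed

lemma nn_integral_lborel_kernel:
  fixes f :: "'a::euclidean_space \<Rightarrow> ennreal"
  assumes s: "0 < s" and [measurable]: "f \<in> borel_measurable borel"
  shows "(\<integral>\<^sup>+w. f w * ennreal ((s / pi) powr (real DIM('a) / 2) * exp (- s * (norm (y - w))\<^sup>2)) \<partial>lborel) =
    (\<integral>\<^sup>+z. f (y + sqrt (real DIM('a) / (2 * s)) *\<^sub>R z) \<partial>gauss)"
proof -
  let ?d = "real DIM('a)"
  define r where "r = sqrt (?d / (2 * s))"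
  have r: "0 < r" "r\<^sup>2 = ?d / (2 * s)" using s by (auto simp: r_def)
  have rd: "r ^ DIM('a) = (?d / (2 * s)) powr (?d / 2)"
    using r s by (simp add: r_def powr_half_sqrt[symmetric] powr_powr flip: powr_realpow)
  have const: "r ^ DIM('a) * (s / pi) powr (?d / 2) = (?d / (2 * pi)) powr (?d / 2)"
    unfolding rd using s by (simp add: powr_mult[symmetric])
  have pos: "0 < r ^ DIM('a)" using r by simp
  have "(\<integral>\<^sup>+z. f (y + r *\<^sub>R z) \<partial>gauss) =
      (\<integral>\<^sup>+z. ennreal ((?d / (2 * pi)) powr (?d / 2) * exp (- (?d / 2) * (norm z)\<^sup>2)) * f (y + r *\<^sub>R z) \<partial>lborel)"
    unfolding gauss_eq_density by (rule nn_integral_density) measurable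
  also have "\<dots> = (\<integral>\<^sup>+z. ennreal (r ^ DIM('a)) * (\<lambda>w. f w * ennreal ((s / pi) powr (?d / 2) * exp (- s * (norm (y - w))\<^sup>2))) (y + r *\<^sub>R z) \<partial>lborel)"
  proof (rule nn_integral_cong)
    fix z :: 'a
    have "(norm (y - (y + r *\<^sub>R z)))\<^sup>2 = r\<^sup>2 * (norm z)\<^sup>2" by (simp add: power_mult_distrib)
    then have e: "- s * (norm (y - (y + r *\<^sub>R z)))\<^sup>2 = - (?d / 2) * (norm z)\<^sup>2"
      using s by (simp add: r(2))
    then show "ennreal ((?d / (2 * pi)) powr (?d / 2) * exp (- (?d / 2) * (norm z)\<^sup>2)) * f (y + r *\<^sub>R z) =
        ennreal (r ^ DIM('a)) * (\<lambda>w. f w * ennreal ((s / pi) powr (?d / 2) * exp (- s * (norm (y - w))\<^sup>2))) (y + r *\<^sub>R z)"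
      unfolding const[symmetric] e using pos by (simp add: ennreal_mult mult_ac)
  qed
  also have "\<dots> = ennreal (r ^ DIM('a)) * (\<integral>\<^sup>+z. (\<lambda>w. f w * ennreal ((s / pi) powr (?d / 2) * exp (- s * (norm (y - w))\<^sup>2))) (y + r *\<^sub>R z) \<partial>lborel)"
    by (rule nn_integral_cmult) measurable
  also have "\<dots> = ennreal (r ^ DIM('a)) * (ennreal (1 / r ^ DIM('a)) * (\<integral>\<^sup>+w. f w * ennreal ((s / pi) powr (?d / 2) * exp (- s * (norm (y - w))\<^sup>2)) \<partial>lborel))"
    by (subst nn_integral_lborel_affine[OF r(1)]) measurable
  finally show ?thesis
    using pos r by (simp add: r_def[symmetric] mult.assoc[symmetric] ennreal_mult[symmetric])
qed

lemma nn_integral_gauss_transform: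
  fixes \<mu> :: "'a::euclidean_space measure"
  assumes "sigma_finite_measure \<mu>" and sets [measurable_cong]: "sets \<mu> = sets borel" and s: "0 < s" and f [measurable]: "f \<in> borel_measurable borel"
  shows "(\<integral>\<^sup>+w. f w * (ennreal ((s / pi) powr (real DIM('a) / 2)) * gauss_transform \<mu> s w) \<partial>lborel) =
    (\<integral>\<^sup>+y. \<integral>\<^sup>+z. f (y + sqrt (real DIM('a) / (2 * s)) *\<^sub>R z) \<partial>gauss \<partial>\<mu>)"
proof -
  interpret M: sigma_finite_measure \<mu> by fact
  interpret pair_sigma_finite \<mu> "lborel :: 'a measure" ..
  have "(\<integral>\<^sup>+w. f w * (ennreal ((s / pi) powr (real DIM('a) / 2)) * gauss_transform \<mu> s w) \<partial>lborel) =
     (\<integral>\<^sup>+w. \<integral>\<^sup>+y. f w * ennreal ((s / pi) powr (real DIM('a) / 2) * exp (- s * (norm (y - w))\<^sup>2)) \<partial>\<mu> \<partial>lborel)"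
    unfolding gauss_transform_def by (simp add: nn_integral_cmult[symmetric] ennreal_mult)
  also have "\<dots> = (\<integral>\<^sup>+y. \<integral>\<^sup>+w. f w * ennreal ((s / pi) powr (real DIM('a) / 2) * exp (- s * (norm (y - w))\<^sup>2)) \<partial>lborel \<partial>\<mu>)"
    by (rule Fubini') measurable
  also have "\<dots> = (\<integral>\<^sup>+y. \<integral>\<^sup>+z. f (y + sqrt (real DIM('a) / (2 * s)) *\<^sub>R z) \<partial>gauss \<partial>\<mu>)"
    by (intro nn_integral_cong nn_integral_lborel_kernel[OF s f])
  finally show ?thesis .
qed

text \<open>If \<open>y\<close> lies in the open set \<open>U\<close>, then so does \<open>y + r z\<close>
  for every \<open>z\<close> and all small \<open>r\<close>. Fatou's lemma, for the Gaussian
  measure and then for \<open>\<mu>\<close>, gives the claim.\<close>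

lemma emeasure_open_le_liminf:
  fixes \<mu> :: "'a::euclidean_space measure"
  assumes sf: "sigma_finite_measure \<mu>" and sets [measurable_cong]: "sets \<mu> = sets borel" and U: "open U"
  shows "emeasure \<mu> U \<le> liminf (\<lambda>n. \<integral>\<^sup>+w. indicator U w *
    (ennreal ((real (Suc n) / pi) powr (real DIM('a) / 2)) * gauss_transform \<mu> (real (Suc n)) w) \<partial>lborel)"
proof -
  interpret sigma_finite_measure \<mu> by fact
  have [measurable]: "U \<in> sets borel" using U by simp
  define r where "r n = sqrt (real DIM('a) / (2 * real (Suc n)))" for n
  have r: "r \<longlonglongrightarrow> 0"
  proof -
    have "(\<lambda>n. real DIM('a) / 2 * inverse (real (Suc n))) \<longlonglongrightarrow> real DIM('a) / 2 * 0"
      by (intro tendsto_intros LIMSEQ_inverse_real_of_nat)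
    from tendsto_real_sqrt[OF this] show ?thesis
      unfolding mult_zero_right real_sqrt_zero r_def[abs_def]
      by (simp only: divide_inverse inverse_mult_distrib mult.assoc)
  qed
  have ev: "indicator U y \<le> liminf (\<lambda>n. indicator U (y + r n *\<^sub>R z) :: ennreal)" for y z
  proof (cases "y \<in> U")
    case True
    have "(\<lambda>n. y + r n *\<^sub>R z) \<longlonglongrightarrow> y + 0 *\<^sub>R z" by (intro tendsto_intros r)
    then have "eventually (\<lambda>n. y + r n *\<^sub>R z \<in> U) sequentially"
      using U True by (auto simp: tendsto_def)
    then have "eventually (\<lambda>n. 1 \<le> (indicator U (y + r n *\<^sub>R z) :: ennreal)) sequentially"
      by eventually_elim simp
    then have "1 \<le> liminf (\<lambda>n. indicator U (y + r n *\<^sub>R z) :: ennreal)" by (rule Liminf_bounded)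
    then show ?thesis using True by simp
  qed simp
  have "emeasure \<mu> U = (\<integral>\<^sup>+y. indicator U y \<partial>\<mu>)" using U by (intro nn_integral_indicator[symmetric]) (simp add: sets)
  also have "\<dots> = (\<integral>\<^sup>+y. \<integral>\<^sup>+z. indicator U y \<partial>(gauss :: 'a measure) \<partial>\<mu>)"
    by (simp only: nn_integral_const space_gauss emeasure_gauss_UNIV mult_1_right)
  also have "\<dots> \<le> (\<integral>\<^sup>+y. \<integral>\<^sup>+z. liminf (\<lambda>n. indicator U (y + r n *\<^sub>R z)) \<partial>gauss \<partial>\<mu>)"
    by (intro nn_integral_mono ev)
  also have "\<dots> \<le> (\<integral>\<^sup>+y. liminf (\<lambda>n. \<integral>\<^sup>+z. indicator U (y + r n *\<^sub>R z) \<partial>gauss) \<partial>\<mu>)"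
    by (intro nn_integral_mono nn_integral_liminf) measurable
  also have "\<dots> \<le> liminf (\<lambda>n. \<integral>\<^sup>+y. \<integral>\<^sup>+z. indicator U (y + r n *\<^sub>R z) \<partial>gauss \<partial>\<mu>)"
    by (intro nn_integral_liminf) measurable
  finally show ?thesis
    unfolding r_def by (subst nn_integral_gauss_transform[OF sf sets]) auto
qed

text \<open>For open sets the bound is immediate from \<open>emeasure_open_le_liminf\<close>; outer
  regularity of Lebesgue measure extends it to Borel sets.\<close>

lemma gauss_transform_bound_imp_emeasure_le:
  fixes \<mu> :: "'a::euclidean_space measure"
  assumes sf: "sigma_finite_measure \<mu>" and sets: "sets \<mu> = sets borel" and c: "0 \<le> c"
    and bound: "\<And>s w. 0 < s \<Longrightarrow> gauss_transform \<mu> s w \<le> ennreal (c * (pi / s) powr (real DIM('a) / 2))"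
    and A: "A \<in> sets borel"
  shows "emeasure \<mu> A \<le> ennreal c * emeasure lborel A"
proof -
  have "open U \<Longrightarrow> emeasure \<mu> U \<le> ennreal c * emeasure lborel U" for U
  proof -
    assume U: "open U"
    have "(\<integral>\<^sup>+w. indicator U w * (ennreal ((real (Suc n) / pi) powr (real DIM('a) / 2)) * gauss_transform \<mu> (real (Suc n)) w) \<partial>lborel)
      \<le> ennreal c * emeasure lborel U" for n
    proof -
      have "(real (Suc n) / pi) powr (real DIM('a) / 2) * (c * (pi / real (Suc n)) powr (real DIM('a) / 2)) =
          c * ((real (Suc n) / pi) * (pi / real (Suc n))) powr (real DIM('a) / 2)"
        by (subst powr_mult) simp_all
      then have cancel: "(real (Suc n) / pi) powr (real DIM('a) / 2) * (c * (pi / real (Suc n)) powr (real DIM('a) / 2)) = c"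
        by simp
      have "(\<integral>\<^sup>+w. indicator U w * (ennreal ((real (Suc n) / pi) powr (real DIM('a) / 2)) * gauss_transform \<mu> (real (Suc n)) w) \<partial>lborel)
        \<le> (\<integral>\<^sup>+w. indicator U w * (ennreal ((real (Suc n) / pi) powr (real DIM('a) / 2)) * ennreal (c * (pi / real (Suc n)) powr (real DIM('a) / 2))) \<partial>lborel)"
        by (intro nn_integral_mono mult_left_mono bound) auto
      also have "\<dots> = (\<integral>\<^sup>+w. ennreal c * indicator U w \<partial>lborel)"
        using c by (simp only: ennreal_mult[symmetric] powr_ge_zero mult_nonneg_nonneg cancel mult.commute)
      also have "\<dots> = ennreal c * emeasure lborel U" using U by (simp add: nn_integral_cmult_indicator)
      finally show ?thesis .
    qed
    then have "liminf (\<lambda>n. \<integral>\<^sup>+w. indicator U w * (ennreal ((real (Suc n) / pi) powr (real DIM('a) / 2)) * gauss_transform \<mu> (real (Suc n)) w) \<partial>lborel)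
      \<le> liminf (\<lambda>n. ennreal c * emeasure lborel U)"
      by (intro Liminf_mono always_eventually allI)
    with emeasure_open_le_liminf[OF sf sets U] show ?thesis by (simp add: Liminf_const)
  qed
  note opens = this
  show ?thesis
  proof (rule ennreal_le_epsilon)
    fix e :: real assume e: "0 < e"
    obtain U where U: "open U" "A \<subseteq> U" "emeasure lborel (U - A) < ennreal (e / (c + 1))"
      using outer_regular_lborel[OF A, of "e / (c + 1)"] e c by auto
    have "emeasure \<mu> A \<le> emeasure \<mu> U" using U by (intro emeasure_mono) (auto simp: sets)
    also have "\<dots> \<le> ennreal c * emeasure lborel U" by (rule opens) fact
    also have "emeasure lborel U = emeasure lborel A + emeasure lborel (U - A)"
      using U A by (subst plus_emeasure) (auto simp: Un_absorb1)
    also have "ennreal c * \<dots> = ennreal c * emeasure lborel A + ennreal c * emeasure lborel (U - A)"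
      by (rule distrib_left)
    also have "\<dots> \<le> ennreal c * emeasure lborel A + ennreal c * ennreal (e / (c + 1))"
      using U by (intro add_left_mono mult_left_mono) auto
    also have "ennreal c * ennreal (e / (c + 1)) \<le> ennreal e"
      using c e by (simp add: ennreal_mult[symmetric] field_simps)
    finally show "emeasure \<mu> A \<le> ennreal c * emeasure lborel A + ennreal e" by (simp add: add_left_mono)
  qed
qed

text \<open>The Radon-Nikodym density exceeds \<open>c\<close> only on a null set, since otherwise
  \<open>\<mu>\<close> would be too large on a bounded part of that set. It is then cut off at
  \<open>c\<close> to obtain the bound everywhere.\<close>

lemma emeasure_le_imp_bounded_density:
  fixes \<mu> :: "'a::euclidean_space measure"
  assumes fin: "finite_measure \<mu>" and sets: "sets \<mu> = sets borel" and c: "0 \<le> c"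
    and le: "\<And>A. A \<in> sets borel \<Longrightarrow> emeasure \<mu> A \<le> ennreal c * emeasure lborel A"
  obtains q where "q \<in> borel_measurable borel" "\<And>x. 0 \<le> q x" "\<And>x. q x \<le> c" "\<mu> = density lborel (\<lambda>x. ennreal (q x))"
proof -
  interpret finite_measure \<mu> by fact
  have "absolutely_continuous lborel \<mu>"
    unfolding absolutely_continuous_def null_sets_def using le by (auto simp: sets) (metis le_zero_eq mult_zero_right)
  then obtain f where f [measurable]: "f \<in> borel_measurable lborel" and dens: "density lborel f = \<mu>"
    using sigma_finite_measure.Radon_Nikodym[OF sigma_finite_lborel, of \<mu>] by (auto simp: sets)
  have f' [measurable]: "f \<in> borel_measurable borel" using f by simp
  define B where "B k = {x \<in> ball 0 (real k). ennreal c < f x}" for k :: nat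
  have [measurable]: "B k \<in> sets borel" for k unfolding B_def by measurable
  have "AE x in lborel. x \<notin> B k" for k
  proof -
    have fin_B: "emeasure lborel (B k) < \<infinity>"
    proof -
      have "emeasure lborel (B k) \<le> emeasure lborel (ball (0 :: 'a) (real k))" by (intro emeasure_mono) (auto simp: B_def)
      also have "\<dots> < \<infinity>" by (intro emeasure_bounded_finite) auto
      finally show ?thesis .
    qed
    have "(\<integral>\<^sup>+x. f x * indicator (B k) x \<partial>lborel) = emeasure \<mu> (B k)"
      unfolding dens[symmetric] by (simp add: emeasure_density)
    also have "\<dots> \<le> ennreal c * emeasure lborel (B k)" by (intro le) simp
    finally have up: "(\<integral>\<^sup>+x. f x * indicator (B k) x \<partial>lborel) \<le> (\<integral>\<^sup>+x. ennreal c * indicator (B k) x \<partial>lborel)"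
      by (simp add: nn_integral_cmult_indicator)
    have finc: "(\<integral>\<^sup>+x. ennreal c * indicator (B k) x \<partial>lborel) < \<infinity>"
      using fin_B by (simp add: nn_integral_cmult_indicator ennreal_mult_less_top)
    have "(\<integral>\<^sup>+x. f x * indicator (B k) x - ennreal c * indicator (B k) x \<partial>lborel) =
        (\<integral>\<^sup>+x. f x * indicator (B k) x \<partial>lborel) - (\<integral>\<^sup>+x. ennreal c * indicator (B k) x \<partial>lborel)"
      using finc by (intro nn_integral_diff AE_I2) (auto simp: B_def indicator_def)
    also have "\<dots> = 0" using up finc by (simp add: diff_eq_0_iff_ennreal)
    finally have "AE x in lborel. f x * indicator (B k) x - ennreal c * indicator (B k) x = 0"
      by (subst (asm) nn_integral_0_iff_AE) auto
    then show ?thesis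
      by eventually_elim (auto simp: B_def indicator_def diff_eq_0_iff_ennreal split: if_splits)
  qed
  then have "AE x in lborel. \<forall>k. x \<notin> B k" by (simp add: AE_all_countable)
  then have AE: "AE x in lborel. f x \<le> ennreal c"
  proof eventually_elim
    fix x assume "\<forall>k. x \<notin> B k"
    moreover obtain k :: nat where "norm x < real k" using reals_Archimedean2 by blast
    ultimately show "f x \<le> ennreal c" by (auto simp: B_def not_less dest!: spec[of _ k])
  qed
  define q where "q x = min c (enn2real (f x))" for x
  have [measurable]: "q \<in> borel_measurable borel" unfolding q_def by measurable
  have "\<mu> = density lborel (\<lambda>x. ennreal (q x))"
    unfolding dens[symmetric]
  proof (rule density_cong)
    show "AE x in lborel. f x = ennreal (q x)"
      using AE
    proof eventually_elim
      fix x assume "f x \<le> ennreal c"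
      then obtain t where "f x = ennreal t" "0 \<le> t" by (cases "f x") (auto simp: top_unique)
      then show "f x = ennreal (q x)" using \<open>f x \<le> ennreal c\<close> c by (simp add: q_def min_def)
    qed
  qed auto
  then show ?thesis using c by (intro that[of q]) (auto simp: q_def)
qed

lemma liminf_add_le:
  fixes a b :: "nat \<Rightarrow> ennreal"
  assumes "\<And>n. a n + b n \<le> c"
  shows "liminf a + liminf b \<le> c"
proof -
  have inc: "incseq (\<lambda>n. INF m\<in>{n..}. x m)" for x :: "nat \<Rightarrow> ennreal"
    by (auto simp: incseq_def intro!: INF_superset_mono)
  have "liminf a + liminf b = (SUP n. (INF m\<in>{n..}. a m) + (INF m\<in>{n..}. b m))"
    unfolding liminf_SUP_INF by (rule ennreal_SUP_add[symmetric]) (rule inc)+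
  also have "\<dots> \<le> c"
    by (intro SUP_least order_trans[OF add_mono assms] INF_lower) auto
  finally show ?thesis .
qed

text \<open>Both an open set \<open>V\<close> and the exterior of its closure satisfy the lower bound
  \<open>emeasure_open_le_liminf\<close>, with the same smoothed densities. Their integrals add
  up to at most 1, which gives \<open>\<mu> V \<le> \<nu> (closure V)\<close>. An open set is
  exhausted by open sets whose closures it contains.\<close>

lemma gauss_transform_eq_imp_open_le:
  fixes \<mu> \<nu> :: "'a::euclidean_space measure"
  assumes \<mu>: "prob_space \<mu>" "sets \<mu> = sets borel" and \<nu>: "prob_space \<nu>" "sets \<nu> = sets borel"
    and eq: "\<And>s w. 0 < s \<Longrightarrow> gauss_transform \<mu> s w = gauss_transform \<nu> s w"
    and U: "open U"
  shows "emeasure \<mu> U \<le> emeasure \<nu> U"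
proof -
  interpret \<mu>: prob_space \<mu> by fact
  interpret \<nu>: prob_space \<nu> by fact
  note sf = \<mu>.sigma_finite_measure_axioms \<nu>.sigma_finite_measure_axioms
  have closure: "emeasure \<mu> V \<le> emeasure \<nu> (closure V)" if V: "open V" for V
  proof -
    define W where "W = - closure V"
    have W: "open W" by (simp add: W_def open_Compl)
    define T where "T n w = ennreal ((real (Suc n) / pi) powr (real DIM('a) / 2)) * gauss_transform \<nu> (real (Suc n)) w" for n w
    have [measurable]: "T n \<in> borel_measurable borel" for n
      unfolding T_def using measurable_gauss_transform[OF sf(2) \<nu>(2)] by measurable
    have [measurable]: "V \<in> sets borel" "W \<in> sets borel" using V W by auto
    have "emeasure \<mu> V \<le> liminf (\<lambda>n. \<integral>\<^sup>+w. indicator V w * T n w \<partial>lborel)"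
      using emeasure_open_le_liminf[OF sf(1) \<mu>(2) V] by (simp add: T_def eq)
    moreover have "emeasure \<nu> W \<le> liminf (\<lambda>n. \<integral>\<^sup>+w. indicator W w * T n w \<partial>lborel)"
      using emeasure_open_le_liminf[OF sf(2) \<nu>(2) W] by (simp add: T_def)
    ultimately have "emeasure \<mu> V + emeasure \<nu> W \<le>
        liminf (\<lambda>n. \<integral>\<^sup>+w. indicator V w * T n w \<partial>lborel) + liminf (\<lambda>n. \<integral>\<^sup>+w. indicator W w * T n w \<partial>lborel)"
      by (rule add_mono)
    also have "\<dots> \<le> 1"
    proof (rule liminf_add_le)
      fix n
      have "(\<integral>\<^sup>+w. indicator V w * T n w \<partial>lborel) + (\<integral>\<^sup>+w. indicator W w * T n w \<partial>lborel) =
          (\<integral>\<^sup>+w. indicator V w * T n w + indicator W w * T n w \<partial>lborel)"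
        by (rule nn_integral_add[symmetric]) measurable
      also have "\<dots> \<le> (\<integral>\<^sup>+w. 1 * T n w \<partial>lborel)"
        using closure_subset[of V] by (intro nn_integral_mono) (auto simp: indicator_def W_def)
      also have "\<dots> = (\<integral>\<^sup>+y. \<integral>\<^sup>+z. 1 \<partial>(gauss :: 'a measure) \<partial>\<nu>)"
        unfolding T_def by (rule nn_integral_gauss_transform[OF sf(2) \<nu>(2)]) auto
      also have "\<dots> = 1" by (simp only: nn_integral_const space_gauss emeasure_gauss_UNIV \<nu>.emeasure_space_1 mult_1_right)
      finally show "(\<integral>\<^sup>+w. indicator V w * T n w \<partial>lborel) + (\<integral>\<^sup>+w. indicator W w * T n w \<partial>lborel) \<le> 1" .
    qed
    also have "1 = emeasure \<nu> (closure V) + emeasure \<nu> W"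
    proof -
      have "emeasure \<nu> (closure V) + emeasure \<nu> W = emeasure \<nu> (closure V \<union> W)"
        by (rule plus_emeasure) (auto simp: \<nu> W_def)
      also have "closure V \<union> W = space \<nu>" using sets_eq_imp_space_eq[OF \<nu>(2)] by (auto simp: W_def)
      finally show ?thesis by (simp add: \<nu>.emeasure_space_1)
    qed
    finally show ?thesis by (simp add: \<nu>.emeasure_eq_measure \<mu>.emeasure_eq_measure)
  qed
  show ?thesis
  proof (cases "U = UNIV")
    case True
    then show ?thesis
      using \<mu>.emeasure_space_1 \<nu>.emeasure_space_1 sets_eq_imp_space_eq[OF \<mu>(2)] sets_eq_imp_space_eq[OF \<nu>(2)] by simp
  next
    case False
    define V where "V n = {x. inverse (real (Suc n)) < infdist x (- U)}" for n
    have V: "open (V n)" for n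
      unfolding V_def by (intro open_Collect_less continuous_intros)
    have cl: "closure (V n) \<subseteq> U" for n
    proof -
      have "closure (V n) \<subseteq> {x. inverse (real (Suc n)) \<le> infdist x (- U)}"
        by (rule closure_minimal) (auto simp: V_def intro!: closed_Collect_le continuous_intros)
      also have "\<dots> \<subseteq> U"
      proof
        fix x assume x: "x \<in> {x. inverse (real (Suc n)) \<le> infdist x (- U)}"
        have "0 < inverse (real (Suc n))" by simp
        with x have "infdist x (- U) \<noteq> 0" by auto
        then show "x \<in> U" using infdist_zero[of x "- U"] by blast
      qed
      finally show ?thesis .
    qed
    have "(\<Union>n. V n) = U"
    proof
      show "(\<Union>n. V n) \<subseteq> U" using cl closure_subset by blast
      show "U \<subseteq> (\<Union>n. V n)"
      proof
        fix x assume "x \<in> U"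
        then have "0 < infdist x (- U)" using U False by (intro infdist_pos_not_in_closed) auto
        then obtain n where "inverse (real (Suc n)) < infdist x (- U)" using reals_Archimedean by blast
        then show "x \<in> (\<Union>n. V n)" by (auto simp: V_def)
      qed
    qed
    moreover have "incseq V"
    proof (rule incseq_SucI, rule subsetI)
      fix n x assume "x \<in> V n"
      moreover have "inverse (real (Suc (Suc n))) \<le> inverse (real (Suc n))" by (intro le_imp_inverse_le) auto
      ultimately show "x \<in> V (Suc n)" unfolding V_def mem_Collect_eq by (rule le_less_trans[rotated])
    qed
    ultimately have "emeasure \<mu> U = (SUP n. emeasure \<mu> (V n))"
      using V SUP_emeasure_incseq[of V \<mu>] by (metis \<mu>(2) borel_open image_subset_iff)
    also have "\<dots> \<le> emeasure \<nu> U"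
    proof (rule SUP_least)
      fix n
      have "emeasure \<mu> (V n) \<le> emeasure \<nu> (closure (V n))" by (rule closure[OF V])
      also have "\<dots> \<le> emeasure \<nu> U" using cl U by (intro emeasure_mono) (auto simp: \<nu>)
      finally show "emeasure \<mu> (V n) \<le> emeasure \<nu> U" .
    qed
    finally show ?thesis .
  qed
qed

lemma gauss_transform_inject:
  fixes \<mu> \<nu> :: "'a::euclidean_space measure"
  assumes \<mu>: "prob_space \<mu>" "sets \<mu> = sets borel" and \<nu>: "prob_space \<nu>" "sets \<nu> = sets borel"
    and eq: "\<And>s w. 0 < s \<Longrightarrow> gauss_transform \<mu> s w = gauss_transform \<nu> s w"
  shows "\<mu> = \<nu>"
proof (rule measure_eqI_generator_eq[where E = "{U. open U}" and \<Omega> = UNIV and A = "\<lambda>_. UNIV"])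
  fix U :: "'a set" assume "U \<in> {U. open U}"
  then show "emeasure \<mu> U = emeasure \<nu> U"
    using gauss_transform_eq_imp_open_le[OF \<mu> \<nu> eq, of U] gauss_transform_eq_imp_open_le[OF \<nu> \<mu> eq[symmetric], of U] by auto
next
  show "emeasure \<mu> UNIV \<noteq> \<infinity>"
    using prob_space.emeasure_space_1[OF \<mu>(1)] sets_eq_imp_space_eq[OF \<mu>(2)] by simp
qed (auto simp: Int_stable_def \<mu> \<nu> borel_def)

section \<open>Mixtures of centred Gaussians\<close>

text \<open>The density of \<open>t\<close> times a standard Gaussian vector. For \<open>t = 0\<close> the
  conventions on division and powers make it vanish identically.\<close>

definition scaled_gauss_density :: "real \<Rightarrow> 'a::euclidean_space \<Rightarrow> real" where
  "scaled_gauss_density t z = (real DIM('a) / (2 * t\<^sup>2) / pi) powr (real DIM('a) / 2) *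
     exp (- (real DIM('a) / (2 * t\<^sup>2)) * (norm z)\<^sup>2)"

lemma scaled_gauss_density_nonneg: "0 \<le> scaled_gauss_density t z"
  by (simp add: scaled_gauss_density_def)

lemma scaled_gauss_density_antimono:
  fixes x y :: "'a::euclidean_space"
  assumes "norm x \<le> norm y"
  shows "scaled_gauss_density t y \<le> scaled_gauss_density t x"
proof -
  have "real DIM('a) / (2 * t\<^sup>2) * (norm x)\<^sup>2 \<le> real DIM('a) / (2 * t\<^sup>2) * (norm y)\<^sup>2"
    using assms by (intro mult_left_mono power_mono) auto
  then show ?thesis unfolding scaled_gauss_density_def by (intro mult_left_mono) auto
qed

lemma measurable_scaled_gauss_density [measurable]:
  assumes [measurable]: "f \<in> borel_measurable M" "g \<in> borel_measurable M"
  shows "(\<lambda>x. scaled_gauss_density (f x) (g x)) \<in> borel_measurable M"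
  unfolding scaled_gauss_density_def by measurable

lemma nn_integral_scaled_gauss:
  fixes f :: "'a::euclidean_space \<Rightarrow> ennreal"
  assumes t: "0 < t" and [measurable]: "f \<in> borel_measurable borel"
  shows "(\<integral>\<^sup>+z. f (t *\<^sub>R z) \<partial>gauss) = (\<integral>\<^sup>+y. f y * ennreal (scaled_gauss_density t y) \<partial>lborel)"
proof -
  have "sqrt (real DIM('a) / (2 * (real DIM('a) / (2 * t\<^sup>2)))) = t" using t by (simp add: real_sqrt_divide)
  then show ?thesis
    using nn_integral_lborel_kernel[of "real DIM('a) / (2 * t\<^sup>2)" f 0] t
    by (simp add: scaled_gauss_density_def)
qed

text \<open>The normalised transform of a Gaussian at 0 is explicit, and its limit is the value of the
  density at 0.\<close>

lemma laplace_at_zero_tendsto: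
  fixes t :: real
  assumes t: "0 < t"
  shows "(\<lambda>n. ennreal ((real (Suc n) / pi) powr (real DIM('a) / 2)) *
      (\<integral>\<^sup>+z. gexp (real (Suc n)) (t *\<^sub>R z) \<partial>(gauss :: 'a::euclidean_space measure)))
    \<longlonglongrightarrow> ennreal (scaled_gauss_density t (0 :: 'a))"
proof -
  let ?d = "real DIM('a)"
  have eq: "ennreal ((s / pi) powr (?d / 2)) * (\<integral>\<^sup>+z. gexp s (t *\<^sub>R z) \<partial>(gauss :: 'a measure)) =
      ennreal ((1 / (pi * inverse s + 2 * pi * t\<^sup>2 / ?d)) powr (?d / 2))" if s: "0 < s" for s
  proof -
    have "(\<integral>\<^sup>+z. gexp s (t *\<^sub>R z) \<partial>(gauss :: 'a measure)) =
        (\<integral>\<^sup>+z. gexp (s * t\<^sup>2) z \<partial>(gauss :: 'a measure))"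
      by (simp add: power_mult_distrib mult.assoc)
    also have "\<dots> = ennreal ((1 + 2 * (s * t\<^sup>2) / ?d) powr (- (?d / 2)))"
      using s by (intro nn_integral_gauss_exp_neg_norm_square) simp
    also have "(1 + 2 * (s * t\<^sup>2) / ?d) powr (- (?d / 2)) = (inverse (1 + 2 * (s * t\<^sup>2) / ?d)) powr (?d / 2)"
      using s by (simp add: powr_minus inverse_powr)
    finally have "ennreal ((s / pi) powr (?d / 2)) * (\<integral>\<^sup>+z. gexp s (t *\<^sub>R z) \<partial>(gauss :: 'a measure)) =
        ennreal (((s / pi) * inverse (1 + 2 * (s * t\<^sup>2) / ?d)) powr (?d / 2))"
      unfolding powr_mult by (simp add: ennreal_mult)
    also have "(s / pi) * inverse (1 + 2 * (s * t\<^sup>2) / ?d) = 1 / (pi * inverse s + 2 * pi * t\<^sup>2 / ?d)"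
    proof -
      have "pi * inverse s + 2 * pi * t\<^sup>2 / ?d = (pi / s) * (1 + 2 * (s * t\<^sup>2) / ?d)"
        using s by (simp add: field_simps)
      then show ?thesis using s by (simp add: inverse_eq_divide)
    qed
    finally show ?thesis .
  qed
  have "(\<lambda>n. (1 / (pi * inverse (real (Suc n)) + 2 * pi * t\<^sup>2 / ?d)) powr (?d / 2)) \<longlonglongrightarrow>
      (1 / (pi * 0 + 2 * pi * t\<^sup>2 / ?d)) powr (?d / 2)"
    using t by (intro tendsto_intros LIMSEQ_inverse_real_of_nat) auto
  also have "(1 / (pi * 0 + 2 * pi * t\<^sup>2 / ?d)) powr (?d / 2) = scaled_gauss_density t (0 :: 'a)"
    using t by (simp add: scaled_gauss_density_def field_simps)
  finally show ?thesis
    by (subst eq) (simp_all add: tendsto_ennrealI)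
qed

lemma emeasure_lborel_ball_pos: "0 < r \<Longrightarrow> 0 < emeasure lborel (ball (c :: 'a::euclidean_space) r)"
  by (simp add: emeasure_ball unit_ball_vol_pos)

text \<open>The essential supremum bounds \<open>p\<close> at points arbitrarily close to 0, because balls
  have positive measure, and therefore by continuity also at 0 itself.\<close>

lemma Linf_norm_radial:
  fixes p :: "'a::euclidean_space \<Rightarrow> real"
  assumes [measurable]: "p \<in> borel_measurable borel" and nonneg: "\<And>x. 0 \<le> p x" and le: "\<And>x. p x \<le> p 0"
    and cont: "\<And>X. X \<longlonglongrightarrow> 0 \<Longrightarrow> (\<lambda>k. p (X k)) \<longlonglongrightarrow> p 0"
  shows "Linf_norm p = ereal (p 0)"
proof (rule antisym)
  show "Linf_norm p \<le> ereal (p 0)"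
    unfolding Linf_norm_def using nonneg le by (intro esssup_I) auto
  have ess: "AE x in lborel. ereal \<bar>p x\<bar> \<le> Linf_norm p"
    unfolding Linf_norm_def by (rule esssup_AE)
  have "\<exists>x\<in>ball 0 (inverse (real (Suc k))). ereal (p x) \<le> Linf_norm p" for k
  proof (rule ccontr)
    assume *: "\<not> ?thesis"
    have "AE x in lborel. x \<notin> ball (0 :: 'a) (inverse (real (Suc k)))"
      using ess by eventually_elim (use * nonneg in force)
    then have "emeasure lborel (ball (0 :: 'a) (inverse (real (Suc k)))) = 0"
      by (subst (asm) AE_iff_measurable[of "ball 0 (inverse (real (Suc k)))"]) (auto simp: set_eq_iff)
    with emeasure_lborel_ball_pos[of "inverse (real (Suc k))" "0 :: 'a"] show False by simp
  qed
  then obtain X where X: "\<And>k. X k \<in> ball (0 :: 'a) (inverse (real (Suc k)))" "\<And>k. ereal (p (X k)) \<le> Linf_norm p"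
    by metis
  have "(\<lambda>k. norm (X k)) \<longlonglongrightarrow> 0"
    using X(1) by (intro real_tendsto_sandwich[OF _ _ tendsto_const LIMSEQ_inverse_real_of_nat])
      (auto intro!: always_eventually less_imp_le)
  then have "X \<longlonglongrightarrow> 0" by (rule tendsto_norm_zero_cancel)
  from cont[OF this] have "(\<lambda>k. ereal (p (X k))) \<longlonglongrightarrow> ereal (p 0)" by simp
  then show "ereal (p 0) \<le> Linf_norm p"
    by (rule LIMSEQ_le_const2) (use X(2) in auto)
qed

text \<open>The density is the average of the Gaussian densities over the random scale. The bound on the
  transforms at 0 serves twice. It shows that the scale is almost surely positive, for otherwise
  the transform at 0 would not tend to 0; and by Fatou's lemma it bounds the average of the
  densities at 0, which dominates the densities at all other points.\<close>

lemma gaussian_mixture_density: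
  fixes \<mu> :: "'a::euclidean_space measure" and \<tau> :: "'r \<Rightarrow> real"
  assumes \<mu>: "prob_space \<mu>" "sets \<mu> = sets borel" and N: "prob_space N"
    and \<tau> [measurable]: "\<tau> \<in> borel_measurable N" and \<tau>0: "\<And>R. 0 \<le> \<tau> R" and c: "0 \<le> c"
    and mixture: "\<And>s w. 0 < s \<Longrightarrow> gauss_transform \<mu> s w =
      (\<integral>\<^sup>+R. \<integral>\<^sup>+z. gexp s (\<tau> R *\<^sub>R z - w) \<partial>gauss \<partial>N)"
    and bound: "\<And>s. 0 < s \<Longrightarrow> gauss_transform \<mu> s 0 \<le> ennreal (c * (pi / s) powr (real DIM('a) / 2))"
  obtains p where "p \<in> borel_measurable borel" "\<And>x. 0 \<le> p x" "\<mu> = density lborel (\<lambda>x. ennreal (p x))"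
    "\<And>x y. norm x \<le> norm y \<Longrightarrow> p y \<le> p x" "Linf_norm p = ereal (p 0)" "p 0 \<le> c"
proof -
  interpret N: prob_space N by fact
  interpret pair_sigma_finite N "lborel :: 'a measure" ..
  let ?d = "real DIM('a)"
  define K where "K n = (real (Suc n) / pi) powr (?d / 2)" for n
  have cancel: "K n * (c * (pi / real (Suc n)) powr (?d / 2)) = c" for n
  proof -
    have "K n * (c * (pi / real (Suc n)) powr (?d / 2)) = c * ((real (Suc n) / pi) * (pi / real (Suc n))) powr (?d / 2)"
      unfolding K_def by (subst powr_mult) simp_all
    then show ?thesis by simp
  qed
  have K: "0 \<le> K n" for n by (simp add: K_def)
  have at_zero: "(\<integral>\<^sup>+R. ennreal (K n) * (\<integral>\<^sup>+z. gexp (real (Suc n)) (\<tau> R *\<^sub>R z :: 'a) \<partial>gauss) \<partial>N) \<le> ennreal c" for n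
  proof -
    have "(\<integral>\<^sup>+R. ennreal (K n) * (\<integral>\<^sup>+z. gexp (real (Suc n)) (\<tau> R *\<^sub>R z :: 'a) \<partial>gauss) \<partial>N) =
        ennreal (K n) * gauss_transform \<mu> (real (Suc n)) 0"
      by (subst mixture) (simp_all add: nn_integral_cmult)
    also have "\<dots> \<le> ennreal (K n) * ennreal (c * (pi / real (Suc n)) powr (?d / 2))"
      by (intro mult_left_mono bound) auto
    also have "\<dots> = ennreal c"
      using K[of n] c by (simp only: ennreal_mult[symmetric] powr_ge_zero mult_nonneg_nonneg cancel)
    finally show ?thesis .
  qed
  \<comment> \<open>On the event that the scale vanishes the inner integral is 1, while the factor
    \<open>K n\<close> is unbounded.\<close>
  have pos: "AE R in N. 0 < \<tau> R"
  proof -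
    define Z where "Z = {R \<in> space N. \<tau> R = 0}"
    have [measurable]: "Z \<in> sets N" unfolding Z_def by measurable
    have le: "ennreal (K n) * emeasure N Z \<le> ennreal c" for n
    proof -
      have "ennreal (K n) * emeasure N Z = (\<integral>\<^sup>+R. ennreal (K n) * indicator Z R \<partial>N)"
        by (simp add: nn_integral_cmult_indicator)
      also have "\<dots> \<le> (\<integral>\<^sup>+R. ennreal (K n) * (\<integral>\<^sup>+z. gexp (real (Suc n)) (\<tau> R *\<^sub>R z :: 'a) \<partial>gauss) \<partial>N)"
        by (intro nn_integral_mono mult_left_mono) (auto simp: Z_def indicator_def emeasure_gauss_UNIV)
      finally show ?thesis using at_zero[of n] by (rule order_trans)
    qed
    have "measure N Z = 0"
    proof (rule ccontr)
      assume "measure N Z \<noteq> 0"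
      then have m: "0 < measure N Z" by (simp add: zero_less_measure_iff)
      have "filterlim K at_top sequentially"
        unfolding K_def by real_asymp
      then have "eventually (\<lambda>n. c / measure N Z < K n) sequentially"
        by (auto simp: filterlim_at_top_dense)
      then obtain n where "c / measure N Z < K n" by (meson eventually_sequentially order_refl)
      then have "c < K n * measure N Z" using m by (simp add: field_simps)
      moreover have "K n * measure N Z \<le> c"
        using le[of n] K[of n] c by (simp add: N.emeasure_eq_measure ennreal_mult[symmetric])
      ultimately show False by simp
    qed
    then have "AE R in N. R \<notin> Z"
      by (intro AE_not_in) (simp add: null_sets_def N.emeasure_eq_measure)
    then show ?thesis
      using AE_space by eventually_elim (use \<tau>0 in \<open>auto simp: Z_def less_le\<close>)
  qed
  have nn0: "(\<integral>\<^sup>+R. ennreal (scaled_gauss_density (\<tau> R) (0 :: 'a)) \<partial>N) \<le> ennreal c"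
  proof -
    have "(\<integral>\<^sup>+R. ennreal (scaled_gauss_density (\<tau> R) (0 :: 'a)) \<partial>N) \<le>
        (\<integral>\<^sup>+R. liminf (\<lambda>n. ennreal (K n) * (\<integral>\<^sup>+z. gexp (real (Suc n)) (\<tau> R *\<^sub>R z :: 'a) \<partial>gauss)) \<partial>N)"
    proof (rule nn_integral_mono_AE)
      show "AE R in N. ennreal (scaled_gauss_density (\<tau> R) (0 :: 'a)) \<le>
          liminf (\<lambda>n. ennreal (K n) * (\<integral>\<^sup>+z. gexp (real (Suc n)) (\<tau> R *\<^sub>R z :: 'a) \<partial>gauss))"
        using pos
      proof eventually_elim
        fix R assume "0 < \<tau> R"
        from lim_imp_Liminf[OF _ laplace_at_zero_tendsto[OF this, where 'a = 'a]]
        show "ennreal (scaled_gauss_density (\<tau> R) (0 :: 'a)) \<le>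
          liminf (\<lambda>n. ennreal (K n) * (\<integral>\<^sup>+z. gexp (real (Suc n)) (\<tau> R *\<^sub>R z :: 'a) \<partial>gauss))"
          by (simp add: K_def)
      qed
    qed
    also have "\<dots> \<le> liminf (\<lambda>n. \<integral>\<^sup>+R. ennreal (K n) * (\<integral>\<^sup>+z. gexp (real (Suc n)) (\<tau> R *\<^sub>R z :: 'a) \<partial>gauss) \<partial>N)"
      by (rule nn_integral_liminf) measurable
    also have "\<dots> \<le> liminf (\<lambda>n. ennreal c)"
      by (intro Liminf_mono always_eventually allI at_zero)
    finally show ?thesis by (simp add: Liminf_const)
  qed
  have int0: "integrable N (\<lambda>R. scaled_gauss_density (\<tau> R) (0 :: 'a))"
  proof (rule integrableI_nonneg)
    show "(\<integral>\<^sup>+R. ennreal (scaled_gauss_density (\<tau> R) (0 :: 'a)) \<partial>N) < \<infinity>"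
      using nn0 by (rule le_less_trans) simp
  qed (auto simp: scaled_gauss_density_nonneg)
  have int: "integrable N (\<lambda>R. scaled_gauss_density (\<tau> R) z)" for z :: 'a
    by (rule Bochner_Integration.integrable_bound[OF int0])
       (auto simp: scaled_gauss_density_nonneg intro!: AE_I2 scaled_gauss_density_antimono)
  define p where "p z = (\<integral>R. scaled_gauss_density (\<tau> R) z \<partial>N)" for z :: 'a
  have p_meas [measurable]: "p \<in> borel_measurable borel"
    unfolding p_def by measurable
  have p_nonneg: "0 \<le> p z" for z
    unfolding p_def by (simp add: integral_nonneg_AE scaled_gauss_density_nonneg)
  have p_anti: "p y \<le> p x" if "norm x \<le> norm y" for x y
    unfolding p_def by (intro integral_mono int scaled_gauss_density_antimono that)
  have p_nn: "ennreal (p z) = (\<integral>\<^sup>+R. ennreal (scaled_gauss_density (\<tau> R) z) \<partial>N)" for z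
    unfolding p_def by (rule nn_integral_eq_integral[OF int, symmetric]) (simp add: scaled_gauss_density_nonneg)
  have p_int: "(\<integral>\<^sup>+y. f y * ennreal (p y) \<partial>lborel) = (\<integral>\<^sup>+R. \<integral>\<^sup>+z. f (\<tau> R *\<^sub>R z) \<partial>gauss \<partial>N)"
    if [measurable]: "f \<in> borel_measurable borel" for f
  proof -
    have "(\<integral>\<^sup>+y. f y * ennreal (p y) \<partial>lborel) = (\<integral>\<^sup>+y. \<integral>\<^sup>+R. f y * ennreal (scaled_gauss_density (\<tau> R) y) \<partial>N \<partial>lborel)"
      unfolding p_nn by (simp add: nn_integral_cmult)
    also have "\<dots> = (\<integral>\<^sup>+R. \<integral>\<^sup>+y. f y * ennreal (scaled_gauss_density (\<tau> R) y) \<partial>lborel \<partial>N)"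
      by (rule Fubini') measurable
    also have "\<dots> = (\<integral>\<^sup>+R. \<integral>\<^sup>+z. f (\<tau> R *\<^sub>R z) \<partial>gauss \<partial>N)"
    proof (rule nn_integral_cong_AE)
      show "AE R in N. (\<integral>\<^sup>+y. f y * ennreal (scaled_gauss_density (\<tau> R) y) \<partial>lborel) = (\<integral>\<^sup>+z. f (\<tau> R *\<^sub>R z) \<partial>gauss)"
        using pos by eventually_elim (simp add: nn_integral_scaled_gauss)
    qed
    finally show ?thesis .
  qed
  let ?\<nu> = "density lborel (\<lambda>x. ennreal (p x))"
  have "emeasure ?\<nu> (space ?\<nu>) = (\<integral>\<^sup>+y. 1 * ennreal (p y) \<partial>lborel)"
    by (simp add: emeasure_density)
  also have "\<dots> = 1"
    by (subst p_int) (simp_all add: emeasure_gauss_UNIV N.emeasure_space_1)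
  finally have \<nu>: "prob_space ?\<nu>" by (rule prob_spaceI)
  have "\<mu> = ?\<nu>"
  proof (rule gauss_transform_inject[OF \<mu> \<nu>])
    fix s :: real and w :: 'a assume s: "0 < s"
    have "gauss_transform ?\<nu> s w = (\<integral>\<^sup>+y. gexp s (y - w) * ennreal (p y) \<partial>lborel)"
      unfolding gauss_transform_def by (subst nn_integral_density) (auto simp: mult.commute)
    also have "\<dots> = gauss_transform \<mu> s w"
      by (subst p_int) (simp_all add: mixture[OF s])
    finally show "gauss_transform \<mu> s w = gauss_transform ?\<nu> s w" ..
  qed simp
  moreover have "Linf_norm p = ereal (p 0)"
  proof (rule Linf_norm_radial[OF p_meas p_nonneg])
    show "p x \<le> p 0" for x by (rule p_anti) simp
    fix X :: "nat \<Rightarrow> 'a" assume X: "X \<longlonglongrightarrow> 0"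
    show "(\<lambda>k. p (X k)) \<longlonglongrightarrow> p 0"
      unfolding p_def
    proof (rule integral_dominated_convergence[OF _ _ int0])
      show "AE R in N. (\<lambda>k. scaled_gauss_density (\<tau> R) (X k)) \<longlonglongrightarrow> scaled_gauss_density (\<tau> R) (0 :: 'a)"
        unfolding scaled_gauss_density_def by (intro AE_I2 tendsto_mult tendsto_const tendsto_exp tendsto_power tendsto_norm X)
      show "AE R in N. norm (scaled_gauss_density (\<tau> R) (X k)) \<le> scaled_gauss_density (\<tau> R) (0 :: 'a)" for k
        by (intro AE_I2) (simp add: scaled_gauss_density_nonneg scaled_gauss_density_antimono)
    qed measurable
  qed
  moreover have "p 0 \<le> c"
    using nn0 c unfolding p_nn[symmetric] by simp
  ultimately show ?thesis
    using that[OF p_meas p_nonneg] p_anti by blast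
qed

section \<open>The radial density of the permanent\<close>

text \<open>Right multiplication by \<open>v\<close> multiplies all norms by \<open>|v|\<close>, so it is
  \<open>|v|\<close> times an isometry, and so is its adjoint. The lower bound tests the adjoint
  against \<open>\<xi> v^(-1)\<close>.\<close>

lemma lin_adj_right_mult:
  fixes v \<xi> :: "'k::{euclidean_space,real_normed_div_algebra}"
  shows "norm (\<Sum>e\<in>Basis. (\<xi> \<bullet> (e * v)) *\<^sub>R e) = norm \<xi> * norm v"
proof -
  define a where "a = (\<Sum>e\<in>Basis. (\<xi> \<bullet> (e * v)) *\<^sub>R e)"
  have adj: "x \<bullet> a = \<xi> \<bullet> (x * v)" for x
  proof -
    have "\<xi> \<bullet> (x * v) = \<xi> \<bullet> ((\<Sum>e\<in>Basis. (x \<bullet> e) *\<^sub>R e) * v)" by (simp add: euclidean_representation)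
    also have "\<dots> = (\<Sum>e\<in>Basis. (x \<bullet> e) * (\<xi> \<bullet> (e * v)))" by (simp add: sum_distrib_right inner_sum_right)
    finally show ?thesis by (simp add: a_def inner_sum_right mult.commute)
  qed
  have "norm a * norm a = a \<bullet> a" by (simp add: norm_eq_sqrt_inner)
  also have "\<dots> \<le> norm \<xi> * (norm a * norm v)"
    unfolding adj norm_mult[of a v, symmetric] by (rule norm_cauchy_schwarz)
  finally have "norm a \<le> norm \<xi> * norm v" by (cases "a = 0") (simp_all add: mult_ac)
  moreover have "norm \<xi> * norm v \<le> norm a"
  proof (cases "v = 0 \<or> \<xi> = 0")
    case False
    have "norm \<xi> * norm \<xi> = \<xi> \<bullet> \<xi>" by (simp add: norm_eq_sqrt_inner)
    also have "\<dots> = (\<xi> * inverse v) \<bullet> a" using False by (simp add: adj mult.assoc)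
    also have "\<dots> \<le> norm (\<xi> * inverse v) * norm a" by (rule norm_cauchy_schwarz)
    also have "\<dots> = norm \<xi> * (norm a / norm v)" by (simp add: norm_mult norm_inverse divide_inverse)
    finally show ?thesis using False by (simp add: field_simps)
  qed auto
  ultimately show ?thesis by (simp add: a_def)
qed

definition first_row_per :: "nat \<Rightarrow> 'k mat \<Rightarrow> 'k mat \<Rightarrow> 'k::{euclidean_space,real_normed_div_algebra}" where
  "first_row_per n R x = row_per n (\<lambda>ij. if ij \<in> {1} \<times> {1..n} then x ij else R ij)"

lemma lin_on_first_row_per: "1 \<le> n \<Longrightarrow> lin_on ({1} \<times> {1..n}) (first_row_per n R)"
  unfolding first_row_per_def[abs_def] by (rule lin_on_row_per[OF crossing_row]) auto

text \<open>The entry of the first row is the leftmost factor of every product.\<close>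

lemma first_row_per_single:
  assumes "1 \<le> n"
  shows "first_row_per n R (single (1, j) x) = x * first_row_per n R (single (1, j) 1)"
proof -
  have split: "prod_list (map (\<lambda>i. A (i, \<sigma> i)) [1..<Suc n]) = A (1, \<sigma> 1) * prod_list (map (\<lambda>i. A (i, \<sigma> i)) [2..<Suc n])"
    for A :: "'a mat" and \<sigma>
    using assms prod_list_split_at[of 1 n "\<lambda>i. A (i, \<sigma> i)"] by (simp add: numeral_2_eq_2 del: upt_Suc)
  have tail: "prod_list (map (\<lambda>i. if (i, \<sigma> i) \<in> {1} \<times> {1..n} then y (i, \<sigma> i) else R (i, \<sigma> i)) [2..<Suc n]) =
      prod_list (map (\<lambda>i. R (i, \<sigma> i)) [2..<Suc n])" for y :: "'a mat" and \<sigma>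
    by (intro arg_cong[where f = prod_list] map_cong) auto
  show ?thesis
    unfolding first_row_per_def row_per_def sum_distrib_left
  proof (rule sum.cong[OF refl])
    fix \<sigma> assume "\<sigma> \<in> {\<sigma>. \<sigma> permutes {1..n}}"
    then have "\<sigma> 1 \<in> {1..n}" using assms permutes_in_image[of \<sigma> "{1..n}" 1] by auto
    then show "prod_list (map (\<lambda>i. if (i, \<sigma> i) \<in> {1} \<times> {1..n} then single (1, j) x (i, \<sigma> i) else R (i, \<sigma> i)) [1..<Suc n]) =
        x * prod_list (map (\<lambda>i. if (i, \<sigma> i) \<in> {1} \<times> {1..n} then single (1, j) 1 (i, \<sigma> i) else R (i, \<sigma> i)) [1..<Suc n])"
      unfolding split[of "\<lambda>ij. if ij \<in> {1} \<times> {1..n} then _ ij else R ij"] tail by (simp add: single_def)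
  qed
qed

text \<open>Since the entries of the first row are multiplied by the minors from the right, the covariance
  of the permanent, given the other rows, is a multiple of the identity.\<close>

lemma first_row_per_isotropic:
  fixes R :: "'k::{euclidean_space,real_normed_div_algebra} mat"
  assumes n: "1 \<le> n" and s: "0 \<le> s"
  defines "I \<equiv> {1} \<times> {1..n}"
  defines "\<tau> \<equiv> sqrt (\<Sum>ij\<in>I. (norm (first_row_per n R (single ij 1)))\<^sup>2)"
  shows "(\<integral>\<^sup>+x. gexp s (a *\<^sub>R first_row_per n R x + c) \<partial>gauss_vec I) =
    (\<integral>\<^sup>+z. gexp s ((\<bar>a\<bar> * \<tau>) *\<^sub>R z + c) \<partial>gauss)"
proof -
  let ?U = "\<lambda>x. (\<bar>a\<bar> * \<tau>) *\<^sub>R x ()"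
  have T: "lin_on I (\<lambda>x. a *\<^sub>R first_row_per n R x)"
    unfolding I_def by (rule lin_on_scale[OF lin_on_first_row_per[OF n]])
  have U: "lin_on {()} ?U" by (simp add: lin_on_def scaleR_add_right)
  have "(norm (lin_adj (\<lambda>x. a *\<^sub>R first_row_per n R x) \<xi> ij))\<^sup>2 = a\<^sup>2 * (norm \<xi>)\<^sup>2 * (norm (first_row_per n R (single ij 1)))\<^sup>2"
    if ij: "ij \<in> I" for ij and \<xi> :: 'k
  proof -
    obtain j where j: "ij = (1, j)" using ij unfolding I_def by blast
    have "lin_adj (first_row_per n R) \<xi> ij = (\<Sum>e\<in>Basis. (\<xi> \<bullet> (e * first_row_per n R (single ij 1))) *\<^sub>R e)"
      unfolding lin_adj_def j by (intro sum.cong refl) (subst first_row_per_single[OF n], rule refl)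
    then show ?thesis by (simp add: lin_adj_scaleR lin_adj_right_mult power_mult_distrib mult_ac)
  qed
  then have "(\<Sum>ij\<in>I. (norm (lin_adj (\<lambda>x. a *\<^sub>R first_row_per n R x) \<xi> ij))\<^sup>2) = a\<^sup>2 * (norm \<xi>)\<^sup>2 * \<tau>\<^sup>2" for \<xi> :: 'k
    by (simp add: \<tau>_def sum_distrib_left sum_nonneg)
  moreover have "(\<Sum>i\<in>{()}. (norm (lin_adj ?U \<xi> i))\<^sup>2) = a\<^sup>2 * (norm \<xi>)\<^sup>2 * \<tau>\<^sup>2" for \<xi> :: 'k
    by (simp add: lin_adj_def single_def euclidean_representation scaleR_scaleR[symmetric] scaleR_sum_right[symmetric] power_mult_distrib mult_ac del: scaleR_scaleR)
  ultimately have "(\<integral>\<^sup>+x. gexp s (a *\<^sub>R first_row_per n R x + c) \<partial>gauss_vec I) =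
      (\<integral>\<^sup>+x. gexp s (?U x + c) \<partial>PiM {()} (\<lambda>_. gauss))"
    by (intro gauss_lin_on_eq_if_lin_adj[OF T _ U _ s]) (simp_all add: I_def)
  also have "\<dots> = (\<integral>\<^sup>+z. gexp s ((\<bar>a\<bar> * \<tau>) *\<^sub>R z + c) \<partial>gauss)"
    by (rule gauss_PiM.product_nn_integral_singleton[where f = "\<lambda>z. gexp s ((\<bar>a\<bar> * \<tau>) *\<^sub>R z + c)"]) simp
  finally show ?thesis .
qed

lemma kappa_eq_decay:
  assumes s: "0 < s"
  shows "decay d n * inverse ((s / fact n) powr (real d / 2)) = kappa n d * (pi / s) powr (real d / 2)"
  using s by (simp add: decay_def kappa_def powr_divide field_simps)

lemma laplace_per_le_kappa:
  assumes n: "1 \<le> n" and s: "0 < s"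
  shows "laplace_per TYPE('k::{euclidean_space,real_normed_div_algebra}) n (s / fact n) \<le>
    ennreal (kappa n DIM('k) * (pi / s) powr (real DIM('k) / 2))"
proof -
  have "0 < decay DIM('k) n"
    using n Gamma_real_pos[of "real DIM('k) / 2"] Gamma_real_pos[of "real DIM('k) / 2 * real n"] by (simp add: decay_def)
  then have "ennreal (decay DIM('k) n) * inverse (ennreal ((s / fact n) powr (real DIM('k) / 2))) =
      ennreal (kappa n DIM('k) * (pi / s) powr (real DIM('k) / 2))"
    unfolding kappa_eq_decay[OF s, symmetric] using s by (simp add: inverse_ennreal ennreal_mult)
  then show ?thesis using laplace_per_decay[OF n, of "s / fact n", where 'k = 'k] s by simp
qed

text \<open>Conditioning on rows 2 to n exhibits the law as a mixture of centred isotropic Gaussians.\<close>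

lemma permanent_radial_density:
  assumes n: "1 \<le> n"
  obtains p :: "'k::{euclidean_space,real_normed_div_algebra} \<Rightarrow> real" where
    "p \<in> borel_measurable borel" "\<And>x. 0 \<le> p x"
    "distr (gauss_vec (mat_idx n)) borel (\<lambda>A. row_per n A /\<^sub>R sqrt (fact n)) = density lborel (\<lambda>x. ennreal (p x))"
    "\<And>x y. norm x \<le> norm y \<Longrightarrow> p y \<le> p x" "Linf_norm p = ereal (p 0)" "p 0 \<le> kappa n DIM('k)"
proof -
  let ?\<Gamma> = "PiM (mat_idx n) (\<lambda>_. gauss :: 'k measure)"
  define I where "I = {1 :: nat} \<times> {1..n}"
  define K where "K = mat_idx n - I"
  have split: "finite K" "finite I" "K \<inter> I = {}" "K \<union> I = mat_idx n"
    using n by (auto simp: I_def K_def)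
  let ?N = "PiM K (\<lambda>_. gauss :: 'k measure)"
  define a where "a = inverse (sqrt (fact n))"
  have a: "0 < a" by (simp add: a_def)
  define \<tau> where "\<tau> R = \<bar>a\<bar> * sqrt (\<Sum>ij\<in>I. (norm (first_row_per n R (single ij 1) :: 'k))\<^sup>2)" for R
  define \<mu> where "\<mu> = distr ?\<Gamma> borel (\<lambda>A. a *\<^sub>R row_per n A)"
  have [measurable]: "row_per n \<in> borel_measurable ?\<Gamma>"
    by (rule measurable_row_per) (rule component_gauss)
  have \<mu>: "prob_space \<mu>" "sets \<mu> = sets borel"
  proof -
    have \<Gamma>: "prob_space ?\<Gamma>" by (intro prob_space_PiM gauss.prob_space_axioms)
    show "prob_space \<mu>"
      unfolding \<mu>_def by (rule prob_space.prob_space_distr[OF \<Gamma>]) measurable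
  qed (simp add: \<mu>_def)
  have transform: "gauss_transform \<mu> s w = (\<integral>\<^sup>+A. gexp s (a *\<^sub>R row_per n A - w) \<partial>?\<Gamma>)" for s w
    unfolding gauss_transform_def \<mu>_def by (subst nn_integral_distr) measurable
  show ?thesis
  proof (rule gaussian_mixture_density[OF \<mu>, of ?N \<tau> "kappa n DIM('k)"])
    show "prob_space ?N" by (intro prob_space_PiM gauss.prob_space_axioms)
    have "(\<lambda>R. first_row_per n R (single ij 1)) \<in> borel_measurable ?N" for ij
      unfolding first_row_per_def
    proof (rule measurable_row_per)
      fix kl assume "kl \<in> mat_idx n"
      then show "(\<lambda>R. if kl \<in> {1} \<times> {1..n} then single ij 1 kl else R kl) \<in> borel_measurable ?N"
        using component_gauss[of kl K] by (cases "kl \<in> {1} \<times> {1..n}") (auto simp: K_def I_def)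
    qed
    then show "\<tau> \<in> borel_measurable ?N" unfolding \<tau>_def by measurable
    show "0 \<le> \<tau> R" for R by (simp add: \<tau>_def sum_nonneg)
    show "0 \<le> kappa n DIM('k)"
      using n Gamma_real_pos[of "real DIM('k) / 2"] Gamma_real_pos[of "real DIM('k) * real n / 2"] by (simp add: kappa_def)
  next
    fix s :: real and w :: 'k assume s: "0 < s"
    have "gauss_transform \<mu> s w = (\<integral>\<^sup>+R. \<integral>\<^sup>+x. gexp s (a *\<^sub>R row_per n (merge K I (R, x)) - w) \<partial>gauss_vec I \<partial>?N)"
      unfolding transform by (rule nn_integral_PiM_gauss_split[OF split]) measurable
    also have "\<dots> = (\<integral>\<^sup>+R. \<integral>\<^sup>+x. gexp s (a *\<^sub>R first_row_per n R x + (- w)) \<partial>gauss_vec I \<partial>?N)"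
    proof -
      have "row_per n (merge K I (R, x)) = first_row_per n R x" for R x :: "'k mat"
        unfolding first_row_per_def by (rule row_per_cong) (auto simp: merge_def K_def I_def)
      then show ?thesis by simp
    qed
    also have "\<dots> = (\<integral>\<^sup>+R. \<integral>\<^sup>+z. gexp s (\<tau> R *\<^sub>R z + (- w)) \<partial>gauss \<partial>?N)"
      unfolding I_def \<tau>_def using s by (intro nn_integral_cong first_row_per_isotropic[OF n]) simp
    finally show "gauss_transform \<mu> s w = (\<integral>\<^sup>+R. \<integral>\<^sup>+z. gexp s (\<tau> R *\<^sub>R z - w) \<partial>gauss \<partial>?N)" by simp
  next
    fix s :: real assume s: "0 < s"
    have "gauss_transform \<mu> s 0 = laplace_per TYPE('k) n (s / fact n)"
      unfolding transform laplace_per_def by (simp add: a_def power_mult_distrib field_simps)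
    then show "gauss_transform \<mu> s 0 \<le> ennreal (kappa n DIM('k) * (pi / s) powr (real DIM('k) / 2))"
      using laplace_per_le_kappa[OF n s, where 'k = 'k] by simp
  next
    fix p :: "'k \<Rightarrow> real"
    assume "p \<in> borel_measurable borel" "\<And>x. 0 \<le> p x" "\<mu> = density lborel (\<lambda>x. ennreal (p x))"
      "\<And>x y. norm x \<le> norm y \<Longrightarrow> p y \<le> p x" "Linf_norm p = ereal (p 0)" "p 0 \<le> kappa n DIM('k)"
    then show thesis using that[of p] by (simp add: \<mu>_def a_def)
  qed
qed

section \<open>Density and small-ball bounds for shifted permanents\<close>

lemma measurable_row_per_add:
  "(\<lambda>x. row_per n (\<lambda>ij. fst x ij + snd x ij)) \<in>
     borel_measurable (mat_borel n \<Otimes>\<^sub>M (mat_borel n :: 'k::{euclidean_space,real_normed_div_algebra} mat measure))"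
proof (rule measurable_row_per)
  fix ij assume "ij \<in> mat_idx n"
  then have [measurable]: "(\<lambda>A. A ij) \<in> measurable (mat_borel n) (borel :: 'k measure)"
    unfolding mat_borel_def by (rule measurable_component_singleton)
  show "(\<lambda>x. fst x ij + snd x ij :: 'k) \<in> borel_measurable (mat_borel n \<Otimes>\<^sub>M mat_borel n)" by measurable
qed

text \<open>By independence one may integrate over \<open>G\<close> first, with \<open>Z\<close> fixed.\<close>

lemma shifted_ginibre_laplace_le:
  fixes Z G :: "'w \<Rightarrow> 'k::{euclidean_space,real_normed_div_algebra} mat"
  assumes n: "n \<ge> 1" and M: "prob_space M" and G: "std_ginibre M n G"
    and indep: "prob_space.indep_var M (mat_borel n) Z (mat_borel n) G" and s: "0 \<le> s"
  shows "(\<integral>\<^sup>+\<omega>. gexp s (row_per n (\<lambda>ij. Z \<omega> ij + G \<omega> ij) - w) \<partial>M) \<le> laplace_per TYPE('k) n s"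
proof -
  interpret prob_space M by fact
  have Z [measurable]: "Z \<in> measurable M (mat_borel n)" and G' [measurable]: "G \<in> measurable M (mat_borel n)"
    and joint: "distr M (mat_borel n) Z \<Otimes>\<^sub>M distr M (mat_borel n) G = distr M (mat_borel n \<Otimes>\<^sub>M mat_borel n) (\<lambda>\<omega>. (Z \<omega>, G \<omega>))"
    using indep by (auto simp: indep_var_distribution_eq)
  interpret DZ: prob_space "distr M (mat_borel n) Z" by (rule prob_space_distr[OF Z])
  interpret DG: prob_space "distr M (mat_borel n) G" by (rule prob_space_distr[OF G'])
  note [measurable] = measurable_row_per_add
  let ?F = "\<lambda>x. gexp s (row_per n (\<lambda>ij. fst x ij + snd x ij) - w)"
  have F: "?F \<in> borel_measurable (mat_borel n \<Otimes>\<^sub>M mat_borel n)" by measurable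
  have "(\<integral>\<^sup>+\<omega>. gexp s (row_per n (\<lambda>ij. Z \<omega> ij + G \<omega> ij) - w) \<partial>M) =
      (\<integral>\<^sup>+x. ?F x \<partial>distr M (mat_borel n \<Otimes>\<^sub>M mat_borel n) (\<lambda>\<omega>. (Z \<omega>, G \<omega>)))"
    using F by (subst nn_integral_distr) simp_all
  also have "\<dots> = (\<integral>\<^sup>+z. \<integral>\<^sup>+g. ?F (z, g) \<partial>distr M (mat_borel n) G \<partial>distr M (mat_borel n) Z)"
    unfolding joint[symmetric] by (rule DG.nn_integral_fst[symmetric]) (use F in simp)
  also have "\<dots> \<le> (\<integral>\<^sup>+z. laplace_per TYPE('k) n s \<partial>distr M (mat_borel n) Z)"
    unfolding distr_std_ginibre[OF M G n] fst_conv snd_conv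
    by (intro nn_integral_mono shifted_per_le_laplace_per n s)
  also have "\<dots> = laplace_per TYPE('k) n s"
    using DZ.emeasure_space_1 by simp
  finally show ?thesis .
qed

lemma has_density_imp_distr:
  assumes "has_density M X p"
  shows "p \<in> borel_measurable borel" "distr M borel X = density lborel (\<lambda>x. ennreal (p x))" "\<And>x. 0 \<le> p x"
proof -
  show nonneg: "\<And>x. 0 \<le> p x" using assms by (simp add: has_density_def)
  have d: "distributed M lborel X (\<lambda>x. ennreal (p x))" using assms by (simp add: has_density_def)
  have "(\<lambda>x. enn2real (ennreal (p x))) \<in> borel_measurable lborel"
    using distributed_borel_measurable[OF d] by measurable
  then show "p \<in> borel_measurable borel" using nonneg by simp
  show "distr M borel X = density lborel (\<lambda>x. ennreal (p x))"
    using distributed_distr_eq_density[OF d] by (simp cong: distr_cong)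
qed

lemma has_densityI:
  assumes "X \<in> borel_measurable M" "q \<in> borel_measurable borel" "\<And>x. 0 \<le> q x" "distr M borel X = density lborel (\<lambda>x. ennreal (q x))"
  shows "has_density M X q"
  using assms by (simp add: has_density_def distributed_def cong: distr_cong)

text \<open>Two densities of the same law agree almost everywhere. So the value at 0 of a radial density,
  which is its essential supremum, depends on the law alone.\<close>

lemma Linf_norm_unique:
  assumes p: "has_density M X p" and q: "has_density M X q"
  shows "Linf_norm p = Linf_norm q"
proof -
  note p = has_density_imp_distr[OF p] and q = has_density_imp_distr[OF q]
  have [measurable]: "p \<in> borel_measurable borel" "q \<in> borel_measurable borel" using p q by auto
  have "AE x in lborel. ennreal (p x) = ennreal (q x)"
    by (rule sigma_finite_measure.density_unique[OF sigma_finite_lborel]) (use p(2) q(2) in simp_all)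
  then have "AE x in lborel. ereal \<bar>p x\<bar> = ereal \<bar>q x\<bar>"
    by eventually_elim (use p q in simp)
  then show ?thesis unfolding Linf_norm_def by (intro esssup_AE_cong) auto
qed

theorem theorem4p1:
  fixes M :: "'w measure"
    and n :: nat
    and Z G :: "'w \<Rightarrow> 'k::{euclidean_space,real_normed_div_algebra} mat"
  assumes K: "real_complex_or_quaternion TYPE('k)"
    and n: "n \<ge> 1"
    and M: "prob_space M"
    and Z: "Z \<in> measurable M (mat_borel n)"
    and G: "std_ginibre M n G"
    and indep: "prob_space.indep_var M (mat_borel n) Z (mat_borel n) G"
  shows
    "(\<forall>w::'k. \<forall>s\<ge>0.
        (\<integral>\<omega>. exp (- s * (norm (row_per n (\<lambda>ij. Z \<omega> ij + G \<omega> ij) - w))\<^sup>2) \<partial>M)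
          \<le> (\<integral>\<omega>. exp (- s * (norm (row_per n (G \<omega>)))\<^sup>2) \<partial>M)) \<and>
     (\<exists>p. has_radial_density M (\<lambda>\<omega>. row_per n (G \<omega>) /\<^sub>R sqrt (fact n)) p) \<and>
     (\<exists>q. has_density M (\<lambda>\<omega>. row_per n (\<lambda>ij. Z \<omega> ij + G \<omega> ij) /\<^sub>R sqrt (fact n)) q \<and>
        (\<forall>p. has_radial_density M (\<lambda>\<omega>. row_per n (G \<omega>) /\<^sub>R sqrt (fact n)) p \<longrightarrow>
           Linf_norm q \<le> ereal (p 0) \<and> p 0 \<le> kappa n DIM('k))) \<and>
     (\<forall>\<epsilon>>0.
        (SUP w::'k. measure M {\<omega> \<in> space M.
            norm (row_per n (\<lambda>ij. Z \<omega> ij + G \<omega> ij) - w) \<le> \<epsilon> * sqrt (fact n)})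
          \<le> min 1 (unit_ball_vol (real DIM('k)) * kappa n DIM('k) * \<epsilon> ^ DIM('k)))"
proof -
  interpret prob_space M by fact
  let ?d = "real DIM('k)" and ?r = "sqrt (fact n)"
  define Y where "Y \<omega> = row_per n (\<lambda>ij. Z \<omega> ij + G \<omega> ij)" for \<omega>
  define P where "P \<omega> = row_per n (G \<omega>)" for \<omega>
  have G' [measurable]: "G \<in> measurable M (mat_borel n)" using G by (simp add: std_ginibre_def)
  note [measurable] = Z
  have "(\<lambda>\<omega>. (Z \<omega>, G \<omega>)) \<in> measurable M (mat_borel n \<Otimes>\<^sub>M mat_borel n)" by measurable
  from measurable_compose[OF this measurable_row_per_add]
  have Y [measurable]: "Y \<in> borel_measurable M" by (simp add: Y_def[abs_def])
  have per [measurable]: "row_per n \<in> borel_measurable (mat_borel n :: 'k mat measure)"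
    unfolding mat_borel_def by (rule measurable_row_per) (rule measurable_component_singleton)
  have P [measurable]: "P \<in> borel_measurable M" unfolding P_def[abs_def] by measurable
  have law: "(\<integral>\<^sup>+\<omega>. f (G \<omega>) \<partial>M) = (\<integral>\<^sup>+A. f A \<partial>gauss_vec (mat_idx n))"
    if "f \<in> borel_measurable (mat_borel n)" for f
    unfolding distr_std_ginibre[OF M G n, symmetric] using that by (intro nn_integral_distr[symmetric] G') simp

  have laplace_P: "(\<integral>\<^sup>+\<omega>. gexp s (P \<omega>) \<partial>M) = laplace_per TYPE('k) n s" for s
    unfolding P_def laplace_per_def by (rule law) measurable
  have laplace_Y: "(\<integral>\<^sup>+\<omega>. gexp s (Y \<omega> - w) \<partial>M) \<le> laplace_per TYPE('k) n s" if "0 \<le> s" for s w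
    unfolding Y_def by (rule shifted_ginibre_laplace_le[OF n M G indep that])
  have first: "(\<integral>\<omega>. exp (- s * (norm (Y \<omega> - w))\<^sup>2) \<partial>M) \<le> (\<integral>\<omega>. exp (- s * (norm (P \<omega>))\<^sup>2) \<partial>M)" if s: "0 \<le> s" for s w
  proof -
    have "integrable M (\<lambda>\<omega>. exp (- s * (norm (Y \<omega> - w))\<^sup>2))" "integrable M (\<lambda>\<omega>. exp (- s * (norm (P \<omega>))\<^sup>2))"
      using s by (auto intro!: integrable_const_bound[where B = 1])
    then have "ennreal (\<integral>\<omega>. exp (- s * (norm (Y \<omega> - w))\<^sup>2) \<partial>M) \<le> ennreal (\<integral>\<omega>. exp (- s * (norm (P \<omega>))\<^sup>2) \<partial>M)"
      using laplace_Y[OF s, of w] laplace_P[of s] by (simp add: nn_integral_eq_integral)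
    then show ?thesis by (simp add: ennreal_le_iff integral_nonneg_AE)
  qed

  obtain p where p: "p \<in> borel_measurable borel" "\<And>x. 0 \<le> p x"
    "distr (gauss_vec (mat_idx n)) borel (\<lambda>A. row_per n A /\<^sub>R ?r) = density lborel (\<lambda>x. ennreal (p x))"
    "\<And>x y :: 'k. norm x \<le> norm y \<Longrightarrow> p y \<le> p x" "Linf_norm p = ereal (p 0)" "p 0 \<le> kappa n DIM('k)"
    using permanent_radial_density[OF n] by blast
  have [measurable]: "p \<in> borel_measurable borel" by (rule p)
  have P_law: "distr M borel (\<lambda>\<omega>. P \<omega> /\<^sub>R ?r) = density lborel (\<lambda>x. ennreal (p x))"
    unfolding p(3)[symmetric] distr_std_ginibre[OF M G n, symmetric]
    by (subst distr_distr) (auto simp: comp_def P_def)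
  have p_radial: "has_radial_density M (\<lambda>\<omega>. P \<omega> /\<^sub>R ?r) p"
    unfolding has_radial_density_def using p P_law by (auto intro!: has_densityI)
  have kappa_nonneg: "0 \<le> kappa n DIM('k)" using p(2)[of 0] p(6) by simp

  define \<mu> where "\<mu> = distr M borel (\<lambda>\<omega>. Y \<omega> /\<^sub>R ?r)"
  have \<mu>: "prob_space \<mu>" "sets \<mu> = sets borel"
    unfolding \<mu>_def by (intro prob_space_distr) simp_all
  \<comment> \<open>The transform of the shifted law at any point is at most that of the unshifted law
    at 0, and the latter has a density bounded by \<open>p 0\<close>.\<close>
  have transform: "gauss_transform \<mu> s w \<le> ennreal (p 0 * (pi / s) powr (?d / 2))" if s: "0 < s" for s w
  proof -
    have scale: "(norm (x /\<^sub>R ?r - v))\<^sup>2 = (norm (x - ?r *\<^sub>R v))\<^sup>2 / fact n" for x v :: 'k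
    proof -
      have "x /\<^sub>R ?r - v = (x - ?r *\<^sub>R v) /\<^sub>R ?r" by (simp add: scaleR_diff_right)
      then show ?thesis by (simp add: power_mult_distrib divide_inverse power_inverse mult.commute)
    qed
    have "gauss_transform \<mu> s w = (\<integral>\<^sup>+\<omega>. gexp (s / fact n) (Y \<omega> - ?r *\<^sub>R w) \<partial>M)"
      unfolding gauss_transform_def \<mu>_def by (subst nn_integral_distr) (simp_all add: scale)
    also have "\<dots> \<le> laplace_per TYPE('k) n (s / fact n)"
      using s by (intro laplace_Y) simp
    also have "\<dots> = gauss_transform (distr M borel (\<lambda>\<omega>. P \<omega> /\<^sub>R ?r)) s 0"
      unfolding gauss_transform_def laplace_P[symmetric] by (subst nn_integral_distr) (simp_all only: scale, simp_all)
    also have "\<dots> = (\<integral>\<^sup>+x. ennreal (p x) * gexp s (x - 0) \<partial>lborel)"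
      unfolding gauss_transform_def P_law by (rule nn_integral_density) measurable
    also have "\<dots> \<le> (\<integral>\<^sup>+x. ennreal (p 0) * gexp s (x - 0 :: 'k) \<partial>lborel)"
      by (intro nn_integral_mono mult_right_mono ennreal_leI p(4)) auto
    also have "\<dots> = ennreal (p 0) * ennreal ((pi / s) powr (?d / 2))"
      by (subst nn_integral_cmult) (measurable, simp only: nn_integral_lborel_exp_neg_norm_square[OF s])
    also have "\<dots> = ennreal (p 0 * (pi / s) powr (?d / 2))" using p(2) by (simp add: ennreal_mult)
    finally show ?thesis .
  qed
  have \<mu>_le: "emeasure \<mu> A \<le> ennreal (p 0) * emeasure lborel A" if "A \<in> sets borel" for A
    by (rule gauss_transform_bound_imp_emeasure_le[OF prob_space_imp_sigma_finite[OF \<mu>(1)] \<mu>(2) p(2) transform that])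
  obtain q where q: "q \<in> borel_measurable borel" "\<And>x. 0 \<le> q x" "\<And>x. q x \<le> p 0" "\<mu> = density lborel (\<lambda>x. ennreal (q x))"
    using emeasure_le_imp_bounded_density[OF prob_space.finite_measure[OF \<mu>(1)] \<mu>(2) p(2) \<mu>_le] by blast
  have q_density: "has_density M (\<lambda>\<omega>. Y \<omega> /\<^sub>R ?r) q"
    using q by (intro has_densityI) (auto simp: \<mu>_def)
  have q_le: "Linf_norm q \<le> ereal (p 0)"
    unfolding Linf_norm_def using q by (intro esssup_I) auto
  have p_unique: "ereal (p' 0) = ereal (p 0)" if "has_radial_density M (\<lambda>\<omega>. P \<omega> /\<^sub>R ?r) p'" for p'
    using that p_radial Linf_norm_unique[of M "\<lambda>\<omega>. P \<omega> /\<^sub>R ?r" p' p] by (simp add: has_radial_density_def)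

  have ball: "measure M {\<omega> \<in> space M. norm (Y \<omega> - w) \<le> \<epsilon> * ?r} \<le> unit_ball_vol ?d * kappa n DIM('k) * \<epsilon> ^ DIM('k)"
    if \<epsilon>: "0 < \<epsilon>" for \<epsilon> w
  proof -
    have "norm (Y \<omega> - w) \<le> \<epsilon> * ?r \<longleftrightarrow> Y \<omega> /\<^sub>R ?r \<in> cball (w /\<^sub>R ?r) \<epsilon>" for \<omega>
    proof -
      have "dist (w /\<^sub>R ?r) (Y \<omega> /\<^sub>R ?r) = norm (Y \<omega> - w) / ?r"
        by (simp add: dist_norm scaleR_diff_right[symmetric] norm_minus_commute divide_inverse mult.commute)
      then show ?thesis by (simp add: pos_divide_le_eq)
    qed
    then have event: "{\<omega> \<in> space M. norm (Y \<omega> - w) \<le> \<epsilon> * ?r} = (\<lambda>\<omega>. Y \<omega> /\<^sub>R ?r) -` cball (w /\<^sub>R ?r) \<epsilon> \<inter> space M"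
      by blast
    have "emeasure M {\<omega> \<in> space M. norm (Y \<omega> - w) \<le> \<epsilon> * ?r} = emeasure \<mu> (cball (w /\<^sub>R ?r) \<epsilon>)"
      unfolding \<mu>_def event by (rule emeasure_distr[symmetric]) measurable
    also have "\<dots> \<le> ennreal (p 0) * emeasure lborel (cball (w /\<^sub>R ?r) \<epsilon>)" by (rule \<mu>_le) simp
    also have "\<dots> \<le> ennreal (kappa n DIM('k)) * emeasure lborel (cball (w /\<^sub>R ?r) \<epsilon>)"
      by (intro mult_right_mono ennreal_leI p) simp
    also have "\<dots> = ennreal (unit_ball_vol ?d * kappa n DIM('k) * \<epsilon> ^ DIM('k))"
      using \<epsilon> kappa_nonneg by (simp add: emeasure_cball ennreal_mult[symmetric] mult_ac)
    finally show ?thesis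
      using \<epsilon> kappa_nonneg by (simp add: emeasure_eq_measure ennreal_le_iff)
  qed
  have fourth: "(SUP w::'k. measure M {\<omega> \<in> space M. norm (Y \<omega> - w) \<le> \<epsilon> * ?r})
      \<le> min 1 (unit_ball_vol ?d * kappa n DIM('k) * \<epsilon> ^ DIM('k))" if "0 < \<epsilon>" for \<epsilon>
    by (rule cSUP_least) (simp_all add: ball[OF that])
  show ?thesis
    unfolding Y_def[symmetric] P_def[symmetric]
  proof (intro conjI allI impI exI)
    fix p' assume p': "has_radial_density M (\<lambda>\<omega>. P \<omega> /\<^sub>R ?r) p'"
    show "Linf_norm q \<le> ereal (p' 0)" using q_le p_unique[OF p'] by simp
    show "p' 0 \<le> kappa n DIM('k)" using p(6) p_unique[OF p'] by simp
  qed (use first p_radial q_density fourth in auto)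
qed

end
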